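(* Let $A$, $B$ be primitive nonsingular integer matrices with nonnegative entries. Choose a finite extension $E$ of the algebraic number field $F$ of the eigenvalues of $A$, $B$ in which all ideals of $F$ become principal, and consider primes in it. Let $\lambda,\lambda'$ be the Perron--Frobenius eigenvalues of $A,B$, let $v,v'$ be row Perron--Frobenius eigenvectors ($vA=\lambda v$, $v'B=\lambda' v'$) and $w,w'$ column Perron--Frobenius eigenvectors ($Aw=\lambda w$, $Bw'=\lambda' w'$), normalized so that all entries are algebraic integers with greatest common divisor $1$. Let $J$ be an isomorphism of ordered dimension groups from $G(A)$ to $G(B)$. (i) $J$ sends the row Perron--Frobenius eigenvector $v'$ of $B$ to a multiple $c$ times the row Perron--Frobenius eigenvector $v$ of $A$, i.e. $v'J=c\,v$. (ii) The two Perron--Frobenius eigenvalues generate the same algebraic number field and involve the same primes of that field. (iii) Assume that for each non-Perron--Frobenius eigenvalue $\mu$ of $A$ or $B$, the Perron--Frobenius eigenvalue $\lambda$ is divisible by some algebraic prime not dividing $\mu$. Then the Perron--Frobenius column eigenvector $w$ is mapped to a multiple $\xi$ times the other Perron--Frobenius column eigenvector $w'$, i.e. $Jw=\xi w'$. (iv) If $\lambda$ satisfies the hypothesis in (iii), then the coefficient $\xi$ factorizes into the primes dividing $\lambda$. (v) If $\lambda$ satisfies the hypothesis in (iii), then the coefficient $c$ factorizes into primes dividing $\lambda$. The inner products of left and right Perron--Frobenius eigenvectors are equal modulo normalization: $v'Jw'=c\,vw'=(c/\xi)\,vJw$. Therefore the inner product of the normalized Perron--Frobenius eigenvectors is an invariant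 up to units in the algebraic number ring generated by $1/\lambda$.
   Context: A square nonnegative integer matrix is primitive if all sufficiently high powers have only strictly positive entries. For a nonsingular primitive $N\times N$ matrix $A$, the dimension group is $G(A)=\bigcup_{n\ge 0}A^{-n}\mathbb{Z}^N\subset\mathbb{Q}^N$ (column vectors), ordered by the positive cone $\bigcup_{n\ge 0}A^{-n}(\mathbb{Z}_{\ge0}^N)$. If $G(A)$ and $G(B)$ are isomorphic then $A$ and $B$ have the same size $N$, and every isomorphism $G(A)\to G(B)$ of ordered groups has the form $g\mapsto Jg$ for a nonsingular matrix $J\in M_N(\mathbb{Q})$; the isomorphism is identified with $J$, which acts on column vectors by left multiplication and on row vectors by right multiplication. The Perron--Frobenius eigenvalue is the positive eigenvalue strictly dominating all others in absolute value. An algebraic prime is a prime (ideal) of the ring of algebraic integers of the number field under consideration.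
   Formalization: In (v), "units in the algebraic number ring generated by 1/λ" is taken as units of O_E[1/λ], O_E the algebraic integers of E; for Z[1/λ] the claim fails, since normalized eigenvectors are fixed only up to units of O_E (A=B=[2], E=Q(√2), v=w=w'=1, v'=1+√2). *)

theory Defs
  imports
    "Jordan_Normal_Form.Char_Poly"
    "Jordan_Normal_Form.VS_Connect"
    "HOL-Algebra.Divisibility"
    "HOL-Algebra.Ideal_Product"
    "HOL-Algebra.Generated_Rings"
    "HOL-Algebra.Generated_Fields"
    "HOL-Algebra.Embedded_Algebras"
begin

section \<open>Primitive matrices and Perron-Frobenius eigenvalues\<close>

definition primitive_mat :: "int mat \<Rightarrow> bool" where
  "primitive_mat A \<longleftrightarrow> square_mat A
     \<and> (\<forall>i < dim_row A. \<forall>j < dim_col A. 0 \<le> A $$ (i, j))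
     \<and> (\<exists>k0. \<forall>k \<ge> k0. \<forall>i < dim_row A. \<forall>j < dim_col A. 0 < (A ^\<^sub>m k) $$ (i, j))"

abbreviation cmat :: "int mat \<Rightarrow> complex mat" where
  "cmat A \<equiv> map_mat of_int A"

text \<open>Row vectors are represented by the same type as column vectors.\<close>
abbreviation row_mult :: "complex vec \<Rightarrow> complex mat \<Rightarrow> complex vec" (infixl "\<^sub>r*" 70) where
  "v \<^sub>r* M \<equiv> transpose_mat M *\<^sub>v v"

definition row_eigenvector :: "complex mat \<Rightarrow> complex vec \<Rightarrow> complex \<Rightarrow> bool" where
  "row_eigenvector M v k \<longleftrightarrow>
     v \<in> carrier_vec (dim_row M) \<and> v \<noteq> 0\<^sub>v (dim_row M) \<and> v \<^sub>r* M = k \<cdot>\<^sub>v v"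

definition pf_eigenvalue :: "int mat \<Rightarrow> complex \<Rightarrow> bool" where
  "pf_eigenvalue A l \<longleftrightarrow> eigenvalue (cmat A) l \<and> l \<in> \<real> \<and> 0 < Re l
     \<and> (\<forall>\<mu>. eigenvalue (cmat A) \<mu> \<longrightarrow> \<mu> \<noteq> l \<longrightarrow> cmod \<mu> < cmod l)"

section \<open>Dimension groups\<close>

text \<open>For nonsingular \<open>A\<close>, the set \<open>A\<^sup>-\<^sup>k \<int>\<^sup>N\<close> is the preimage of \<open>\<int>\<^sup>N\<close>
  under \<open>A\<^sup>k\<close>, which is how it is written here; likewise for the cone.\<close>

definition dim_group :: "int mat \<Rightarrow> rat vec set" where
  "dim_group A = (\<Union>k. {g \<in> carrier_vec (dim_row A).
     \<exists>z \<in> carrier_vec (dim_row A).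
       (map_mat of_int A ^\<^sub>m k) *\<^sub>v g = map_vec of_int (z :: int vec)})"

definition dim_group_cone :: "int mat \<Rightarrow> rat vec set" where
  "dim_group_cone A = (\<Union>k. {g \<in> carrier_vec (dim_row A).
     \<exists>z \<in> carrier_vec (dim_row A). (\<forall>i < dim_row A. 0 \<le> z $ i) \<and>
       (map_mat of_int A ^\<^sub>m k) *\<^sub>v g = map_vec of_int (z :: int vec)})"

definition dim_group_iso :: "int mat \<Rightarrow> int mat \<Rightarrow> (rat vec \<Rightarrow> rat vec) \<Rightarrow> bool" where
  "dim_group_iso A B h \<longleftrightarrow> bij_betw h (dim_group A) (dim_group B)
     \<and> (\<forall>x \<in> dim_group A. \<forall>y \<in> dim_group A. h (x + y) = h x + h y)
     \<and> (\<forall>x \<in> dim_group A. x \<in> dim_group_cone A \<longleftrightarrow> h x \<in> dim_group_cone B)"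

section \<open>Number fields inside the complex numbers\<close>

text \<open>Number fields are subfields of the field of complex numbers, which is the
  \<open>HOL-Algebra\<close> record \<open>class_ring\<close>.\<close>

definition gen_field :: "complex set \<Rightarrow> complex set" where
  "gen_field S = generate_field class_ring S"

definition finite_field_extension :: "complex set \<Rightarrow> complex set \<Rightarrow> bool" where
  "finite_field_extension F E \<longleftrightarrow>
     subfield F class_ring \<and> subfield E class_ring \<and> F \<subseteq> E
     \<and> ring.finite_dimension class_ring F E"

definition ring_of_integers :: "complex set \<Rightarrow> complex ring" where
  "ring_of_integers E = class_ring\<lparr>carrier := {x \<in> E. algebraic_int x}\<rparr>"

definition ideals_become_principal :: "complex set \<Rightarrow> complex set \<Rightarrow> bool" where
  "ideals_become_principal F E \<longleftrightarrow> (\<forall>I. ideal I (ring_of_integers F) \<longrightarrow>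
     principalideal (genideal (ring_of_integers E) I) (ring_of_integers E))"

text \<open>The zero ideal satisfies \<open>primeideal\<close> but is not a prime of a number field.
  A prime \<open>P\<close> divides an algebraic integer \<open>x\<close> iff \<open>x \<in> P\<close>.\<close>

definition nf_primes :: "complex set \<Rightarrow> complex set set" where
  "nf_primes E = {P. primeideal P (ring_of_integers E) \<and> P \<noteq> {0}}"

definition primes_dividing :: "complex set \<Rightarrow> complex \<Rightarrow> complex set set" where
  "primes_dividing E x = {P \<in> nf_primes E. x \<in> P}"

definition ideal_list_prod :: "complex set \<Rightarrow> complex set list \<Rightarrow> complex set" where
  "ideal_list_prod E Ps = foldr (ideal_prod (ring_of_integers E)) Ps (carrier (ring_of_integers E))"

text \<open>The fractional ideal of \<open>x\<close> is a product of integer powers of primes in \<open>S\<close>: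
  \<open>Qs\<close> lists the primes occurring with positive exponents and \<open>Ps\<close> those with negative
  exponents, and the denominators are cleared.\<close>

definition factorizes_into :: "complex set \<Rightarrow> complex set set \<Rightarrow> complex \<Rightarrow> bool" where
  "factorizes_into E S x \<longleftrightarrow> x \<in> E \<and> x \<noteq> 0
     \<and> (\<exists>Ps Qs. set Ps \<subseteq> S \<and> set Qs \<subseteq> S
          \<and> (\<lambda>y. x * y) ` ideal_list_prod E Ps = ideal_list_prod E Qs)"

text \<open>All entries are algebraic integers of \<open>E\<close>, and every common divisor of the
  entries is a unit.\<close>

definition normalized_vec :: "complex set \<Rightarrow> complex vec \<Rightarrow> bool" where
  "normalized_vec E v \<longleftrightarrow> (\<forall>i < dim_vec v. v $ i \<in> carrier (ring_of_integers E))
     \<and> (\<forall>d \<in> carrier (ring_of_integers E).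
          (\<forall>i < dim_vec v. d divides\<^bsub>ring_of_integers E\<^esub> v $ i)
          \<longrightarrow> d \<in> Units (ring_of_integers E))"

text \<open>The ring obtained by adjoining \<open>1/l\<close> to the ring of integers of \<open>E\<close>.
  Normalization determines eigenvectors only up to units of the ring of integers, so the
  latter has to be contained in the ring whose units are neglected.\<close>

definition integers_adjoin_inverse :: "complex set \<Rightarrow> complex \<Rightarrow> complex ring" where
  "integers_adjoin_inverse E l =
     class_ring\<lparr>carrier := generate_ring class_ring (insert (1 / l) (carrier (ring_of_integers E)))\<rparr>"

end

theory Submission
  imports
    Defs
    "Jordan_Normal_Form.Spectral_Radius"
    "HOL-Algebra.Finite_Extensions"
begin

text \<open>The positive row eigenvector of a primitive matrix spans the ray of all functionals that are
  nonnegative on the cone of its dimension group, so \<open>J\<close> carries the row eigenvector of \<open>B\<close> to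
  that of \<open>A\<close>. All integrality statements come from one observation: if a rational matrix \<open>G\<close> maps
  \<open>\<int>\<^sup>N\<close> into the dimension group of \<open>B\<close>, then \<open>B\<^sup>k G\<close> is an integer matrix for some \<open>k\<close>. For
  \<open>J\<close> and \<open>J\<inverse>\<close> it bounds the denominators of \<open>c\<close> and \<open>\<xi>\<close> by powers of \<open>\<lambda>\<close>. For \<open>J A\<^sup>-\<^sup>m\<close> it
  shows that \<open>J w\<close> is divisible by all powers of \<open>\<lambda>\<close>, whereas an eigenvector of \<open>B\<close> for
  \<open>\<mu>\<close> cannot be if some prime divides \<open>\<lambda>\<close> but not \<open>\<mu>\<close>. That an integer dividing a power of
  \<open>\<lambda>\<close> factorizes into primes dividing \<open>\<lambda>\<close> is unique factorization of ideals, for which it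
  suffices that the residue rings modulo positive integers are finite.\<close>

section \<open>Algebraic integers\<close>

text \<open>Rows and columns behave differently. The order determines the row eigenvector, so (i)
  holds whatever the other eigenvalues are; the column eigenvector has to be recognized by
  divisibility alone, which is where the hypothesis of (iii) enters. Normalization only says that
  common divisors are units, whereas the argument needs a Bezout identity, a combination of the
  entries equal to 1: it turns integrality of a multiple of the vector into integrality of the
  factor. This requires the ideal of the entries to be principal, hence the field \<open>E\<close>.
  As only ideals coming from \<open>F\<close> are known to become principal there, an eigenvector
  with entries in \<open>\<int>[\<lambda>]\<close> is constructed first. The integrality argument
  for \<open>J\<close> yields denominators that are powers of \<open>\<lambda>'\<close>, the one for
  its inverse powers of \<open>\<lambda>\<close>. Integrality of
  \<open>\<lambda>^d / \<lambda>'\<close> for some \<open>d\<close> converts the former into the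
  latter; together with its mirror image it also gives the equality of primes in (ii).\<close>

lemma eigenvalue_int_mat_algebraic_int:
  fixes M :: "int mat"
  assumes M: "M \<in> carrier_mat n n" and ev: "eigenvalue (cmat M) x"
  shows "algebraic_int x"
proof -
  interpret h: ring_hom "of_int :: int \<Rightarrow> complex" ..
  have "poly (char_poly (cmat M)) x = 0"
    using eigenvalue_root_char_poly[of "cmat M" n x] M ev by auto
  moreover have "char_poly (cmat M) = map_poly of_int (char_poly M)"
    by (rule of_int_hom.char_poly_hom[OF M])
  moreover have "monic (char_poly M)" using degree_monic_char_poly[OF M] by auto
  ultimately show ?thesis
    by (intro algebraic_int.intros[of "map_poly of_int (char_poly M)"]) auto
qed

text \<open>The determinant trick: the relations make the vector of the \<open>b i\<close> an
  eigenvector of an integer matrix for \<open>x\<close>, and \<open>nz\<close> keeps this vector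
  from being zero.\<close>

lemma algebraic_int_if_stabilizes:
  fixes b :: "nat \<Rightarrow> complex" and M :: "nat \<Rightarrow> nat \<Rightarrow> int"
  assumes nz: "k < n" "b k \<noteq> 0"
    and eq: "\<And>i. i < n \<Longrightarrow> x * b i = (\<Sum>j<n. of_int (M i j) * b j)"
  shows "algebraic_int x"
proof (rule eigenvalue_int_mat_algebraic_int)
  let ?M = "mat n n (\<lambda>(i, j). M i j)"
  show "?M \<in> carrier_mat n n" by simp
  show "eigenvalue (cmat ?M) x"
    unfolding eigenvalue_def eigenvector_def
  proof (intro exI[of _ "vec n b"] conjI)
    show "vec n b \<noteq> 0\<^sub>v (dim_row (cmat ?M))"
      using nz by (auto simp: vec_eq_iff)
    show "cmat ?M *\<^sub>v vec n b = x \<cdot>\<^sub>v vec n b"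
      by (auto simp: vec_eq_iff scalar_prod_def eq atLeast0LessThan intro!: sum.cong)
  qed simp
qed

section \<open>Finitely generated additive groups stable under multiplication by a number\<close>

definition zspan :: "(nat \<Rightarrow> complex) \<Rightarrow> nat \<Rightarrow> complex set" where
  "zspan b n = range (\<lambda>c. \<Sum>i<n. of_int (c i :: int) * b i)"

lemma zspan_add: "x \<in> zspan b n \<Longrightarrow> y \<in> zspan b n \<Longrightarrow> x + y \<in> zspan b n"
proof -
  assume "x \<in> zspan b n" "y \<in> zspan b n"
  then obtain c d where "x = (\<Sum>i<n. of_int (c i :: int) * b i)"
    "y = (\<Sum>i<n. of_int (d i :: int) * b i)" by (auto simp: zspan_def)
  then have "x + y = (\<Sum>i<n. of_int ((\<lambda>i. c i + d i) i) * b i)"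
    by (simp add: sum.distrib algebra_simps)
  then show ?thesis unfolding zspan_def by (rule range_eqI[where x = "\<lambda>i. c i + d i"])
qed

lemma zspan_of_int_mult: "x \<in> zspan b n \<Longrightarrow> of_int k * x \<in> zspan b n"
proof -
  assume "x \<in> zspan b n"
  then obtain c where "x = (\<Sum>i<n. of_int (c i :: int) * b i)" by (auto simp: zspan_def)
  then have "of_int k * x = (\<Sum>i<n. of_int ((\<lambda>i. k * c i) i) * b i)"
    by (simp add: sum_distrib_left mult.assoc)
  then show ?thesis unfolding zspan_def by (rule range_eqI[where x = "\<lambda>i. k * c i"])
qed

lemma zspan_0: "0 \<in> zspan b n"
  unfolding zspan_def by (rule range_eqI[of _ _ "\<lambda>_. 0"]) simp

lemma zspan_sum: "(\<And>i. i \<in> A \<Longrightarrow> f i \<in> zspan b n) \<Longrightarrow> sum f A \<in> zspan b n"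
  by (induction A rule: infinite_finite_induct) (auto simp: zspan_0 zspan_add)

lemma zspan_base: "i < n \<Longrightarrow> b i \<in> zspan b n"
  unfolding zspan_def
  by (rule range_eqI[of _ _ "\<lambda>j. if j = i then 1 else 0"])
     (simp add: if_distrib[of of_int] if_distrib[of "\<lambda>x. x * _"] sum.delta cong: if_cong)

lemma zspan_mult:
  assumes x: "\<And>i. i < n \<Longrightarrow> x * b i \<in> zspan b n" and z: "z \<in> zspan b n"
  shows "x * z \<in> zspan b n"
proof -
  obtain c where c: "z = (\<Sum>i<n. of_int (c i :: int) * b i)" using z by (auto simp: zspan_def)
  have "x * z = (\<Sum>i<n. of_int (c i) * (x * b i))"
    by (simp add: c sum_distrib_left algebra_simps)
  also have "\<dots> \<in> zspan b n"
    by (intro zspan_sum zspan_of_int_mult x) auto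
  finally show ?thesis .
qed

text \<open>Writing each \<open>x * b i\<close> in the generators yields the integer matrix of the
  determinant trick.\<close>

lemma algebraic_int_zspan:
  assumes nz: "k < n" "b k \<noteq> 0" and x: "\<And>i. i < n \<Longrightarrow> x * b i \<in> zspan b n"
  shows "algebraic_int x"
proof -
  have "\<forall>i. \<exists>c. i < n \<longrightarrow> x * b i = (\<Sum>j<n. of_int (c j :: int) * b j)"
    using x unfolding zspan_def by blast
  then obtain M :: "nat \<Rightarrow> nat \<Rightarrow> int"
    where "\<And>i. i < n \<Longrightarrow> x * b i = (\<Sum>j<n. of_int (M i j) * b j)" by metis
  then show ?thesis by (rule algebraic_int_if_stabilizes[of k n b x M, OF nz])
qed

lemma algebraic_int_power_reduce:
  fixes x :: complex
  assumes "algebraic_int x"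
  obtains m a where "0 < m" "x ^ m = (\<Sum>i<m. of_int (a i :: int) * x ^ i)"
proof -
  obtain p where p: "Polynomial.coeff p (Polynomial.degree p) = 1" "\<forall>i. Polynomial.coeff p i \<in> \<int>" "poly p x = 0"
    using assms by (auto simp: algebraic_int.simps)
  have deg: "Polynomial.degree p \<noteq> 0"
  proof
    assume "Polynomial.degree p = 0"
    then obtain a where "p = [:a:]" by (rule degree_eq_zeroE)
    then show False using p by simp
  qed
  have "\<forall>i. \<exists>a. - Polynomial.coeff p i = of_int a"
    using p(2) by (metis Ints_cases Ints_minus)
  then obtain a where a: "\<And>i. - Polynomial.coeff p i = of_int (a i)" by metis
  have "0 = (\<Sum>i<Polynomial.degree p. Polynomial.coeff p i * x ^ i) + x ^ Polynomial.degree p"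
    using p by (simp add: poly_altdef lessThan_Suc_atMost[symmetric])
  then have "x ^ Polynomial.degree p = (\<Sum>i<Polynomial.degree p. - (Polynomial.coeff p i * x ^ i))"
    by (simp add: sum_negf eq_neg_iff_add_eq_0 add.commute)
  also have "\<dots> = (\<Sum>i<Polynomial.degree p. of_int (a i) * x ^ i)"
    using a by (intro sum.cong) (auto simp flip: a)
  finally show ?thesis using that[of "Polynomial.degree p" a] deg by blast
qed

text \<open>The monomials \<open>x ^ i * y ^ j\<close> with \<open>i < m\<close> and
  \<open>j < k\<close> span a group stable under both numbers: an exponent that reaches
  \<open>m\<close> or \<open>k\<close> is lowered again by the integral equation of \<open>x\<close>
  or \<open>y\<close>.\<close>

lemma algebraic_int_common_module:
  fixes x y :: complex
  assumes "algebraic_int x" "algebraic_int y"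
  obtains b n where "0 < n" "b 0 = 1"
    "\<And>i. i < n \<Longrightarrow> x * b i \<in> zspan b n" "\<And>i. i < n \<Longrightarrow> y * b i \<in> zspan b n"
proof -
  obtain m a where m: "0 < m" "x ^ m = (\<Sum>i<m. of_int (a i :: int) * x ^ i)"
    using algebraic_int_power_reduce[OF assms(1)] .
  obtain k c where k: "0 < k" "y ^ k = (\<Sum>i<k. of_int (c i :: int) * y ^ i)"
    using algebraic_int_power_reduce[OF assms(2)] .
  \<comment> \<open>One index encodes both exponents, \<open>i div k\<close> for \<open>x\<close>
    and \<open>i mod k\<close> for \<open>y\<close>.\<close>
  define b where "b = (\<lambda>i. x ^ (i div k) * y ^ (i mod k))"
  have mem: "x ^ i * y ^ j \<in> zspan b (m * k)" if "i < m" "j < k" for i j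
  proof -
    have "i * k + j < m * k"
    proof -
      have "i * k + j < Suc i * k" using that by simp
      also have "\<dots> \<le> m * k" using that by (intro mult_right_mono) auto
      finally show ?thesis .
    qed
    moreover have "b (i * k + j) = x ^ i * y ^ j" using that by (simp add: b_def)
    ultimately show ?thesis using zspan_base by metis
  qed
  have ij: "i div k < m" "i mod k < k" if "i < m * k" for i
    using that k(1) by (auto simp: less_mult_imp_div_less)
  show ?thesis
  proof (rule that[of "m * k" b])
    show "0 < m * k" "b 0 = 1" using m k by (auto simp: b_def)
    fix i assume i: "i < m * k"
    show "x * b i \<in> zspan b (m * k)"
    proof (cases "Suc (i div k) < m")
      case True
      then show ?thesis using mem[OF True ij(2)[OF i]] by (simp add: b_def mult.assoc)
    next
      case False
      then have "Suc (i div k) = m" using ij(1)[OF i] by simp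
      then have "x * b i = x ^ m * y ^ (i mod k)" by (auto simp: b_def mult.assoc)
      also have "\<dots> = (\<Sum>l<m. of_int (a l) * (x ^ l * y ^ (i mod k)))"
        by (simp add: m(2) sum_distrib_right mult.assoc)
      also have "\<dots> \<in> zspan b (m * k)"
        by (intro zspan_sum zspan_of_int_mult mem ij(2)[OF i]) auto
      finally show ?thesis .
    qed
    show "y * b i \<in> zspan b (m * k)"
    proof (cases "Suc (i mod k) < k")
      case True
      then show ?thesis using mem[OF ij(1)[OF i] True] by (simp add: b_def algebra_simps)
    next
      case False
      then have "Suc (i mod k) = k" using ij(2)[OF i] by simp
      then have "y * b i = x ^ (i div k) * y ^ k"
        by (metis b_def mult.left_commute power_Suc)
      also have "\<dots> = (\<Sum>l<k. of_int (c l) * (x ^ (i div k) * y ^ l))"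
        by (simp add: k(2) sum_distrib_left algebra_simps)
      also have "\<dots> \<in> zspan b (m * k)"
        by (intro zspan_sum zspan_of_int_mult mem ij(1)[OF i]) auto
      finally show ?thesis .
    qed
  qed
qed

lemma algebraic_int_add:
  fixes x y :: complex
  assumes "algebraic_int x" "algebraic_int y"
  shows "algebraic_int (x + y)"
proof -
  obtain b n where b: "0 < n" "b 0 = 1" "\<And>i. i < n \<Longrightarrow> x * b i \<in> zspan b n"
    "\<And>i. i < n \<Longrightarrow> y * b i \<in> zspan b n"
    using algebraic_int_common_module[OF assms] by metis
  show ?thesis
    by (rule algebraic_int_zspan[of 0 n b]) (use b in \<open>auto simp: distrib_right intro: zspan_add\<close>)
qed

lemma algebraic_int_mult:
  fixes x y :: complex
  assumes "algebraic_int x" "algebraic_int y"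
  shows "algebraic_int (x * y)"
proof -
  obtain b n where b: "0 < n" "b 0 = 1" "\<And>i. i < n \<Longrightarrow> x * b i \<in> zspan b n"
    "\<And>i. i < n \<Longrightarrow> y * b i \<in> zspan b n"
    using algebraic_int_common_module[OF assms] by metis
  show ?thesis
    by (rule algebraic_int_zspan[of 0 n b])
      (use b in \<open>auto simp: mult.assoc intro!: zspan_mult[of n x b "y * _"]\<close>)
qed

lemma algebraic_int_diff:
  fixes x y :: complex
  shows "algebraic_int x \<Longrightarrow> algebraic_int y \<Longrightarrow> algebraic_int (x - y)"
  using algebraic_int_add[of x "- y"] by auto

lemma algebraic_int_power:
  fixes x :: complex
  shows "algebraic_int x \<Longrightarrow> algebraic_int (x ^ k)"
  by (induction k) (auto intro: algebraic_int_mult)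

text \<open>Cancelling powers of \<open>x\<close> in an integral equation leaves a nonzero constant term.\<close>
lemma algebraic_int_dvd_nat:
  fixes x :: complex
  assumes "algebraic_int x" "x \<noteq> 0"
  obtains N q where "0 < (N :: nat)" "of_nat N = x * poly (map_poly of_int q) x"
proof -
  obtain p where p: "Polynomial.coeff p (Polynomial.degree p) = 1" "poly (map_poly of_int p) x = (0::complex)"
    using assms(1) by (auto simp: algebraic_int_altdef_ipoly)
  have "\<exists>r. r \<noteq> 0 \<and> poly r 0 \<noteq> 0 \<and> poly (map_poly of_int r) x = (0::complex)"
    if "p \<noteq> 0" "poly (map_poly of_int p) x = (0::complex)" for p :: "int poly"
    using that
  proof (induction p rule: pCons_induct)
    case 0
    then show ?case by simp
  next
    case (pCons a p)
    show ?case
    proof (cases "a = 0")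
      case False
      then show ?thesis using pCons by (intro exI[of _ "pCons a p"]) auto
    next
      case True
      then show ?thesis using pCons assms(2) by (auto simp: map_poly_pCons)
    qed
  qed
  moreover have "p \<noteq> 0" using p by auto
  ultimately obtain r where r: "poly r 0 \<noteq> 0" "poly (map_poly of_int r) x = (0::complex)"
    using p(2) by blast
  obtain a q where aq: "r = pCons a q" by (cases r)
  have "of_int a = - x * poly (map_poly of_int q) x" "a \<noteq> 0"
    using r by (auto simp: aq map_poly_pCons eq_neg_iff_add_eq_0)
  \<comment> \<open>The sign of \<open>q\<close> is adapted to that of \<open>a\<close> so that the
    multiple of \<open>x\<close> is a positive integer.\<close>
  then have "of_nat (nat \<bar>a\<bar>) = x * poly (map_poly of_int (if a > 0 then - q else q)) x"
    by (cases "a > 0") (auto simp: hom_distribs)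
  then show ?thesis using that[of "nat \<bar>a\<bar>"] \<open>a \<noteq> 0\<close> by force
qed

section \<open>Rings of integers\<close>

lemma subfield_Rats: "subfield (\<rat> :: complex set) class_ring"
proof (rule field.subfieldI'[OF class_field])
  show "subring (\<rat> :: complex set) class_ring"
    by (rule ring.subringI[OF class_ring.ring_axioms]) (auto simp: class_ring_simps)
qed (auto simp: class_ring_simps)

locale complex_subfield =
  fixes E :: "complex set"
  assumes subfield_E: "subfield E class_ring"
begin

lemma E_0: "0 \<in> E" and E_1: "1 \<in> E"
  and E_add: "x \<in> E \<Longrightarrow> y \<in> E \<Longrightarrow> x + y \<in> E"
  and E_mult: "x \<in> E \<Longrightarrow> y \<in> E \<Longrightarrow> x * y \<in> E"
  using subringE(2,3,6,7)[OF subfieldE(1)[OF subfield_E]] by auto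

lemma E_uminus: "x \<in> E \<Longrightarrow> - x \<in> E"
  using subringE(5)[OF subfieldE(1)[OF subfield_E], of x] by (simp add: class_ring_simps)

lemma E_diff: "x \<in> E \<Longrightarrow> y \<in> E \<Longrightarrow> x - y \<in> E"
  using E_add[of x "- y"] E_uminus[of y] by simp

lemma E_inverse: "x \<in> E \<Longrightarrow> inverse x \<in> E"
proof (cases "x = 0")
  case False
  assume "x \<in> E"
  then show ?thesis
    using ring.subfield_m_inv(1)[OF class_ring.ring_axioms subfield_E, of x] False
    by (simp add: class_ring_simps)
qed auto

lemma E_divide: "x \<in> E \<Longrightarrow> y \<in> E \<Longrightarrow> x / y \<in> E"
  using E_mult[of x "inverse y"] E_inverse[of y] by (simp add: divide_inverse)

lemma E_of_nat: "of_nat k \<in> E"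
  by (induction k) (auto intro: E_0 E_1 E_add)

lemma E_of_int: "of_int k \<in> E"
  by (cases k) (auto intro: E_of_nat E_uminus E_diff E_1 simp del: of_nat_Suc)

lemma E_power: "x \<in> E \<Longrightarrow> x ^ k \<in> E"
  by (induction k) (auto intro: E_1 E_mult)

lemma E_sum: "(\<And>i. i \<in> A \<Longrightarrow> f i \<in> E) \<Longrightarrow> sum f A \<in> E"
  by (induction A rule: infinite_finite_induct) (auto intro: E_0 E_add)

lemma E_Rats: "\<rat> \<subseteq> E"
proof
  fix x :: complex assume "x \<in> \<rat>"
  then obtain a b where "x = of_int a / of_int b" by (elim Rats_cases') auto
  then show "x \<in> E" by (auto intro: E_divide E_of_int)
qed

abbreviation R where "R \<equiv> {x \<in> E. algebraic_int x}"

lemma R_0: "0 \<in> R" and R_1: "1 \<in> R"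
  and R_add: "x \<in> R \<Longrightarrow> y \<in> R \<Longrightarrow> x + y \<in> R"
  and R_mult: "x \<in> R \<Longrightarrow> y \<in> R \<Longrightarrow> x * y \<in> R"
  and R_uminus: "x \<in> R \<Longrightarrow> - x \<in> R"
  and R_diff: "x \<in> R \<Longrightarrow> y \<in> R \<Longrightarrow> x - y \<in> R"
  and R_power: "x \<in> R \<Longrightarrow> x ^ k \<in> R"
  and R_of_nat: "of_nat l \<in> R"
  and R_of_int: "of_int m \<in> R"
  by (auto intro: E_0 E_1 E_add E_mult E_uminus E_diff E_of_nat E_of_int E_power algebraic_int_add
      algebraic_int_mult algebraic_int_diff algebraic_int_power)

lemma R_sum: "(\<And>i. i \<in> A \<Longrightarrow> f i \<in> R) \<Longrightarrow> sum f A \<in> R"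
  by (induction A rule: infinite_finite_induct) (auto intro: E_0 E_add algebraic_int_add)

lemma ring_of_integers_simps [simp]:
  "carrier (ring_of_integers E) = R"
  "mult (ring_of_integers E) = (*)" "add (ring_of_integers E) = (+)"
  "one (ring_of_integers E) = 1" "zero (ring_of_integers E) = 0"
  by (simp_all add: ring_of_integers_def)

lemma subring_R: "subring R class_ring"
  by (rule ring.subringI[OF class_ring.ring_axioms])
     (use R_0 R_1 R_add R_mult R_uminus in \<open>auto simp: class_ring_simps\<close>)

lemma domain_R: "domain (ring_of_integers E)"
  unfolding ring_of_integers_def by (rule domain.subring_is_domain[OF class_field.domain_axioms subring_R])

sublocale roi: "domain" "ring_of_integers E" by (rule domain_R)

text \<open>Closure under negation is multiplication by \<open>-1\<close>, and commutativity makes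
  one-sided multiplication enough, so ideals can be handled by plain conditions on complex
  numbers.\<close>

lemma ideal_iff:
  "ideal I (ring_of_integers E) \<longleftrightarrow>
    I \<subseteq> R \<and> 0 \<in> I \<and> (\<forall>x\<in>I. \<forall>y\<in>I. x + y \<in> I) \<and> (\<forall>x\<in>I. \<forall>r\<in>R. r * x \<in> I)"
    (is "?L \<longleftrightarrow> ?Rh")
proof
  assume ?L
  then interpret ideal I "ring_of_integers E" .
  show ?Rh using a_subset zero_closed a_closed I_l_closed by auto
next
  assume *: ?Rh
  have inv: "\<ominus>\<^bsub>ring_of_integers E\<^esub> x = - x" if "x \<in> R" for x
    using R_uminus[OF that] that by (intro roi.minus_equality) auto
  show ?L
  proof (rule idealI)
    show "ring (ring_of_integers E)" by (rule roi.ring_axioms)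
    have "- x \<in> I" if "x \<in> I" for x
      using * that R_uminus[OF R_1] by (metis mult_minus1)
    then show "subgroup I (add_monoid (ring_of_integers E))"
      using * inv by (intro roi.add.subgroupI) (auto simp flip: a_inv_def)
  qed (use * in \<open>auto simp: mult.commute\<close>)
qed

lemma ideal_linearI:
  assumes "I \<subseteq> R" "0 \<in> I" and lin: "\<And>x y r. x \<in> I \<Longrightarrow> y \<in> I \<Longrightarrow> r \<in> R \<Longrightarrow> x + r * y \<in> I"
  shows "ideal I (ring_of_integers E)"
  unfolding ideal_iff using assms(1,2) lin[OF _ _ R_1] lin[OF assms(2)] by simp

lemma primeideal_iff:
  "primeideal I (ring_of_integers E) \<longleftrightarrow>
    ideal I (ring_of_integers E) \<and> 1 \<notin> I \<and> (\<forall>x\<in>R. \<forall>y\<in>R. x * y \<in> I \<longrightarrow> x \<in> I \<or> y \<in> I)"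
    (is "?L \<longleftrightarrow> ?Rh")
proof
  assume ?L
  then interpret primeideal I "ring_of_integers E" .
  show ?Rh using I_prime I_notcarr one_imp_carrier by (auto simp: ideal_axioms)
next
  assume *: ?Rh
  show ?L
    by (rule primeidealI) (use * R_1 roi.is_cring in auto)
qed

lemma ideal_multiple: "N \<in> I \<Longrightarrow> ideal I (ring_of_integers E) \<Longrightarrow> r \<in> R \<Longrightarrow> r * N \<in> I"
  by (simp add: ideal_iff)

lemma nf_primesD:
  assumes "P \<in> nf_primes E"
  shows "ideal P (ring_of_integers E)" "1 \<notin> P" "\<And>x y. x \<in> R \<Longrightarrow> y \<in> R \<Longrightarrow> x * y \<in> P \<Longrightarrow> x \<in> P \<or> y \<in> P"
  using assms unfolding nf_primes_def primeideal_iff by blast+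

lemma prime_power_mem:
  assumes "P \<in> nf_primes E" "x \<in> R" "x ^ k \<in> P"
  shows "x \<in> P"
  using assms(3)
proof (induction k)
  case 0
  then show ?case using nf_primesD[OF assms(1)] by simp
next
  case (Suc k)
  then show ?case using nf_primesD(3)[OF assms(1,2) R_power[OF assms(2)], of k] by auto
qed

lemma ideal_span:
  fixes x :: "nat \<Rightarrow> complex"
  assumes "\<And>i. i < n \<Longrightarrow> x i \<in> R"
  shows "ideal {\<Sum>i<n. r i * x i | r. \<forall>i<n. r i \<in> R} (ring_of_integers E)"
proof (rule ideal_linearI)
  let ?I = "{\<Sum>i<n. r i * x i | r. \<forall>i<n. r i \<in> R}"
  show "?I \<subseteq> R"
  proof
    fix a assume "a \<in> ?I"
    then obtain r where "a = (\<Sum>i<n. r i * x i)" "\<forall>i<n. r i \<in> R" by blast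
    moreover from this have "(\<Sum>i<n. r i * x i) \<in> R" using assms by (intro R_sum R_mult) auto
    ultimately show "a \<in> R" by simp
  qed
  show "0 \<in> ?I" using R_0 by (intro CollectI exI[of _ "\<lambda>_. 0"]) auto
  fix a b t assume "a \<in> ?I" "b \<in> ?I" and t: "t \<in> R"
  then obtain r s where r: "a = (\<Sum>i<n. r i * x i)" "\<forall>i<n. r i \<in> R"
    and s: "b = (\<Sum>i<n. s i * x i)" "\<forall>i<n. s i \<in> R" by blast
  have "a + t * b = (\<Sum>i<n. (r i + t * s i) * x i)"
    by (simp add: r s sum.distrib sum_distrib_left algebra_simps)
  moreover have "\<forall>i<n. r i + t * s i \<in> R" using r(2) R_mult[OF t] s(2) R_add by blast
  ultimately show "a + t * b \<in> ?I" by (intro CollectI exI[of _ "\<lambda>i. r i + t * s i"] conjI)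
qed

end

section \<open>Finiteness of the residue rings modulo positive integers\<close>

locale number_field = complex_subfield +
  assumes finite_dim_E: "ring.finite_dimension class_ring \<rat> E"
begin

lemma combine_eq_sum:
  "ring.combine class_ring Ks Us = (\<Sum>i<min (length Ks) (length Us). Ks ! i * (Us ! i :: complex))"
  by (induction Ks Us rule: ring.combine.induct[OF class_ring.ring_axioms])
     (auto simp: sum.lessThan_Suc_shift ring.combine.simps[OF class_ring.ring_axioms] simp del: sum.lessThan_Suc)

text \<open>\<open>d\<close> is the dimension of \<open>E\<close> over the rationals, so
  \<open>d + 1\<close> elements satisfy a rational relation; multiplication by the product of the
  denominators makes it integral.\<close>

lemma ex_int_dependence:
  obtains d where "\<And>x :: nat \<Rightarrow> complex. (\<And>i. i \<le> d \<Longrightarrow> x i \<in> E) \<Longrightarrow>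
    \<exists>c. (\<exists>i\<le>d. c i \<noteq> 0) \<and> (\<Sum>i\<le>d. of_int (c i :: int) * x i) = 0"
proof -
  obtain d where d: "ring.dimension class_ring d \<rat> E"
    using finite_dim_E by (auto simp: ring.finite_dimension_def[OF class_ring.ring_axioms])
  show ?thesis
  proof (rule that[of d])
    fix x :: "nat \<Rightarrow> complex" assume x: "\<And>i. i \<le> d \<Longrightarrow> x i \<in> E"
    define Us where "Us = map x [0..<Suc d]"
    have len: "length Us = Suc d" by (simp add: Us_def)
    have "\<not> ring.independent class_ring \<rat> Us"
      using ring.independent_length_le_dimension[OF class_ring.ring_axioms subfield_Rats d, of Us] x
      by (force simp: Us_def)
    then obtain Ks where Ks: "set Ks \<subseteq> \<rat>" "ring.combine class_ring Ks Us = 0"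
      "\<not> set (take (length Us) Ks) \<subseteq> {0}"
      using ring.trivial_combine_imp_independent[OF class_ring.ring_axioms subfield_Rats, of Us] by auto
    define q where "q i = (if i < length Ks then Ks ! i else 0)" for i
    have q: "q i \<in> \<rat>" for i using Ks(1) by (auto simp: q_def)
    have "(\<Sum>i\<le>d. q i * x i) = (\<Sum>i<min (length Ks) (Suc d). q i * x i)"
      by (rule sum.mono_neutral_right) (auto simp: q_def)
    also have "\<dots> = 0"
      using Ks(2) unfolding combine_eq_sum len
      by (auto simp: q_def Us_def nth_append simp del: upt_Suc intro!: sum.cong elim!: trans[rotated])
    finally have sum0: "(\<Sum>i\<le>d. q i * x i) = 0" .
    obtain i where i: "i < Suc d" "i < length Ks" "Ks ! i \<noteq> 0"
    proof -
      obtain y where "y \<in> set (take (length Us) Ks)" "y \<noteq> 0" using Ks(3) by blast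
      then obtain i where "i < length (take (length Us) Ks)" "take (length Us) Ks ! i \<noteq> 0"
        by (metis in_set_conv_nth)
      then show ?thesis using that[of i] by (simp add: len)
    qed
    have "\<forall>i. \<exists>b. b > 0 \<and> (\<exists>a. q i = of_int a / of_int (b :: int))"
      using q by (metis Rats_cases')
    then obtain b where b: "\<And>i. b i > 0" "\<And>i. \<exists>a. q i = of_int a / of_int (b i :: int)" by metis
    define D where "D = (\<Prod>i\<le>d. b i)"
    have D: "D > 0" using b(1) by (simp add: D_def prod_pos)
    have "\<forall>i. \<exists>c. i \<le> d \<longrightarrow> of_int D * q i = of_int c"
    proof (intro allI)
      fix i
      obtain a where a: "q i = of_int a / of_int (b i)" using b(2) by blast
      show "\<exists>c. i \<le> d \<longrightarrow> of_int D * q i = of_int c"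
      proof (cases "i \<le> d")
        case True
        then have "b i dvd D" unfolding D_def by (intro dvd_prodI) auto
        then obtain e where "D = b i * e" by blast
        then have "of_int D * q i = of_int (e * a)" using b(1)[of i] by (simp add: a)
        then show ?thesis by blast
      qed auto
    qed
    then obtain c where c: "\<And>i. i \<le> d \<Longrightarrow> of_int D * q i = of_int (c i)" by metis
    have "(\<Sum>i\<le>d. of_int (c i) * x i) = of_int D * (\<Sum>i\<le>d. q i * x i)"
      unfolding sum_distrib_left by (intro sum.cong) (auto simp flip: c)
    moreover have "of_int (c i) \<noteq> (0::complex)"
      using c[of i] i D by (auto simp: q_def simp flip: c)
    ultimately show "\<exists>c. (\<exists>i\<le>d. c i \<noteq> 0) \<and> (\<Sum>i\<le>d. of_int (c i :: int) * x i) = 0"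
      using sum0 i(1) by (intro exI[of _ c] conjI exI[of _ i]) auto
  qed
qed

text \<open>Descent: if \<open>p\<close> divides all coefficients, division by \<open>p\<close>
  leaves a nontrivial relation whose coefficients have a smaller sum of absolute values.\<close>

lemma ex_primitive_dependence:
  fixes d :: nat
  assumes p: "Factorial_Ring.prime (p :: int)"
    and "(\<exists>i\<le>d. c i \<noteq> 0) \<and> (\<Sum>i\<le>d. of_int (c i :: int) * x i) = (0 :: complex)"
  shows "\<exists>c. (\<exists>i\<le>d. \<not> p dvd c i) \<and> (\<Sum>i\<le>d. of_int (c i :: int) * x i) = 0"
  using assms(2)
proof (induction "nat (\<Sum>i\<le>d. \<bar>c i\<bar>)" arbitrary: c rule: less_induct)
  case less
  show ?case
  proof (cases "\<exists>i\<le>d. \<not> p dvd c i")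
    case True
    then show ?thesis using less.prems by blast
  next
    case False
    then have "\<forall>i. \<exists>e. i \<le> d \<longrightarrow> c i = p * e" by blast
    then obtain e where e: "\<And>i. i \<le> d \<Longrightarrow> c i = p * e i" by metis
    have p1: "p > 1" using p by (simp add: prime_gt_1_int)
    have "(\<Sum>i\<le>d. of_int (c i) * x i) = of_int p * (\<Sum>i\<le>d. of_int (e i) * x i)"
      unfolding sum_distrib_left by (intro sum.cong) (auto simp: e)
    then have e0: "(\<exists>i\<le>d. e i \<noteq> 0) \<and> (\<Sum>i\<le>d. of_int (e i :: int) * x i) = 0"
      using less.prems p1 e by (metis mult_eq_0_iff of_int_0_eq_iff order_less_irrefl
          zero_less_one_class.zero_less_one order.strict_trans)
    have "(\<Sum>i\<le>d. \<bar>c i\<bar>) = p * (\<Sum>i\<le>d. \<bar>e i\<bar>)"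
      unfolding sum_distrib_left using p1 by (intro sum.cong) (auto simp: e abs_mult)
    moreover have "(\<Sum>i\<le>d. \<bar>e i\<bar>) > 0"
    proof -
      obtain i where "i \<le> d" "e i \<noteq> 0" using e0 by blast
      then show ?thesis by (intro sum_pos2[of "{..d}" i]) auto
    qed
    ultimately have "nat (\<Sum>i\<le>d. \<bar>e i\<bar>) < nat (\<Sum>i\<le>d. \<bar>c i\<bar>)"
      using p1 by simp
    then show ?thesis using less.hyps[of e] e0 by blast
  qed
qed

text \<open>Representatives may be congruent to each other: all that is asked for is the finiteness
  of \<open>R / mR\<close>.\<close>

definition residue_system :: "int \<Rightarrow> complex set \<Rightarrow> bool" where
  "residue_system m S \<longleftrightarrow> finite S \<and> S \<subseteq> R \<and> (\<forall>x\<in>R. \<exists>s\<in>S. \<exists>y\<in>R. x = s + of_int m * y)"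

text \<open>A maximal family that is linearly independent modulo \<open>p\<close> spans \<open>R / pR\<close>, and its length
  is bounded because every longer family is dependent over the rationals.\<close>
lemma ex_residue_system_prime:
  assumes p: "Factorial_Ring.prime (p :: int)"
  shows "\<exists>S. residue_system p S"
proof -
  obtain d where d: "\<And>x :: nat \<Rightarrow> complex. (\<And>i. i \<le> d \<Longrightarrow> x i \<in> E) \<Longrightarrow>
    \<exists>c. (\<exists>i\<le>d. c i \<noteq> 0) \<and> (\<Sum>i\<le>d. of_int (c i :: int) * x i) = 0"
    using ex_int_dependence by blast
  \<comment> \<open>This is linear independence of the residues of
    \<open>x 0, ..., x (r - 1)\<close> over the field with \<open>p\<close> elements.\<close>
  define indep where "indep r x \<longleftrightarrow> (\<forall>i<r. x i \<in> R) \<and>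
     (\<forall>c. (\<exists>y\<in>R. (\<Sum>i<r. of_int (c i :: int) * x i) = of_int p * y) \<longrightarrow> (\<forall>i<r. p dvd c i))"
    for r and x :: "nat \<Rightarrow> complex"
  have bound: "r \<le> d" if ex: "\<exists>x. indep r x" for r
  proof (rule ccontr)
    assume "\<not> r \<le> d"
    obtain x where x: "indep r x" using ex by blast
    have "\<exists>c. (\<exists>i\<le>d. c i \<noteq> 0) \<and> (\<Sum>i\<le>d. of_int (c i :: int) * x i) = 0"
      using d[of x] x \<open>\<not> r \<le> d\<close> by (auto simp: indep_def)
    then obtain c where c: "\<exists>i\<le>d. \<not> p dvd c i" "(\<Sum>i\<le>d. of_int (c i :: int) * x i) = 0"
      using ex_primitive_dependence[OF p] by blast
    define c' where "c' i = (if i \<le> d then c i else 0)" for i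
    have "(\<Sum>i<r. of_int (c' i) * x i) = (\<Sum>i\<le>d. of_int (c i) * x i)"
      using \<open>\<not> r \<le> d\<close> by (intro sum.mono_neutral_cong_right) (auto simp: c'_def)
    then have "(\<Sum>i<r. of_int (c' i) * x i) = of_int p * 0" using c by simp
    then have "\<forall>i<r. p dvd c' i" using x R_0 unfolding indep_def by blast
    moreover obtain i where "i \<le> d" "\<not> p dvd c i" using c(1) by blast
    moreover have "i < r" using \<open>i \<le> d\<close> \<open>\<not> r \<le> d\<close> by simp
    ultimately have "p dvd c' i" by blast
    then show False using \<open>\<not> p dvd c i\<close> \<open>i \<le> d\<close> by (simp add: c'_def)
  qed
  have "\<exists>x. indep 0 x" by (simp add: indep_def)
  define r where "r = (GREATEST r. \<exists>x. indep r x)"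
  have "\<exists>x. indep r x"
    unfolding r_def by (rule GreatestI_nat[of "\<lambda>r. \<exists>x. indep r x", OF _ bound]) fact
  then obtain x where x: "indep r x" by blast
  have max: "s \<le> r" if "\<exists>x. indep s x" for s
    unfolding r_def by (rule Greatest_le_nat[of "\<lambda>r. \<exists>x. indep r x", OF that bound])
  define S where "S = (\<lambda>e. \<Sum>i<r. of_int (e i) * x i) ` (PiE {..<r} (\<lambda>_. {0..<p}))"
  have xR: "x i \<in> R" if "i < r" for i using x that by (simp add: indep_def)
  have "residue_system p S"
    unfolding residue_system_def
  proof (intro conjI ballI)
    show "finite S" unfolding S_def by (intro finite_imageI finite_PiE) auto
    show "S \<subseteq> R" unfolding S_def
      by (rule image_subsetI) (intro R_sum R_mult R_of_int xR, simp)
    fix z assume z: "z \<in> R"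
    \<comment> \<open>By maximality, appending \<open>z\<close> creates a relation modulo
      \<open>p\<close>. Its coefficient at \<open>z\<close> is prime to \<open>p\<close>, and
      inverting it modulo \<open>p\<close> expresses \<open>z\<close> by the family.\<close>
    have "\<not> indep (Suc r) (x(r := z))"
      using max by (meson Suc_n_not_le_n)
    then obtain c y where y: "y \<in> R" and
      c: "(\<Sum>i<Suc r. of_int (c i :: int) * (x(r := z)) i) = of_int p * y" "\<exists>i<Suc r. \<not> p dvd c i"
      using xR z unfolding indep_def by (auto simp: less_Suc_eq)
    have eq: "(\<Sum>i<r. of_int (c i) * x i) + of_int (c r) * z = of_int p * y"
      using c(1) by simp
    have "\<not> p dvd c r"
    proof
      assume "p dvd c r"
      then obtain t where t: "c r = p * t" by blast
      have "(\<Sum>i<r. of_int (c i) * x i) = of_int p * (y - of_int t * z)"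
        using eq by (simp add: t algebra_simps)
      moreover have "y - of_int t * z \<in> R" by (intro R_diff R_mult R_of_int y z)
      ultimately have "\<forall>i<r. p dvd c i" using x unfolding indep_def by blast
      then show False using c(2) \<open>p dvd c r\<close> by (auto simp: less_Suc_eq)
    qed
    then have "coprime p (c r)" using p by (simp add: prime_imp_coprime)
    then have "\<exists>a b. a * p + b * c r = 1"
      by (metis bezout_int coprime_iff_gcd_eq_1)
    then obtain a u where au: "a * p + u * c r = 1" by blast
    define g where "g i = - u * c i" for i
    have 1: "of_int a * of_int p + of_int u * of_int (c r) = (1::complex)"
      using arg_cong[OF au, of "of_int :: _ \<Rightarrow> complex"] by simp
    have "z = (of_int a * of_int p + of_int u * of_int (c r)) * z" using 1 by simp
    also have "\<dots> = of_int p * (of_int a * z) + of_int u * (of_int (c r) * z)"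
      by (simp add: algebra_simps)
    also have "of_int (c r) * z = of_int p * y - (\<Sum>i<r. of_int (c i) * x i)"
      using eq by (simp add: algebra_simps)
    also have "of_int u * \<dots> = of_int p * (of_int u * y) + (\<Sum>i<r. of_int (g i) * x i)"
      by (simp add: g_def algebra_simps sum_distrib_left sum_negf)
    \<comment> \<open>The remainders of the coefficients modulo \<open>p\<close> give an element of
      \<open>S\<close>, the quotients go into the multiple of \<open>p\<close>.\<close>
    also have "(\<Sum>i<r. of_int (g i) * x i)
      = (\<Sum>i<r. of_int (g i mod p) * x i + of_int p * (of_int (g i div p) * x i))"
    proof (intro sum.cong refl)
      fix i
      have "of_int (g i) = (of_int (g i mod p + p * (g i div p)) :: complex)" by simp
      also have "\<dots> = of_int (g i mod p) + of_int p * of_int (g i div p)"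
        unfolding of_int_add of_int_mult ..
      finally show "of_int (g i) * x i
        = of_int (g i mod p) * x i + of_int p * (of_int (g i div p) * x i)"
        by (simp add: algebra_simps)
    qed
    also have "\<dots> = (\<Sum>i<r. of_int (g i mod p) * x i) + of_int p * (\<Sum>i<r. of_int (g i div p) * x i)"
      by (simp add: sum.distrib sum_distrib_left)
    finally have "z = (\<Sum>i<r. of_int (g i mod p) * x i)
      + of_int p * (of_int a * z + of_int u * y + (\<Sum>i<r. of_int (g i div p) * x i))"
      by (simp add: algebra_simps)
    moreover have "of_int a * z + of_int u * y + (\<Sum>i<r. of_int (g i div p) * x i) \<in> R"
      by (intro R_add R_mult R_sum R_of_int z y xR) simp
    moreover have "(\<Sum>i<r. of_int (g i mod p) * x i) \<in> S"
      unfolding S_def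
      by (rule image_eqI[where x = "\<lambda>i\<in>{..<r}. g i mod p"])
         (use p prime_gt_0_int in auto)
    ultimately show "\<exists>s\<in>S. \<exists>y\<in>R. z = s + of_int p * y" by blast
  qed
  then show ?thesis by blast
qed

text \<open>For \<open>N = p * M\<close> an element is \<open>s + p * y\<close>, and
  \<open>y\<close> in turn is \<open>t + M * z\<close>; hence the representatives
  \<open>s + p * t\<close>.\<close>

lemma ex_residue_system:
  assumes "N > 0"
  shows "\<exists>S. residue_system (int N) S"
  using assms
proof (induction N rule: less_induct)
  case (less N)
  show ?case
  proof (cases "N = 1")
    case True
    have "residue_system 1 {0}"
      unfolding residue_system_def using R_0 by auto
    then show ?thesis using True by auto
  next
    case False
    then obtain p where p: "Factorial_Ring.prime p" "p dvd N" using prime_factor_nat by blast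
    then obtain M where M: "N = p * M" by blast
    have "M < N" "M > 0" using M less.prems p(1) prime_gt_1_nat[of p] by auto
    then obtain T where T: "residue_system (int M) T" using less.IH by blast
    obtain S where S: "residue_system (int p) S"
      using ex_residue_system_prime[of "int p"] p(1) by auto
    define U where "U = (\<lambda>(s, t). s + of_nat p * t) ` (S \<times> T)"
    have "residue_system (int N) U"
      unfolding residue_system_def
    proof (intro conjI ballI)
      show "finite U" using S T by (simp add: U_def residue_system_def)
      show "U \<subseteq> R" using S T unfolding residue_system_def U_def
        by (auto intro!: E_add E_mult E_of_nat algebraic_int_add algebraic_int_mult)
      fix x assume "x \<in> R"
      then obtain s y where s: "s \<in> S" "y \<in> R" "x = s + of_nat p * y"
        using S by (auto simp: residue_system_def)
      then obtain t z where t: "t \<in> T" "z \<in> R" "y = t + of_nat M * z"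
        using T unfolding residue_system_def by (metis of_int_of_nat_eq)
      have "x = (s + of_nat p * t) + of_int (int N) * z"
        by (simp add: s t M algebra_simps)
      then show "\<exists>u\<in>U. \<exists>y\<in>R. x = u + of_int (int N) * y"
        using s(1) t(1,2) unfolding U_def by force
    qed
    then show ?thesis by blast
  qed
qed

text \<open>An infinite sequence meets one of the finitely many residue classes modulo
  \<open>N\<close> twice.\<close>

lemma pigeonhole_mod:
  assumes "N > 0" and f: "\<And>i. f i \<in> R"
  obtains i j where "i < (j :: nat)" "(f j - f i) / of_nat N \<in> R"
proof -
  obtain S where S: "residue_system (int N) S" using ex_residue_system[OF assms(1)] by blast
  then have "\<forall>i. \<exists>s\<in>S. \<exists>y\<in>R. f i = s + of_nat N * y"
    using f by (auto simp: residue_system_def)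
  then obtain s y where s: "\<And>i. s i \<in> S" "\<And>i. y i \<in> R" "\<And>i. f i = s i + of_nat N * y i" by metis
  have "\<not> inj s"
    using S s(1) by (metis finite_subset residue_system_def image_subset_iff finite_imageD
        infinite_UNIV_nat)
  then obtain i j where ij: "i < j" "s i = s j"
    by (auto simp: inj_def) (metis linorder_neqE_nat)
  have "(f j - f i) / of_nat N = y j - y i"
    using assms(1) by (simp add: s(3) ij field_simps)
  then show ?thesis using that[OF ij(1)] R_diff[OF s(2) s(2)] by simp
qed

text \<open>\<open>R\<close> is completely integrally closed: by the pigeonhole principle \<open>x ^ j - x ^ i\<close>
  lies in \<open>R\<close> for some \<open>i < j\<close>.\<close>
lemma almost_integral_imp_integral:
  assumes "N > 0" "x \<in> E" and f: "\<And>k. of_nat N * x ^ k \<in> R"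
  shows "x \<in> R"
proof -
  obtain i j where ij: "i < j" "(of_nat N * x ^ j - of_nat N * x ^ i) / of_nat N \<in> R"
    using pigeonhole_mod[of N "\<lambda>k. of_nat N * x ^ k"] assms by blast
  have "(of_nat N * x ^ j - of_nat N * x ^ i) / of_nat N = x ^ j - x ^ i"
    using assms(1) by (simp add: field_simps)
  then have *: "algebraic_int (x ^ j - x ^ i)" using ij(2) by simp
  \<comment> \<open>The monic integer polynomial \<open>X ^ j - X ^ i\<close> takes an algebraic
    integer as its value at \<open>x\<close>, which makes \<open>x\<close> itself integral.\<close>
  define p :: "complex poly" where "p = Polynomial.monom 1 j - Polynomial.monom 1 i"
  have deg: "Polynomial.degree p = j"
    unfolding p_def diff_conv_add_uminus using ij(1)
    by (subst degree_add_eq_left) (auto simp: Polynomial.degree_monom_eq)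
  have "algebraic_int x"
  proof (rule algebraic_int_root[OF *])
    show "poly p x = x ^ j - x ^ i" by (simp add: p_def Polynomial.poly_monom)
    show "\<forall>k. Polynomial.coeff p k \<in> \<int>" by (auto simp: p_def)
    show "Polynomial.coeff p (Polynomial.degree p) = 1"
      unfolding deg using ij(1) by (simp add: p_def)
    show "Polynomial.degree p > 0" using ij(1) deg by simp
  qed
  then show ?thesis using assms(2) by simp
qed

end

section \<open>Factorization of ideals\<close>

context number_field
begin

abbreviation "OE \<equiv> ring_of_integers E"

lemma ideal_diff: "ideal I OE \<Longrightarrow> x \<in> I \<Longrightarrow> y \<in> I \<Longrightarrow> x - y \<in> I"
proof -
  assume I: "ideal I OE" "x \<in> I" "y \<in> I"
  have "(-1) * y \<in> I" using ideal_multiple[OF I(3,1) R_uminus[OF R_1]] .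
  then have "x + (-1) * y \<in> I" using I unfolding ideal_iff by blast
  then show ?thesis by simp
qed

lemma ideal_carrier: "ideal R OE"
  unfolding ideal_iff using R_0 R_add R_mult by blast

text \<open>An ideal containing \<open>N\<close> is determined by its trace on a finite residue system.\<close>
lemma ex_ideal_rank:
  assumes N: "N > (0::nat)"
  obtains rk :: "complex set \<Rightarrow> nat" and bd where
    "\<And>I. ideal I OE \<Longrightarrow> of_nat N \<in> I \<Longrightarrow> rk I \<le> bd"
    "\<And>I J. ideal I OE \<Longrightarrow> ideal J OE \<Longrightarrow> of_nat N \<in> I \<Longrightarrow> I \<subset> J \<Longrightarrow> rk I < rk J"
proof -
  obtain S where S: "residue_system (int N) S" using ex_residue_system[OF N] by blast
  show ?thesis
  proof (rule that[of "\<lambda>I. card (I \<inter> S)" "card S"])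
    show "card (I \<inter> S) \<le> card S" for I
      using S by (intro card_mono) (auto simp: residue_system_def)
    fix I J assume I: "ideal I OE" "ideal J OE" "of_nat N \<in> I" "I \<subset> J"
    obtain x where x: "x \<in> J" "x \<notin> I" using I(4) by blast
    have "x \<in> R" using x(1) I(2) by (auto simp: ideal_iff)
    then obtain s y where s: "s \<in> S" "y \<in> R" "x = s + of_nat N * y"
      using S by (auto simp: residue_system_def)
    have yI: "y * of_nat N \<in> I" using ideal_multiple[OF I(3,1) s(2)] .
    have "s = x - y * of_nat N" using s by simp
    then have "s \<in> J" using ideal_diff[OF I(2) x(1)] yI I(4) by blast
    have "s \<notin> I"
    proof
      assume "s \<in> I"
      then have "s + y * of_nat N \<in> I" using yI I(1) by (simp add: ideal_iff)
      then show False using x(2) s(3) by (simp add: mult.commute)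
    qed
    have "I \<inter> S \<subset> J \<inter> S" using I(4) \<open>s \<in> J\<close> \<open>s \<notin> I\<close> s(1) by blast
    then show "card (I \<inter> S) < card (J \<inter> S)"
      using S by (intro psubset_card_mono) (auto simp: residue_system_def)
  qed
qed

text \<open>The rank is bounded by \<open>bd\<close> and grows along strict inclusions, so
  \<open>bd - rk I\<close> is a measure for induction towards larger ideals.\<close>

lemma ideal_noetherian_induct [consumes 3, case_names step]:
  assumes "N > (0::nat)" "ideal I OE" "of_nat N \<in> I"
    and step: "\<And>I. ideal I OE \<Longrightarrow> of_nat N \<in> I \<Longrightarrow>
      (\<And>J. ideal J OE \<Longrightarrow> I \<subset> J \<Longrightarrow> P J) \<Longrightarrow> P I"
  shows "P I"
proof -
  obtain rk :: "complex set \<Rightarrow> nat" and bd where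
    rk: "\<And>I. ideal I OE \<Longrightarrow> of_nat N \<in> I \<Longrightarrow> rk I \<le> bd"
    "\<And>I J. ideal I OE \<Longrightarrow> ideal J OE \<Longrightarrow> of_nat N \<in> I \<Longrightarrow> I \<subset> J \<Longrightarrow> rk I < rk J"
    using ex_ideal_rank[OF assms(1)] by blast
  show ?thesis using assms(2,3)
  proof (induction "bd - rk I" arbitrary: I rule: less_induct)
    case less
    show ?case
    proof (rule step[OF less.prems])
      fix J assume J: "ideal J OE" "I \<subset> J"
      have NJ: "of_nat N \<in> J" using J(2) less.prems by blast
      have "rk I < rk J" "rk J \<le> bd"
        using rk(2)[OF less.prems(1) J(1) less.prems(2) J(2)] rk(1)[OF J(1) NJ] by auto
      then show "P J" using less.hyps[OF _ J(1) NJ] by simp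
    qed
  qed
qed

definition add_principal :: "complex set \<Rightarrow> complex \<Rightarrow> complex set" where
  "add_principal I x = {a + r * x | a r. a \<in> I \<and> r \<in> R}"

lemma ideal_add_principal:
  assumes I: "ideal I OE" and x: "x \<in> R"
  shows "ideal (add_principal I x) OE" "I \<subseteq> add_principal I x" "x \<in> add_principal I x"
proof -
  have "add_principal I x = I <+>\<^bsub>OE\<^esub> PIdl\<^bsub>OE\<^esub> x"
    unfolding add_principal_def set_add_def' cgenideal_def ring_of_integers_simps by blast
  then show "ideal (add_principal I x) OE"
    using roi.add_ideals[OF I roi.cgenideal_ideal[of x]] x by simp
  have "a = a + 0 * x" for a by simp
  then show "I \<subseteq> add_principal I x" unfolding add_principal_def using R_0 by blast
  have "x = 0 + 1 * x" "0 \<in> I" using I by (simp_all add: ideal_iff)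
  then show "x \<in> add_principal I x" unfolding add_principal_def using R_1 by blast
qed

text \<open>A nonzero algebraic integer \<open>x\<close> divides a positive integer, and the
  quotient, an integer polynomial in \<open>x\<close>, lies in \<open>R\<close>.\<close>

lemma nonzero_ideal_contains_nat:
  assumes "ideal I OE" "x \<in> I" "x \<noteq> 0"
  obtains N where "N > 0" "of_nat N \<in> I"
proof -
  have x: "x \<in> R" using assms by (auto simp: ideal_iff)
  then obtain N q where N: "0 < (N :: nat)" "of_nat N = x * poly (map_poly of_int q) x"
    using algebraic_int_dvd_nat[of x] assms(3) by auto
  have "poly (map_poly of_int q) x \<in> R"
    by (induction q) (use x in \<open>auto simp: map_poly_pCons intro!: E_0 E_add E_mult E_of_int algebraic_int_add algebraic_int_mult\<close>)
  then have "of_nat N \<in> I" using ideal_multiple[OF assms(2,1)] N(2) by (metis mult.commute)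
  then show ?thesis using that N(1) by blast
qed

lemma prime_contains_nat:
  assumes "P \<in> nf_primes E"
  obtains N where "N > 0" "of_nat N \<in> P"
proof -
  have P: "ideal P OE" "P \<noteq> {0}" using assms by (auto simp: nf_primes_def primeideal_iff)
  then obtain x where "x \<in> P" "x \<noteq> 0" by (auto simp: ideal_iff)
  then show ?thesis using nonzero_ideal_contains_nat[OF P(1)] that by blast
qed

text \<open>Powers of \<open>x\<close> repeat modulo an integer of \<open>P\<close>, so \<open>x\<close> is invertible modulo \<open>P\<close>
  unless it lies in \<open>P\<close>.\<close>
lemma nf_prime_invertible_mod:
  assumes P: "P \<in> nf_primes E" and x: "x \<in> R" "x \<notin> P"
  obtains y where "y \<in> R" "1 - x * y \<in> P"
proof -
  obtain N where N: "N > 0" "of_nat N \<in> P" using prime_contains_nat[OF P] .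
  obtain i j where ij: "i < (j :: nat)" "(x ^ j - x ^ i) / of_nat N \<in> R"
    using pigeonhole_mod[OF N(1), of "\<lambda>i. x ^ i"] R_power[OF x(1)] by blast
  have "x ^ j - x ^ i = (x ^ j - x ^ i) / of_nat N * of_nat N" using N by simp
  also have "\<dots> \<in> P" using ideal_multiple[OF N(2) nf_primesD(1)[OF P] ij(2)] .
  finally have "x ^ j - x ^ i \<in> P" .
  then have "(-1) * (x ^ j - x ^ i) \<in> P"
    by (rule ideal_multiple[OF _ nf_primesD(1)[OF P] R_uminus[OF R_1]])
  \<comment> \<open>The prime \<open>P\<close> contains one of the two factors. It cannot be
    \<open>x ^ i\<close>, so \<open>x ^ (j - i - 1)\<close> is the inverse modulo
    \<open>P\<close>.\<close>
  moreover have "(-1) * (x ^ j - x ^ i) = x ^ i * (1 - x * x ^ (j - i - 1))"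
  proof -
    have "x ^ j = x ^ i * (x * x ^ (j - i - 1))"
    proof -
      have "x ^ j = x ^ (i + Suc (j - i - 1))" using ij(1) by simp
      then show ?thesis by (simp only: power_add power_Suc)
    qed
    then show ?thesis by (simp add: algebra_simps)
  qed
  ultimately have "x ^ i \<in> P \<or> 1 - x * x ^ (j - i - 1) \<in> P"
    using nf_primesD(3)[OF P R_power[OF x(1)] R_diff[OF R_1 R_mult[OF x(1) R_power[OF x(1)]]]] by metis
  then show ?thesis using that[OF R_power[OF x(1)]] prime_power_mem[OF P x(1)] x(2) by blast
qed

text \<open>An element of \<open>I\<close> outside \<open>P\<close> is invertible modulo
  \<open>P\<close>, which puts 1 into \<open>I\<close>.\<close>

lemma nf_prime_maximal:
  assumes P: "P \<in> nf_primes E" and I: "ideal I OE" "P \<subset> I"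
  shows "I = R"
proof -
  obtain x where x: "x \<in> I" "x \<notin> P" using I(2) by blast
  have xR: "x \<in> R" using x I(1) by (auto simp: ideal_iff)
  obtain y where y: "y \<in> R" "1 - x * y \<in> P" using nf_prime_invertible_mod[OF P xR x(2)] .
  have "y * x \<in> I" using ideal_multiple[OF x(1) I(1) y(1)] .
  then have "(1 - x * y) + y * x \<in> I" using y(2) I unfolding ideal_iff by blast
  then have 1: "1 \<in> I" by (simp add: mult.commute)
  have "r \<in> I" if "r \<in> R" for r using ideal_multiple[OF 1 I(1) that] by simp
  then show ?thesis using I(1) by (auto simp: ideal_iff)
qed

section \<open>Products of ideals and prime ideals\<close>

lemma ideal_prod_subset:
  assumes "ideal K OE" "\<And>i j. i \<in> I \<Longrightarrow> j \<in> J \<Longrightarrow> i * j \<in> K"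
  shows "ideal_prod OE I J \<subseteq> K"
proof
  fix x assume "x \<in> ideal_prod OE I J"
  then show "x \<in> K"
    by (induction) (use assms in \<open>auto simp: ideal_iff\<close>)
qed

lemma ideal_prod_mult: "i \<in> I \<Longrightarrow> j \<in> J \<Longrightarrow> i * j \<in> ideal_prod OE I J"
  using ideal_prod.prod[of i I j J OE] by simp

lemma ideal_list_prod_simps:
  "ideal_list_prod E [] = R" "ideal_list_prod E (P # Ps) = ideal_prod OE P (ideal_list_prod E Ps)"
  by (simp_all add: ideal_list_prod_def)

lemma ideal_ideal_list_prod:
  "(\<And>P. P \<in> set Ps \<Longrightarrow> ideal P OE) \<Longrightarrow> ideal (ideal_list_prod E Ps) OE"
proof (induction Ps)
  case Nil
  then show ?case by (simp add: ideal_list_prod_simps ideal_carrier)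
next
  case (Cons P Ps)
  then show ?case by (simp add: ideal_list_prod_simps roi.ideal_prod_is_ideal)
qed

lemma ideal_list_prod_append:
  assumes "\<And>P. P \<in> set Ps \<union> set Qs \<Longrightarrow> ideal P OE"
  shows "ideal_list_prod E (Ps @ Qs) = ideal_prod OE (ideal_list_prod E Ps) (ideal_list_prod E Qs)"
  using assms
proof (induction Ps)
  case Nil
  then have I: "ideal (ideal_list_prod E Qs) OE" by (intro ideal_ideal_list_prod) auto
  show ?case
    using roi.ideal_prod_commute[OF I ideal_carrier] roi.ideal_prod_one[OF I]
    by (simp add: ideal_list_prod_simps)
next
  case (Cons P Ps)
  then show ?case
    by (simp add: ideal_list_prod_simps roi.ideal_prod_assoc ideal_ideal_list_prod)
qed

text \<open>Noether's argument: if \<open>x * y\<close> lies in \<open>I\<close> but neither factor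
  does, the prime products found inside \<open>I + R x\<close> and \<open>I + R y\<close> multiply
  into \<open>I\<close>.\<close>

lemma ex_prime_list_prod_subset:
  assumes "N > 0" "ideal I OE" "of_nat N \<in> I"
  shows "\<exists>Ps. set Ps \<subseteq> nf_primes E \<and> ideal_list_prod E Ps \<subseteq> I"
  using assms
proof (induction rule: ideal_noetherian_induct)
  case (step I)
  have N0: "(of_nat N :: complex) \<noteq> 0" using assms(1) by simp
  show ?case
  proof (cases "I = R")
    case True
    then show ?thesis by (intro exI[of _ "[]"]) (simp add: ideal_list_prod_simps)
  next
    case False
    then have I1: "1 \<notin> I" using step(1) by (force simp: ideal_iff)
    show ?thesis
    proof (cases "primeideal I OE")
      case True
      then have "I \<in> nf_primes E" using step(2) N0 by (auto simp: nf_primes_def)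
      moreover have "ideal_list_prod E [I] = I"
        using roi.ideal_prod_one[OF step(1)] by (simp add: ideal_list_prod_simps)
      ultimately show ?thesis by (intro exI[of _ "[I]"]) auto
    next
      case False
      then obtain x y where xy: "x \<in> R" "y \<in> R" "x * y \<in> I" "x \<notin> I" "y \<notin> I"
        using step(1) I1 unfolding primeideal_iff by blast
      note ax = ideal_add_principal[OF step(1) xy(1)] and ay = ideal_add_principal[OF step(1) xy(2)]
      obtain Ps where Ps: "set Ps \<subseteq> nf_primes E" "ideal_list_prod E Ps \<subseteq> add_principal I x"
        using step(3)[OF ax(1)] ax(2,3) xy(4) by blast
      obtain Qs where Qs: "set Qs \<subseteq> nf_primes E" "ideal_list_prod E Qs \<subseteq> add_principal I y"
        using step(3)[OF ay(1)] ay(2,3) xy(5) by blast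
      have "ideal_list_prod E (Ps @ Qs) = ideal_prod OE (ideal_list_prod E Ps) (ideal_list_prod E Qs)"
        using Ps(1) Qs(1) by (intro ideal_list_prod_append) (auto dest: nf_primesD)
      also have "\<dots> \<subseteq> I"
      proof (rule ideal_prod_subset[OF step(1)])
        fix u v assume "u \<in> ideal_list_prod E Ps" "v \<in> ideal_list_prod E Qs"
        then obtain a r b s where u: "u = a + r * x" "a \<in> I" "r \<in> R"
          and v: "v = b + s * y" "b \<in> I" "s \<in> R"
          using Ps(2) Qs(2) unfolding add_principal_def by blast
        have "v \<in> R" using v(2,3) step(1) xy(2) R_add[of b "s * y"] R_mult[of s y]
          unfolding v(1) ideal_iff by blast
        then have 1: "v * a \<in> I" using ideal_multiple[OF u(2) step(1)] by blast
        have 2: "(r * x) * b \<in> I" using ideal_multiple[OF v(2) step(1) R_mult[OF u(3) xy(1)]] .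
        have 3: "(r * s) * (x * y) \<in> I" using ideal_multiple[OF xy(3) step(1) R_mult[OF u(3) v(3)]] .
        have "u * v = v * a + ((r * x) * b + (r * s) * (x * y))"
          by (simp add: u(1) v(1) algebra_simps)
        then show "u * v \<in> I" using 1 2 3 step(1) unfolding ideal_iff by metis
      qed
      finally show ?thesis using Ps(1) Qs(1) by (intro exI[of _ "Ps @ Qs"]) auto
    qed
  qed
qed

text \<open>A prime containing a product contains one of the factors, and equals it because nonzero
  primes are maximal.\<close>

lemma prime_contains_factor:
  assumes P: "P \<in> nf_primes E" and Ps: "set Ps \<subseteq> nf_primes E" "ideal_list_prod E Ps \<subseteq> P"
  shows "P \<in> set Ps"
  using Ps
proof (induction Ps)
  case Nil
  then show ?case using nf_primesD(2)[OF P] R_1 by (auto simp: ideal_list_prod_simps)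
next
  case (Cons Q Ps)
  have Q: "Q \<in> nf_primes E" "ideal Q OE" "ideal (ideal_list_prod E Ps) OE"
    using Cons.prems by (auto dest: nf_primesD intro!: ideal_ideal_list_prod)
  have "primeideal P OE" using P by (simp add: nf_primes_def)
  then have "Q \<subseteq> P \<or> ideal_list_prod E Ps \<subseteq> P"
    using roi.primeideal_divides_ideal_prod[OF _ Q(2,3)] Cons.prems
    by (simp add: ideal_list_prod_simps)
  then show ?case
  proof
    assume "Q \<subseteq> P"
    moreover have "P \<noteq> R" using nf_primesD(2)[OF P] R_1 by blast
    ultimately have "Q = P"
      using nf_prime_maximal[OF Q(1) nf_primesD(1)[OF P]] by blast
    then show ?thesis by simp
  next
    assume "ideal_list_prod E Ps \<subseteq> P"
    then show ?thesis using Cons by auto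
  qed
qed

lemma ideal_principal:
  assumes "a \<in> R"
  shows "ideal ((\<lambda>r. a * r) ` R) OE"
  proof -
  have "(\<lambda>r. a * r) ` R = {\<Sum>i<1. r i * a | r :: nat \<Rightarrow> complex. \<forall>i<1. r i \<in> R}"
  proof (intro equalityI subsetI)
    fix x assume "x \<in> (\<lambda>r. a * r) ` R"
    then obtain r where r: "x = a * r" "r \<in> R" by blast
    show "x \<in> {\<Sum>i<1. r i * a | r :: nat \<Rightarrow> complex. \<forall>i<1. r i \<in> R}"
      by (intro CollectI exI[of _ "\<lambda>_. r"]) (use r in \<open>simp add: mult.commute\<close>)
  qed (auto simp: mult.commute)
  then show ?thesis
    using ideal_span[of 1 "\<lambda>_. a"] assms by (simp only: simp_thms)
qed

text \<open>The element \<open>z\<close> comes from a product of primes of minimal length inside \<open>N R\<close>, one of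
  whose factors is \<open>P\<close>.\<close>
lemma ex_fractional_inverse_element:
  assumes P: "P \<in> nf_primes E"
  obtains z where "z \<in> E" "z \<notin> R" "\<And>x. x \<in> P \<Longrightarrow> z * x \<in> R"
proof -
  obtain N where N: "N > 0" "of_nat N \<in> P" using prime_contains_nat[OF P] .
  define I where "I = (\<lambda>r. of_nat N * r) ` R"
  have I: "ideal I OE" unfolding I_def by (rule ideal_principal[OF R_of_nat])
  have "of_nat N = (of_nat N * 1 :: complex)" by simp
  then have NI: "of_nat N \<in> I" using R_1 unfolding I_def by blast
  define Q where "Q Ps \<longleftrightarrow> set Ps \<subseteq> nf_primes E \<and> ideal_list_prod E Ps \<subseteq> I" for Ps
  have "\<exists>Ps. Q Ps" unfolding Q_def by (rule ex_prime_list_prod_subset[OF N(1) I NI])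
  then obtain Ps where Ps: "Q Ps" and min: "\<And>Qs. length Qs < length Ps \<Longrightarrow> \<not> Q Qs"
    using exists_least_lemma[of "\<lambda>n. \<exists>Ps. length Ps = n \<and> Q Ps"]
    by (metis (mono_tags, lifting) measure_induct_rule[of length "\<lambda>Ps. \<not> Q Ps"])
  have "I \<subseteq> P"
    unfolding I_def using ideal_multiple[OF N(2) nf_primesD(1)[OF P]] by (auto simp: mult.commute)
  then have "P \<in> set Ps" using Ps by (intro prime_contains_factor[OF P]) (auto simp: Q_def)
  then obtain Us Vs where UV: "Ps = Us @ P # Vs" by (meson split_list)
  let ?L = "Us @ Vs"
  have L: "set ?L \<subseteq> nf_primes E" using Ps by (auto simp: Q_def UV)
  have ids: "\<And>P. P \<in> set Ps \<Longrightarrow> ideal P OE" using Ps by (auto simp: Q_def dest: nf_primesD)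
  have iU: "ideal (ideal_list_prod E Us) OE" and iV: "ideal (ideal_list_prod E Vs) OE"
    and iP: "ideal P OE"
    using ids by (auto simp: UV intro!: ideal_ideal_list_prod)
  have "ideal_list_prod E Ps = ideal_prod OE (ideal_list_prod E Us) (ideal_prod OE P (ideal_list_prod E Vs))"
    using ideal_list_prod_append[of Us "P # Vs"] ids
    by (simp add: UV ideal_list_prod_simps(2))
  also have "\<dots> = ideal_prod OE (ideal_prod OE (ideal_list_prod E Us) P) (ideal_list_prod E Vs)"
    by (rule roi.ideal_prod_assoc[OF iU iP iV, symmetric])
  also have "ideal_prod OE (ideal_list_prod E Us) P = ideal_prod OE P (ideal_list_prod E Us)"
    by (rule roi.ideal_prod_commute[OF iU iP])
  also have "ideal_prod OE (ideal_prod OE P (ideal_list_prod E Us)) (ideal_list_prod E Vs)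
    = ideal_prod OE P (ideal_list_prod E ?L)"
    using ideal_list_prod_append[of Us Vs] ids
    by (simp add: UV roi.ideal_prod_assoc[OF iP iU iV])
  finally have eq: "ideal_list_prod E Ps = ideal_prod OE P (ideal_list_prod E ?L)" .
  \<comment> \<open>The list without \<open>P\<close> is shorter, so by minimality its product
    contains some \<open>b\<close> outside \<open>N R\<close>, whereas \<open>P b\<close> lies
    inside. Hence \<open>b / N\<close> is not integral but carries \<open>P\<close> into
    \<open>R\<close>.\<close>
  have "\<not> Q ?L" using min by (simp add: UV)
  then obtain b where b: "b \<in> ideal_list_prod E ?L" "b \<notin> I" using L unfolding Q_def by blast
  have "ideal (ideal_list_prod E ?L) OE" using ids by (intro ideal_ideal_list_prod) (auto simp: UV)
  then have bR: "b \<in> R" using b(1) by (auto simp: ideal_iff)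
  define z where "z = b / of_nat N"
  show ?thesis
  proof (rule that[of z])
    show "z \<in> E" unfolding z_def using bR E_of_nat by (intro E_divide) auto
    show "z \<notin> R"
    proof
      assume "z \<in> R"
      moreover have "b = of_nat N * z" using N(1) by (simp add: z_def)
      ultimately show False using b(2) unfolding I_def by blast
    qed
    fix x assume "x \<in> P"
    then have "x * b \<in> ideal_list_prod E Ps" unfolding eq by (intro ideal_prod_mult b(1))
    then obtain r where "x * b = of_nat N * r" "r \<in> R"
      using Ps unfolding Q_def I_def by blast
    moreover from this have "z * x = r" using N(1) by (simp add: z_def field_simps)
    ultimately show "z * x \<in> R" by simp
  qed
qed

text \<open>If multiplication by \<open>z\<close> preserved \<open>I\<close>, all
  \<open>N * z ^ k\<close> would be integral, which forces \<open>z\<close> into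
  \<open>R\<close>.\<close>

lemma not_stable:
  assumes I: "ideal I OE" "N > 0" "of_nat N \<in> I" and z: "z \<in> E" "z \<notin> R"
  obtains x where "x \<in> I" "z * x \<notin> I"
proof (rule ccontr)
  assume "\<not> thesis"
  then have st: "\<And>x. x \<in> I \<Longrightarrow> z * x \<in> I" using that by blast
  have "of_nat N * z ^ k \<in> I" for k
  proof (induction k)
    case 0
    then show ?case using I by simp
  next
    case (Suc k)
    then show ?case using st[OF Suc] by (simp add: algebra_simps)
  qed
  then have "of_nat N * z ^ k \<in> R" for k using I(1) unfolding ideal_iff by blast
  then show False using almost_integral_imp_integral[OF I(2) z(1)] z(2) by blast
qed

text \<open>This is the product of \<open>I\<close> with the fractional ideal
  \<open>R + z R\<close>, which turns out to be the inverse of a prime. Forming the product inside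
  \<open>R\<close> keeps the argument within ordinary ideals.\<close>

lemma ideal_sum_scaled:
  assumes I: "ideal I OE" and zI: "\<And>x. x \<in> I \<Longrightarrow> z * x \<in> R"
  shows "ideal {a + z * b | a b. a \<in> I \<and> b \<in> I} OE"
proof (rule ideal_linearI)
  have I': "I \<subseteq> R" "0 \<in> I" "\<And>a b r. a \<in> I \<Longrightarrow> b \<in> I \<Longrightarrow> r \<in> R \<Longrightarrow> a + r * b \<in> I"
    using I by (simp_all add: ideal_iff subset_eq)
  show "{a + z * b | a b. a \<in> I \<and> b \<in> I} \<subseteq> R"
    using I'(1) zI by (auto intro!: E_add algebraic_int_add)
  have "0 = 0 + z * 0" by simp
  then show "0 \<in> {a + z * b | a b. a \<in> I \<and> b \<in> I}" using I'(2) by blast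
  fix x y r assume r: "r \<in> R" and "x \<in> {a + z * b | a b. a \<in> I \<and> b \<in> I}"
    "y \<in> {a + z * b | a b. a \<in> I \<and> b \<in> I}"
  then obtain a b c d where x: "x = a + z * b" "a \<in> I" "b \<in> I"
    and y: "y = c + z * d" "c \<in> I" "d \<in> I" by blast
  have "x + r * y = (a + r * c) + z * (b + r * d)" by (simp add: x y algebra_simps)
  then show "x + r * y \<in> {a + z * b | a b. a \<in> I \<and> b \<in> I}"
    using I'(3)[OF x(2) y(2) r] I'(3)[OF x(3) y(3) r] by blast
qed

text \<open>By \<open>not_stable\<close> the ideal \<open>P + z P\<close> is strictly larger than
  \<open>P\<close>, hence all of \<open>R\<close> by maximality. The equation for 1 says that
  \<open>R + z R\<close> is inverse to \<open>P\<close>.\<close>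

lemma fractional_inverse_partition:
  assumes P: "P \<in> nf_primes E" and z: "z \<in> E" "z \<notin> R" "\<And>x. x \<in> P \<Longrightarrow> z * x \<in> R"
  obtains p q where "p \<in> P" "q \<in> P" "1 = p + z * q"
proof -
  let ?K = "{a + z * b | a b. a \<in> P \<and> b \<in> P}"
  have iP: "ideal P OE" by (rule nf_primesD(1)[OF P])
  have 0: "0 \<in> P" using iP by (simp add: ideal_iff)
  obtain N where N: "N > 0" "of_nat N \<in> P" using prime_contains_nat[OF P] .
  have iK: "ideal ?K OE" by (rule ideal_sum_scaled[OF iP z(3)])
  obtain x where x: "x \<in> P" "z * x \<notin> P" using not_stable[OF iP N z(1,2)] .
  have "P \<subseteq> ?K"
  proof
    fix a assume "a \<in> P"
    then have "a = a + z * 0 \<and> a \<in> P" by simp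
    then show "a \<in> ?K" using 0 by blast
  qed
  moreover have "z * x = 0 + z * x" by simp
  then have "z * x \<in> ?K" using x(1) 0 by blast
  ultimately have "P \<subset> ?K" using x(2) by blast
  then have "?K = R" by (rule nf_prime_maximal[OF P iK])
  then have "1 \<in> ?K" using R_1 by simp
  then show ?thesis using that by blast
qed

text \<open>An ideal that is not prime can be enlarged and stays proper: if \<open>x * y\<close> is
  in \<open>I\<close> and \<open>1 = a + r * x\<close> with \<open>a\<close> in \<open>I\<close>,
  then \<open>y = y * a + r * (x * y)\<close> is in \<open>I\<close>.\<close>

lemma ex_prime_above:
  assumes "N > 0" "ideal I OE" "of_nat N \<in> I" "I \<noteq> R"
  shows "\<exists>P\<in>nf_primes E. I \<subseteq> P"
  using assms
proof (induction rule: ideal_noetherian_induct)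
  case (step I)
  have I1: "1 \<notin> I"
  proof
    assume "1 \<in> I"
    then have "r * 1 \<in> I" if "r \<in> R" for r using ideal_multiple[OF _ step(1) that] by blast
    then have "I = R" using step(1) by (auto simp: ideal_iff)
    then show False using step.prems by simp
  qed
  show ?case
  proof (cases "primeideal I OE")
    case True
    moreover have "I \<noteq> {0}" using step(2) assms(1) by auto
    ultimately show ?thesis by (auto simp: nf_primes_def)
  next
    case False
    then obtain x y where xy: "x \<in> R" "y \<in> R" "x * y \<in> I" "x \<notin> I" "y \<notin> I"
      using step(1) I1 unfolding primeideal_iff by blast
    note ax = ideal_add_principal[OF step(1) xy(1)]
    have IJ: "I \<subset> add_principal I x" using ax(2,3) xy(4) by blast
    have "add_principal I x \<noteq> R"
    proof
      assume "add_principal I x = R"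
      then have "1 \<in> add_principal I x" using R_1 by simp
      then obtain a r where ar: "1 = a + r * x" "a \<in> I" "r \<in> R" unfolding add_principal_def by blast
      have "y = y * (a + r * x)" using ar(1) by simp
      also have "\<dots> = y * a + r * (x * y)" by (simp add: algebra_simps)
      also have "\<dots> \<in> I"
        using ideal_multiple[OF ar(2) step(1) xy(2)] ideal_multiple[OF xy(3) step(1) ar(3)] step(1)
        unfolding ideal_iff by blast
      finally show False using xy(5) by simp
    qed
    then show ?thesis using step(3)[OF ax(1) IJ] IJ by blast
  qed
qed

text \<open>For a prime \<open>P\<close> above \<open>I\<close>, the ideal
  \<open>J = I + z I\<close> is \<open>I\<close> times the inverse of \<open>P\<close>. It is
  strictly larger and factorizes by induction; multiplying by \<open>P\<close> returns to
  \<open>I\<close>.\<close>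

theorem ideal_factorization:
  assumes "N > 0" "ideal I OE" "of_nat N \<in> I"
  shows "\<exists>Ps. set Ps \<subseteq> nf_primes E \<and> ideal_list_prod E Ps = I"
  using assms
proof (induction rule: ideal_noetherian_induct)
  case (step I)
  show ?case
  proof (cases "I = R")
    case True
    then show ?thesis by (intro exI[of _ "[]"]) (simp add: ideal_list_prod_simps)
  next
    case False
    obtain P where P: "P \<in> nf_primes E" "I \<subseteq> P"
      using ex_prime_above[OF assms(1) step(1,2) False] by blast
    obtain z where z: "z \<in> E" "z \<notin> R" "\<And>x. x \<in> P \<Longrightarrow> z * x \<in> R"
      using ex_fractional_inverse_element[OF P(1)] by metis
    obtain p q where pq: "p \<in> P" "q \<in> P" "1 = p + z * q"
      using fractional_inverse_partition[OF P(1) z] .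
    define J where "J = {a + z * b | a b. a \<in> I \<and> b \<in> I}"
    have iP: "ideal P OE" by (rule nf_primesD(1)[OF P(1)])
    have I0: "0 \<in> I" using step(1) by (simp add: ideal_iff)
    have iJ: "ideal J OE" unfolding J_def using P(2) z(3) by (intro ideal_sum_scaled step(1)) auto
    have IJ: "I \<subseteq> J"
    proof
      fix a assume "a \<in> I"
      then have "a = a + z * 0 \<and> a \<in> I" by simp
      then show "a \<in> J" unfolding J_def using I0 by blast
    qed
    have zJ: "z * b \<in> J" if "b \<in> I" for b
    proof -
      have "z * b = 0 + z * b" by simp
      then show ?thesis unfolding J_def using that I0 by blast
    qed
    obtain x where x: "x \<in> I" "z * x \<notin> I" using not_stable[OF step(1) assms(1) step(2) z(1,2)] .
    have "I \<subset> J" using IJ zJ[OF x(1)] x(2) by blast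
    then obtain Qs where Qs: "set Qs \<subseteq> nf_primes E" "ideal_list_prod E Qs = J"
      using step(3)[OF iJ] by blast
    have "ideal_prod OE P J = I"
    proof
      show "ideal_prod OE P J \<subseteq> I"
      proof (rule ideal_prod_subset[OF step(1)])
        fix u v assume u: "u \<in> P" and "v \<in> J"
        then obtain a b where v: "v = a + z * b" "a \<in> I" "b \<in> I" by (auto simp: J_def)
        have uR: "u \<in> R" using u iP by (auto simp: ideal_iff)
        have "u * v = u * a + (z * u) * b" by (simp add: v algebra_simps)
        moreover have "u * a \<in> I" "(z * u) * b \<in> I"
          using ideal_multiple[OF v(2) step(1) uR] ideal_multiple[OF v(3) step(1) z(3)[OF u]] by auto
        ultimately show "u * v \<in> I" using step(1) by (simp add: ideal_iff)
      qed
      show "I \<subseteq> ideal_prod OE P J"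
      proof
        fix y assume y: "y \<in> I"
        \<comment> \<open>The decomposition of 1 splits \<open>y\<close> into two products of an
          element of \<open>P\<close> and one of \<open>J\<close>.\<close>
        have "y = (p + z * q) * y" using pq(3) by simp
        also have "\<dots> = p * y + q * (z * y)" by (simp add: algebra_simps)
        also have "\<dots> \<in> ideal_prod OE P J"
          using ideal_prod.sum[OF ideal_prod_mult ideal_prod_mult, of p P y J q "z * y"]
            pq(1,2) y IJ zJ by auto
        finally show "y \<in> ideal_prod OE P J" .
      qed
    qed
    then show ?thesis using P(1) Qs
      by (intro exI[of _ "P # Qs"]) (simp add: ideal_list_prod_simps)
  qed
qed

text \<open>Every prime factor of \<open>a R\<close> contains \<open>a\<close>, hence
  \<open>l ^ k\<close>, hence \<open>l\<close>.\<close>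

lemma principal_factorization:
  assumes a: "a \<in> R" "a \<noteq> 0" and l: "l \<in> R" "b \<in> R" "a * b = l ^ k"
  obtains Ps where "set Ps \<subseteq> primes_dividing E l" "ideal_list_prod E Ps = (\<lambda>r. a * r) ` R"
proof -
  have I: "ideal ((\<lambda>r. a * r) ` R) OE" by (rule ideal_principal[OF a(1)])
  have aI: "a \<in> (\<lambda>r. a * r) ` R" by (rule image_eqI[of _ _ 1]) (use R_1 in auto)
  obtain N where N: "N > 0" "of_nat N \<in> (\<lambda>r. a * r) ` R"
    using nonzero_ideal_contains_nat[OF I aI a(2)] .
  obtain Ps where Ps: "set Ps \<subseteq> nf_primes E" "ideal_list_prod E Ps = (\<lambda>r. a * r) ` R"
    using ideal_factorization[OF N(1) I N(2)] by blast
  have sub: "ideal_list_prod E Ps \<subseteq> P" if "P \<in> set Ps" "set Ps \<subseteq> nf_primes E" for P Ps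
    using that
  proof (induction Ps)
    case (Cons Q Ps)
    have Q: "ideal Q OE" "ideal (ideal_list_prod E Ps) OE"
      using Cons.prems by (auto dest: nf_primesD intro!: ideal_ideal_list_prod)
    have "ideal_list_prod E (Q # Ps) \<subseteq> Q \<inter> ideal_list_prod E Ps"
      using roi.ideal_prod_inter[OF Q] by (simp add: ideal_list_prod_simps)
    then show ?case using Cons by auto
  qed simp
  have "l \<in> P" if P: "P \<in> set Ps" for P
  proof -
    have nP: "P \<in> nf_primes E" using P Ps by blast
    have "l ^ k \<in> (\<lambda>r. a * r) ` R" using l(2,3) by (intro image_eqI[of _ _ b]) auto
    then have "l ^ k \<in> P" using sub[OF P Ps(1)] Ps(2) by blast
    then show ?thesis by (rule prime_power_mem[OF nP l(1)])
  qed
  then have "set Ps \<subseteq> primes_dividing E l" using Ps(1) by (auto simp: primes_dividing_def)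
  then show ?thesis using that Ps(2) by blast
qed

text \<open>The integer \<open>a = l ^ k * x\<close> divides \<open>l ^ (2 * k)\<close>, so both
  \<open>a R\<close> and \<open>l ^ k R\<close> are products of primes dividing \<open>l\<close>;
  the second one is the denominator that has been cleared.\<close>

theorem factorizes_into_if_unit_outside:
  assumes x: "x \<in> E" "x \<noteq> 0" and l: "l \<in> R" "l \<noteq> 0"
    and "l ^ k * x \<in> R" "l ^ k / x \<in> R"
  shows "factorizes_into E (primes_dividing E l) x"
proof -
  define a where "a = l ^ k * x"
  have a: "a \<in> R" "a \<noteq> 0" using assms by (auto simp: a_def)
  have ab: "a * (l ^ k / x) = l ^ (2 * k)"
    using x by (simp add: a_def power_mult power2_eq_square power_mult_distrib mult_2 power_add)
  obtain Qs where Qs: "set Qs \<subseteq> primes_dividing E l" "ideal_list_prod E Qs = (\<lambda>r. a * r) ` R"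
    using principal_factorization[OF a l(1) assms(6) ab] .
  have lk: "l ^ k \<in> R" "l ^ k \<noteq> 0" "l ^ k * 1 = l ^ k" using R_power[OF l(1)] l(2) by auto
  obtain Ps where Ps: "set Ps \<subseteq> primes_dividing E l" "ideal_list_prod E Ps = (\<lambda>r. l ^ k * r) ` R"
    using principal_factorization[OF lk(1,2) l(1) R_1 lk(3)] .
  have "(\<lambda>y. x * y) ` ideal_list_prod E Ps = ideal_list_prod E Qs"
    unfolding Ps Qs image_image by (simp add: a_def mult_ac)
  then show ?thesis unfolding factorizes_into_def using x Ps(1) Qs(1) by blast
qed

end

section \<open>Powers of matrices acting on vectors\<close>

lemma pow_mat_mult_vec_Suc:
  fixes A :: "'a :: comm_ring_1 mat"
  assumes A: "A \<in> carrier_mat n n" and y: "y \<in> carrier_vec n"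
  shows "(A ^\<^sub>m Suc k) *\<^sub>v y = (A ^\<^sub>m k) *\<^sub>v (A *\<^sub>v y)"
    and "(A ^\<^sub>m Suc k) *\<^sub>v y = A *\<^sub>v ((A ^\<^sub>m k) *\<^sub>v y)"
proof -
  have P: "A ^\<^sub>m k \<in> carrier_mat n n" for k using A by simp
  have *: "(A ^\<^sub>m Suc k) *\<^sub>v y = (A ^\<^sub>m k) *\<^sub>v (A *\<^sub>v y)" if "y \<in> carrier_vec n" for k y
    using assoc_mult_mat_vec[OF P A that] by simp
  show "(A ^\<^sub>m Suc k) *\<^sub>v y = (A ^\<^sub>m k) *\<^sub>v (A *\<^sub>v y)" by (rule *[OF y])
  show "(A ^\<^sub>m Suc k) *\<^sub>v y = A *\<^sub>v ((A ^\<^sub>m k) *\<^sub>v y)"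
    using y
  proof (induction k arbitrary: y)
    case 0
    then show ?case using A by simp
  next
    case (Suc k)
    have "(A ^\<^sub>m Suc (Suc k)) *\<^sub>v y = (A ^\<^sub>m Suc k) *\<^sub>v (A *\<^sub>v y)" using *[OF Suc.prems] .
    also have "\<dots> = A *\<^sub>v ((A ^\<^sub>m k) *\<^sub>v (A *\<^sub>v y))"
      by (rule Suc.IH) (use A Suc.prems in simp)
    also have "(A ^\<^sub>m k) *\<^sub>v (A *\<^sub>v y) = (A ^\<^sub>m Suc k) *\<^sub>v y" using *[OF Suc.prems] by simp
    finally show ?case .
  qed
qed

lemma mult_mat_vec_smult:
  fixes A :: "'a :: comm_ring_1 mat"
  assumes A: "A \<in> carrier_mat n m" and y: "y \<in> carrier_vec m"
  shows "A *\<^sub>v (k \<cdot>\<^sub>v y) = k \<cdot>\<^sub>v (A *\<^sub>v y)"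
  using A y by (auto simp: vec_eq_iff scalar_prod_def sum_distrib_left mult_ac)

lemma pow_mat_mult_eigen:
  fixes A :: "'a :: comm_ring_1 mat"
  assumes A: "A \<in> carrier_mat n n" and y: "y \<in> carrier_vec n" and ev: "A *\<^sub>v y = k \<cdot>\<^sub>v y"
  shows "(A ^\<^sub>m m) *\<^sub>v y = k ^ m \<cdot>\<^sub>v y"
proof (induction m)
  case 0
  then show ?case using A y by simp
next
  case (Suc m)
  have "(A ^\<^sub>m Suc m) *\<^sub>v y = A *\<^sub>v (k ^ m \<cdot>\<^sub>v y)"
    using pow_mat_mult_vec_Suc(2)[OF A y] Suc by simp
  also have "\<dots> = k ^ m \<cdot>\<^sub>v (k \<cdot>\<^sub>v y)" using mult_mat_vec_smult[OF A y] ev by simp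
  finally show ?case by (simp add: smult_smult_assoc mult.commute)
qed

lemma transpose_pow_mat:
  fixes A :: "'a :: comm_semiring_1 mat"
  assumes A: "A \<in> carrier_mat n n"
  shows "transpose_mat (A ^\<^sub>m k) = transpose_mat A ^\<^sub>m k"
proof (induction k)
  case 0
  then show ?case using A by (auto simp: one_mat_def)
next
  case (Suc k)
  have "transpose_mat (A ^\<^sub>m Suc k) = transpose_mat A * transpose_mat A ^\<^sub>m k"
    using Suc transpose_mult[of "A ^\<^sub>m k" n n A n] A by simp
  also have "\<dots> = transpose_mat A ^\<^sub>m Suc k"
  proof (induction k)
    case 0
    then show ?case using A by simp
  next
    case (Suc k)
    have "transpose_mat A * transpose_mat A ^\<^sub>m Suc k
      = (transpose_mat A * transpose_mat A ^\<^sub>m k) * transpose_mat A"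
      using A by (simp add: assoc_mult_mat[of _ n n _ n _ n])
    then show ?case using Suc by simp
  qed
  finally show ?case .
qed

lemma row_mult_scalar_prod:
  fixes q :: "'a :: comm_ring_1 vec"
  assumes A: "A \<in> carrier_mat n m" and q: "q \<in> carrier_vec n" and x: "x \<in> carrier_vec m"
  shows "(transpose_mat A *\<^sub>v q) \<bullet> x = q \<bullet> (A *\<^sub>v x)"
  using transpose_vec_mult_scalar[OF A x q] by simp

lemma mult_mat_vec_index:
  assumes "A \<in> carrier_mat n m" "x \<in> carrier_vec m" "i < n"
  shows "(A *\<^sub>v x) $ i = (\<Sum>j<m. A $$ (i, j) * x $ j)"
  using assms by (auto simp: scalar_prod_def atLeast0LessThan intro!: sum.cong)

lemma scalar_prod_sum:
  assumes "x \<in> carrier_vec n"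
  shows "q \<bullet> x = (\<Sum>j<n. q $ j * x $ j)"
  using assms by (auto simp: scalar_prod_def atLeast0LessThan)

lemma positive_mat_mult_vec:
  fixes P :: "real mat"
  assumes P: "P \<in> carrier_mat n n" "\<And>i j. i < n \<Longrightarrow> j < n \<Longrightarrow> P $$ (i, j) > 0"
    and x: "x \<in> carrier_vec n" "\<And>i. i < n \<Longrightarrow> 0 \<le> x $ i" "x \<noteq> 0\<^sub>v n" and i: "i < n"
  shows "(P *\<^sub>v x) $ i > 0"
proof -
  obtain j where j: "j < n" "x $ j \<noteq> 0" using x by (metis eq_vecI carrier_vecD index_zero_vec)
  then have "x $ j > 0" using x(2)[of j] by linarith
  then have "P $$ (i, j) * x $ j > 0" using P(2)[OF i j(1)] by simp
  moreover have "P $$ (i, k) * x $ k \<ge> 0" if "k < n" for k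
    using P(2)[OF i that] x(2)[OF that] by simp
  ultimately show ?thesis
    unfolding mult_mat_vec_index[OF P(1) x(1) i] using j by (intro sum_pos2[of _ j]) auto
qed

section \<open>Perron-Frobenius theory\<close>

locale pf_matrix =
  fixes M :: "int mat" and n :: nat and l :: complex
  assumes M: "M \<in> carrier_mat n n" and prim: "primitive_mat M" and pf: "pf_eigenvalue M l"
begin

abbreviation Mr :: "real mat" where "Mr \<equiv> map_mat of_int M"
abbreviation lam :: real where "lam \<equiv> Re l"

lemma Mr: "Mr \<in> carrier_mat n n" and Mc: "cmat M \<in> carrier_mat n n"
  using M by auto

lemma l_eq: "l = of_real lam" and lam_pos: "lam > 0"
  using pf by (auto simp: pf_eigenvalue_def complex_is_Real_iff complex_eq_iff)

lemma l_nz: "l \<noteq> 0"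
  using lam_pos l_eq by (metis of_real_eq_0_iff less_irrefl)

lemma n_pos: "n > 0"
proof -
  obtain x where "eigenvector (cmat M) x l" using pf by (auto simp: pf_eigenvalue_def eigenvalue_def)
  then have x: "x \<in> carrier_vec n" "x \<noteq> 0\<^sub>v n" using M by (auto simp: eigenvector_def)
  show ?thesis
  proof (rule ccontr)
    assume "\<not> n > 0"
    then have "x = 0\<^sub>v n" using x(1) by (intro eq_vecI) auto
    then show False using x(2) by simp
  qed
qed

lemma M_nonneg: "i < n \<Longrightarrow> j < n \<Longrightarrow> 0 \<le> M $$ (i, j)"
  using prim M by (auto simp: primitive_mat_def)

lemma ex_positive_power:
  obtains m where "\<And>i j. i < n \<Longrightarrow> j < n \<Longrightarrow> (Mr ^\<^sub>m m) $$ (i, j) > 0"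
proof -
  obtain k where k: "\<And>i j. i < n \<Longrightarrow> j < n \<Longrightarrow> 0 < (M ^\<^sub>m k) $$ (i, j)"
  proof -
    obtain k0 where "\<forall>k\<ge>k0. \<forall>i<n. \<forall>j<n. 0 < (M ^\<^sub>m k) $$ (i, j)"
      using prim M unfolding primitive_mat_def by auto
    then show ?thesis using that[of k0] by simp
  qed
  have "Mr ^\<^sub>m k = map_mat of_int (M ^\<^sub>m k)" by (rule of_int_hom.mat_hom_pow[OF M, symmetric])
  then have "(Mr ^\<^sub>m k) $$ (i, j) > 0" if "i < n" "j < n" for i j
    using k[OF that] that M by simp
  then show ?thesis using that by blast
qed

text \<open>Row eigenvectors are treated as column eigenvectors of the transpose, which has the same
  characteristic polynomial.\<close>

lemma pf_transpose: "pf_matrix (transpose_mat M) n l"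
proof
  show "transpose_mat M \<in> carrier_mat n n" using M by simp
  show "primitive_mat (transpose_mat M)"
  proof -
    obtain k0 where k0: "\<forall>k\<ge>k0. \<forall>i<n. \<forall>j<n. 0 < (M ^\<^sub>m k) $$ (i, j)"
      using prim M unfolding primitive_mat_def by auto
    show ?thesis
      using M M_nonneg k0 unfolding primitive_mat_def transpose_pow_mat[OF M, symmetric]
      by (intro conjI exI[of _ k0]) auto
  qed
  have "cmat (transpose_mat M) = transpose_mat (cmat M)" by auto
  then have "eigenvalue (cmat (transpose_mat M)) x \<longleftrightarrow> eigenvalue (cmat M) x" for x
    using eigenvalue_root_char_poly[of "transpose_mat (cmat M)" n x]
      eigenvalue_root_char_poly[of "cmat M" n x] Mc by simp
  then show "pf_eigenvalue (transpose_mat M) l" using pf by (simp add: pf_eigenvalue_def)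
qed

lemma Mr_mono:
  assumes "x \<in> carrier_vec n" "y \<in> carrier_vec n" "\<And>i. i < n \<Longrightarrow> x $ i \<le> y $ i" "i < n"
  shows "(Mr *\<^sub>v x) $ i \<le> (Mr *\<^sub>v y) $ i"
  using assms M M_nonneg
  by (auto simp: mult_mat_vec_index[OF Mr] intro!: sum_mono mult_left_mono simp del: index_mult_mat_vec)

text \<open>Otherwise some positive \<open>z\<close> has \<open>Mr z \<ge> (lam + \<epsilon>) z\<close>, so the powers of \<open>Mr\<close> grow
  faster than the spectral radius permits.\<close>
lemma subinvariant_imp_eigen:
  assumes y: "y \<in> carrier_vec n" "\<And>i. i < n \<Longrightarrow> 0 \<le> y $ i" "y \<noteq> 0\<^sub>v n"
    and sub: "\<And>i. i < n \<Longrightarrow> lam * y $ i \<le> (Mr *\<^sub>v y) $ i"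
  shows "Mr *\<^sub>v y = lam \<cdot>\<^sub>v y"
proof (rule ccontr)
  assume neq: "Mr *\<^sub>v y \<noteq> lam \<cdot>\<^sub>v y"
  obtain m where m: "\<And>i j. i < n \<Longrightarrow> j < n \<Longrightarrow> (Mr ^\<^sub>m m) $$ (i, j) > 0"
    using ex_positive_power by blast
  let ?P = "Mr ^\<^sub>m m"
  have P: "?P \<in> carrier_mat n n" using Mr by simp
  have pos: "(?P *\<^sub>v x) $ i > 0"
    if "x \<in> carrier_vec n" "\<And>i. i < n \<Longrightarrow> 0 \<le> x $ i" "x \<noteq> 0\<^sub>v n" "i < n" for x i
    by (rule positive_mat_mult_vec[OF P]) (use m that in auto)
  \<comment> \<open>\<open>d\<close> is the defect of the inequality. A positive power
    \<open>?P\<close> commutes with \<open>Mr\<close> and makes both \<open>d\<close> and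
    \<open>y\<close> strictly positive.\<close>
  define d where "d = Mr *\<^sub>v y - lam \<cdot>\<^sub>v y"
  define z where "z = ?P *\<^sub>v y"
  have d: "d \<in> carrier_vec n" and z: "z \<in> carrier_vec n"
    using mult_mat_vec_carrier[OF P y(1)] Mr y by (auto simp: d_def z_def)
  have My: "Mr *\<^sub>v y \<in> carrier_vec n" and ly: "lam \<cdot>\<^sub>v y \<in> carrier_vec n" using Mr y by auto
  have d0: "0 \<le> d $ i" if "i < n" for i
    using sub[OF that] that y M by (simp add: d_def)
  have "d \<noteq> 0\<^sub>v n"
  proof
    assume "d = 0\<^sub>v n"
    then have "Mr *\<^sub>v y = lam \<cdot>\<^sub>v y"
      unfolding d_def using My ly M by (intro eq_vecI) (auto simp: vec_eq_iff)
    then show False using neq by simp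
  qed
  have zpos: "z $ i > 0" and Pdpos: "(?P *\<^sub>v d) $ i > 0" if "i < n" for i
    using pos[OF y that] pos[OF d d0 \<open>d \<noteq> 0\<^sub>v n\<close> that] by (auto simp: z_def)
  have "?P *\<^sub>v d = ?P *\<^sub>v (Mr *\<^sub>v y) - ?P *\<^sub>v (lam \<cdot>\<^sub>v y)"
    unfolding d_def by (rule mult_minus_distrib_mat_vec[OF P My ly])
  also have "?P *\<^sub>v (Mr *\<^sub>v y) = Mr *\<^sub>v z"
    unfolding z_def using pow_mat_mult_vec_Suc[OF Mr y(1)] by metis
  also have "?P *\<^sub>v (lam \<cdot>\<^sub>v y) = lam \<cdot>\<^sub>v z" unfolding z_def by (rule mult_mat_vec_smult[OF P y(1)])
  finally have Pd: "?P *\<^sub>v d = Mr *\<^sub>v z - lam \<cdot>\<^sub>v z" .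
  \<comment> \<open>The smallest ratio of entries of \<open>Mr z - lam z\<close> and
    \<open>z\<close>, hence a gain over \<open>lam\<close> that holds in every entry.\<close>
  define eps where "eps = Min ((\<lambda>i. (?P *\<^sub>v d) $ i / z $ i) ` {..<n})"
  have eps: "eps > 0" unfolding eps_def using n_pos zpos Pdpos
    by (subst Min_gr_iff) auto
  have step: "(lam + eps) * z $ i \<le> (Mr *\<^sub>v z) $ i" if i: "i < n" for i
  proof -
    have "eps \<le> (?P *\<^sub>v d) $ i / z $ i" unfolding eps_def using i by (intro Min_le) auto
    then have "eps * z $ i \<le> (?P *\<^sub>v d) $ i" using zpos[OF i] by (simp add: pos_le_divide_eq)
    also have "\<dots> = (Mr *\<^sub>v z) $ i - lam * z $ i" unfolding Pd using i z M by simp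
    finally show ?thesis by (simp add: algebra_simps)
  qed
  have Mk: "(Mr ^\<^sub>m k) *\<^sub>v z \<in> carrier_vec n" for k
    by (rule mult_mat_vec_carrier[OF pow_carrier_mat[OF Mr] z])
  have iter: "(lam + eps) ^ k * z $ i \<le> ((Mr ^\<^sub>m k) *\<^sub>v z) $ i" if "i < n" for i k
    using that
  proof (induction k arbitrary: i)
    case 0
    then show ?case using Mr z by simp
  next
    case (Suc k)
    have "(lam + eps) ^ Suc k * z $ i = (lam + eps) ^ k * ((lam + eps) * z $ i)" by simp
    also have "\<dots> \<le> (lam + eps) ^ k * (Mr *\<^sub>v z) $ i"
      using step[OF Suc.prems] lam_pos eps by (intro mult_left_mono) auto
    also have "\<dots> = (Mr *\<^sub>v ((lam + eps) ^ k \<cdot>\<^sub>v z)) $ i"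
      using mult_mat_vec_smult[OF Mr z] Suc.prems M by simp
    also have "\<dots> \<le> (Mr *\<^sub>v ((Mr ^\<^sub>m k) *\<^sub>v z)) $ i"
      using Suc z Mk by (intro Mr_mono) auto
    finally show ?case using pow_mat_mult_vec_Suc(2)[OF Mr z] by simp
  qed
  \<comment> \<open>A value strictly between \<open>lam\<close> and \<open>lam + eps\<close>: scaled
    by \<open>1 / mu\<close> the matrix has spectral radius below 1 and bounded powers, while the
    iterates of \<open>z\<close> still grow exponentially.\<close>
  define mu where "mu = lam + eps / 2"
  have mu: "mu > 0" "mu > lam" using lam_pos eps by (auto simp: mu_def)
  define N where "N = of_real (1 / mu) \<cdot>\<^sub>m cmat M"
  have N: "N \<in> carrier_mat n n" using M by (simp add: N_def)
  have ev: "cmod a < 1" if a: "eigenvalue N a" for a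
  proof -
    obtain x where x: "x \<in> carrier_vec n" "x \<noteq> 0\<^sub>v n" "N *\<^sub>v x = a \<cdot>\<^sub>v x"
      using a N by (auto simp: eigenvalue_def eigenvector_def)
    have "cmat M *\<^sub>v x = (of_real mu * a) \<cdot>\<^sub>v x"
    proof (rule eq_vecI)
      fix i assume "i < dim_vec ((of_real mu * a) \<cdot>\<^sub>v x)"
      then have i: "i < n" using x by simp
      have "(N *\<^sub>v x) $ i = of_real (1 / mu) * (cmat M *\<^sub>v x) $ i"
        unfolding mult_mat_vec_index[OF N x(1) i] mult_mat_vec_index[OF Mc x(1) i] sum_distrib_left
        using i M by (intro sum.cong) (auto simp: N_def)
      then have "(cmat M *\<^sub>v x) $ i = of_real mu * (N *\<^sub>v x) $ i"
        using mu by simp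
      then show "(cmat M *\<^sub>v x) $ i = ((of_real mu * a) \<cdot>\<^sub>v x) $ i" using x i by simp
    qed (use x M in auto)
    then have "eigenvalue (cmat M) (of_real mu * a)"
      using x M unfolding eigenvalue_def eigenvector_def by auto
    then have "of_real mu * a = l \<or> cmod (of_real mu * a) < cmod l"
      using pf unfolding pf_eigenvalue_def by blast
    then have "cmod (of_real mu * a) \<le> cmod l" by auto
    then have "mu * cmod a \<le> lam"
      using mu lam_pos by (simp add: norm_mult) (metis l_eq abs_of_pos norm_of_real)
    then show ?thesis using mu lam_pos
      by (metis linorder_not_less mult.right_neutral mult_left_mono order.strict_trans2 less_eq_real_def)
  qed
  have "spectral_radius N < 1"
    using spectral_radius_mem_max(1)[OF N] n_pos ev unfolding spectrum_def by auto
  then obtain c where c: "\<And>k. norm_bound (N ^\<^sub>m k) c"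
    using spectral_radius_jnf_norm_bound_less_1_upper_triangular[OF N] by blast
  define zc where "zc = map_vec complex_of_real z"
  have zc: "zc \<in> carrier_vec n" using z by (simp add: zc_def)
  have Nk: "(N ^\<^sub>m k) *\<^sub>v zc = of_real ((1 / mu) ^ k) \<cdot>\<^sub>v map_vec of_real ((Mr ^\<^sub>m k) *\<^sub>v z)" for k
  proof (induction k)
    case 0
    then show ?case using N zc Mr z M by (simp add: zc_def)
  next
    case (Suc k)
    let ?u = "(Mr ^\<^sub>m k) *\<^sub>v z"
    let ?uc = "map_vec complex_of_real ?u"
    have uc: "?uc \<in> carrier_vec n" using Mk by simp
    have "(N ^\<^sub>m Suc k) *\<^sub>v zc = N *\<^sub>v (of_real ((1 / mu) ^ k) \<cdot>\<^sub>v ?uc)"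
      using pow_mat_mult_vec_Suc(2)[OF N zc] Suc by simp
    also have "\<dots> = of_real ((1 / mu) ^ k) \<cdot>\<^sub>v (N *\<^sub>v ?uc)" by (rule mult_mat_vec_smult[OF N uc])
    also have "N *\<^sub>v ?uc = of_real (1 / mu) \<cdot>\<^sub>v map_vec of_real (Mr *\<^sub>v ?u)"
    proof (rule eq_vecI)
      fix i assume "i < dim_vec (of_real (1 / mu) \<cdot>\<^sub>v map_vec complex_of_real (Mr *\<^sub>v ?u))"
      then have i: "i < n" using M by simp
      have ii: "i < dim_row M" using i M by simp
      have "(N *\<^sub>v ?uc) $ i = (\<Sum>j<n. of_real (1 / mu) * (of_int (M $$ (i, j)) * of_real (?u $ j)))"
        unfolding mult_mat_vec_index[OF N uc i]
        using i M Mk by (intro sum.cong refl) (simp add: N_def mult.assoc)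
      also have "\<dots> = of_real (1 / mu) * of_real ((Mr *\<^sub>v ?u) $ i)"
        unfolding mult_mat_vec_index[OF Mr Mk i] using i M
        by (simp add: sum_distrib_left)
      finally show "(N *\<^sub>v ?uc) $ i = (of_real (1 / mu) \<cdot>\<^sub>v map_vec of_real (Mr *\<^sub>v ?u)) $ i"
        using ii by simp
    qed (use N M in auto)
    also have "Mr *\<^sub>v ?u = (Mr ^\<^sub>m Suc k) *\<^sub>v z" using pow_mat_mult_vec_Suc(2)[OF Mr z] by simp
    finally show ?case by (simp add: smult_smult_assoc mult.commute)
  qed
  define C where "C = (\<Sum>j<n. c * z $ j)"
  have bound: "((lam + eps) / mu) ^ k * z $ 0 \<le> C" for k
  proof -
    have Nkc: "N ^\<^sub>m k \<in> carrier_mat n n" using N by simp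
    have "((lam + eps) / mu) ^ k * z $ 0 \<le> (1 / mu) ^ k * ((Mr ^\<^sub>m k) *\<^sub>v z) $ 0"
      using mult_left_mono[OF iter[OF n_pos, of k], of "(1 / mu) ^ k"] mu
      by (simp add: power_divide)
    also have "\<dots> \<le> cmod (((N ^\<^sub>m k) *\<^sub>v zc) $ 0)"
      unfolding Nk using n_pos M Mr mu by (simp add: norm_mult norm_power norm_divide)
    also have "\<dots> \<le> (\<Sum>j<n. cmod ((N ^\<^sub>m k) $$ (0, j) * zc $ j))"
      unfolding mult_mat_vec_index[OF Nkc zc n_pos] by (rule norm_sum)
    also have "\<dots> \<le> C"
      unfolding C_def
    proof (rule sum_mono)
      fix j assume j: "j \<in> {..<n}"
      have "cmod ((N ^\<^sub>m k) $$ (0, j)) \<le> c"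
        using c[of k] j n_pos carrier_matD[OF Nkc] unfolding norm_bound_def by (metis lessThan_iff)
      then show "cmod ((N ^\<^sub>m k) $$ (0, j) * zc $ j) \<le> c * z $ j"
        using j zpos[of j] z by (simp add: norm_mult zc_def mult_right_mono)
    qed
    finally show ?thesis .
  qed
  have "1 < (lam + eps) / mu" using mu eps by (simp add: mu_def)
  then obtain k where "C / z $ 0 < ((lam + eps) / mu) ^ k" using real_arch_pow by blast
  then show False using bound[of k] zpos[OF n_pos] by (simp add: pos_divide_less_eq)
qed

text \<open>Some power of \<open>Mr\<close> has positive entries only, and it acts on
  \<open>x\<close> as multiplication by \<open>lam ^ m\<close>.\<close>

lemma pos_mult_power:
  assumes x: "x \<in> carrier_vec n" "\<And>i. i < n \<Longrightarrow> 0 \<le> x $ i" "x \<noteq> 0\<^sub>v n"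
    and ev: "Mr *\<^sub>v x = lam \<cdot>\<^sub>v x" and i: "i < n"
  shows "x $ i > 0"
proof -
  obtain m where m: "\<And>i j. i < n \<Longrightarrow> j < n \<Longrightarrow> (Mr ^\<^sub>m m) $$ (i, j) > 0"
    using ex_positive_power by blast
  have P: "Mr ^\<^sub>m m \<in> carrier_mat n n" using Mr by simp
  have "((Mr ^\<^sub>m m) *\<^sub>v x) $ i > 0" 
    by (rule positive_mat_mult_vec[OF P]) (use m x i in auto)
  also have "((Mr ^\<^sub>m m) *\<^sub>v x) $ i = lam ^ m * x $ i"
    using pow_mat_mult_eigen[OF Mr x(1) ev] x i by simp
  finally show ?thesis using lam_pos by (simp add: zero_less_mult_iff)
qed

text \<open>By the triangle inequality, the moduli of the entries of a complex eigenvector satisfy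
  the hypothesis of \<open>subinvariant_imp_eigen\<close>.\<close>

lemma ex_positive_eigenvector:
  obtains p where "p \<in> carrier_vec n" "\<And>i. i < n \<Longrightarrow> p $ i > 0" "Mr *\<^sub>v p = lam \<cdot>\<^sub>v p"
proof -
  obtain x where "eigenvector (cmat M) x l" using pf by (auto simp: pf_eigenvalue_def eigenvalue_def)
  then have x: "x \<in> carrier_vec n" "x \<noteq> 0\<^sub>v n" "cmat M *\<^sub>v x = l \<cdot>\<^sub>v x"
    using M by (auto simp: eigenvector_def)
  define y where "y = map_vec cmod x"
  have y: "y \<in> carrier_vec n" "\<And>i. i < n \<Longrightarrow> 0 \<le> y $ i"
    using x by (auto simp: y_def)
  have "y \<noteq> 0\<^sub>v n" using x(1,2) by (auto simp: y_def vec_eq_iff)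
  have "lam * y $ i \<le> (Mr *\<^sub>v y) $ i" if i: "i < n" for i
  proof -
    have "lam * y $ i = cmod ((l \<cdot>\<^sub>v x) $ i)"
      using i x(1) lam_pos by (simp add: y_def norm_mult) (metis l_eq abs_of_pos norm_of_real)
    also have "\<dots> = cmod (\<Sum>j<n. cmat M $$ (i, j) * x $ j)"
      unfolding x(3)[symmetric] mult_mat_vec_index[OF Mc x(1) i] ..
    also have "\<dots> \<le> (\<Sum>j<n. cmod (cmat M $$ (i, j) * x $ j))" by (rule norm_sum)
    also have "\<dots> = (Mr *\<^sub>v y) $ i"
      unfolding mult_mat_vec_index[OF Mr y(1) i] using i M M_nonneg x(1)
      by (intro sum.cong) (auto simp: norm_mult y_def)
    finally show ?thesis .
  qed
  then have "Mr *\<^sub>v y = lam \<cdot>\<^sub>v y" by (intro subinvariant_imp_eigen y \<open>y \<noteq> 0\<^sub>v n\<close>)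
  then show ?thesis using that[of y] y \<open>y \<noteq> 0\<^sub>v n\<close> pos_mult_power by blast
qed

text \<open>Subtracting the largest multiple of \<open>p\<close> that stays below \<open>r\<close>
  leaves a nonnegative eigenvector with a vanishing entry, which must be zero.\<close>

lemma real_eigenvector_unique:
  assumes p: "p \<in> carrier_vec n" "\<And>i. i < n \<Longrightarrow> p $ i > 0" "Mr *\<^sub>v p = lam \<cdot>\<^sub>v p"
    and r: "r \<in> carrier_vec n" "Mr *\<^sub>v r = lam \<cdot>\<^sub>v r"
  shows "\<exists>t. r = t \<cdot>\<^sub>v p"
proof -
  define t where "t = Min ((\<lambda>i. r $ i / p $ i) ` {..<n})"
  have "t \<in> (\<lambda>i. r $ i / p $ i) ` {..<n}" unfolding t_def using n_pos by (intro Min_in) auto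
  then obtain k where k: "k < n" "t = r $ k / p $ k" by blast
  define s where "s = r - t \<cdot>\<^sub>v p"
  have s: "s \<in> carrier_vec n" using r p by (simp add: s_def)
  have nn: "0 \<le> s $ i" if "i < n" for i
  proof -
    have "t \<le> r $ i / p $ i" unfolding t_def using that by (intro Min_le) auto
    then show ?thesis using that p r by (simp add: s_def pos_le_divide_eq)
  qed
  have "Mr *\<^sub>v s = Mr *\<^sub>v r - t \<cdot>\<^sub>v (Mr *\<^sub>v p)"
    using mult_minus_distrib_mat_vec[OF Mr r(1), of "t \<cdot>\<^sub>v p"] mult_mat_vec_smult[OF Mr p(1)] p(1)
    by (simp add: s_def)
  also have "\<dots> = lam \<cdot>\<^sub>v s"
    using p(1) r(1) unfolding p(3) r(2) s_def by (intro eq_vecI) (auto simp: algebra_simps)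
  finally have ev: "Mr *\<^sub>v s = lam \<cdot>\<^sub>v s" .
  have "s $ k = 0" using k p r by (simp add: s_def less_imp_neq[OF p(2), symmetric])
  then have "s = 0\<^sub>v n" using pos_mult_power[OF s nn _ ev k(1)] by fastforce
  have "r = t \<cdot>\<^sub>v p"
  proof (rule eq_vecI)
    fix i assume "i < dim_vec (t \<cdot>\<^sub>v p)"
    then have i: "i < n" using p by simp
    have "s $ i = 0" using \<open>s = 0\<^sub>v n\<close> i by simp
    then show "r $ i = (t \<cdot>\<^sub>v p) $ i" using i p r by (simp add: s_def)
  qed (use p r in auto)
  then show ?thesis by blast
qed

text \<open>\<open>M\<close> and \<open>l\<close> are real, so the real and imaginary parts of
  \<open>x\<close> are eigenvectors separately.\<close>

lemma eigenvector_unique: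
  assumes p: "p \<in> carrier_vec n" "\<And>i. i < n \<Longrightarrow> p $ i > 0" "Mr *\<^sub>v p = lam \<cdot>\<^sub>v p"
    and x: "x \<in> carrier_vec n" "cmat M *\<^sub>v x = l \<cdot>\<^sub>v x"
  shows "\<exists>t. x = t \<cdot>\<^sub>v map_vec of_real p"
proof -
  have comp: "(\<Sum>j<n. of_int (M $$ (i, j)) * x $ j) = of_real lam * x $ i" if "i < n" for i
  proof -
    have "(\<Sum>j<n. of_int (M $$ (i, j)) * x $ j) = (cmat M *\<^sub>v x) $ i"
      unfolding mult_mat_vec_index[OF Mc x(1) that] using that M by (intro sum.cong) auto
    then show ?thesis using x that l_eq by simp
  qed
  have r: "map_vec f x \<in> carrier_vec n" for f using x by auto
  have ev: "Mr *\<^sub>v map_vec f x = lam \<cdot>\<^sub>v map_vec f x" if f: "f = Re \<or> f = Im" for f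
  proof (rule eq_vecI)
    fix i assume "i < dim_vec (lam \<cdot>\<^sub>v map_vec f x)"
    then have i: "i < n" using x by simp
    have "(Mr *\<^sub>v map_vec f x) $ i = (\<Sum>j<n. of_int (M $$ (i, j)) * f (x $ j))"
      unfolding mult_mat_vec_index[OF Mr r i] using i M x(1) by (intro sum.cong) auto
    also have "\<dots> = f (\<Sum>j<n. of_int (M $$ (i, j)) * x $ j)"
      using f by (elim disjE; simp)
    also have "\<dots> = lam * f (x $ i)"
      unfolding comp[OF i] using f by (elim disjE; simp)
    finally show "(Mr *\<^sub>v map_vec f x) $ i = (lam \<cdot>\<^sub>v map_vec f x) $ i"
      using i x(1) by simp
  qed (use M x in auto)
  obtain a b where ab: "map_vec Re x = a \<cdot>\<^sub>v p" "map_vec Im x = b \<cdot>\<^sub>v p"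
    using real_eigenvector_unique[OF p r ev, of Re] real_eigenvector_unique[OF p r ev, of Im] by auto
  have "x = Complex a b \<cdot>\<^sub>v map_vec of_real p"
  proof (rule eq_vecI)
    fix i assume "i < dim_vec (Complex a b \<cdot>\<^sub>v map_vec of_real p)"
    then have i: "i < n" using p by simp
    have "Re (x $ i) = a * p $ i" "Im (x $ i) = b * p $ i"
      using arg_cong[OF ab(1), of "\<lambda>v. v $ i"] arg_cong[OF ab(2), of "\<lambda>v. v $ i"] i x p by auto
    then show "x $ i = (Complex a b \<cdot>\<^sub>v map_vec of_real p) $ i"
      using i p by (simp add: complex_eq_iff)
  qed (use p x in auto)
  then show ?thesis by blast
qed

lemma ex_positive_row_eigenvector:
  obtains q where "q \<in> carrier_vec n" "\<And>i. i < n \<Longrightarrow> q $ i > 0"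
    "\<And>x. x \<in> carrier_vec n \<Longrightarrow> q \<bullet> (Mr *\<^sub>v x) = lam * (q \<bullet> x)"
proof -
  obtain q where q: "q \<in> carrier_vec n" "\<And>i. i < n \<Longrightarrow> q $ i > 0"
    "map_mat of_int (transpose_mat M) *\<^sub>v q = lam \<cdot>\<^sub>v q"
    using pf_matrix.ex_positive_eigenvector[OF pf_transpose] by metis
  have "map_mat of_int (transpose_mat M) = transpose_mat Mr" by auto
  then have "q \<bullet> (Mr *\<^sub>v x) = lam * (q \<bullet> x)" if "x \<in> carrier_vec n" for x
    using row_mult_scalar_prod[OF Mr q(1) that] q that by simp
  then show ?thesis using that q by blast
qed

lemma row_eigen_of_real:
  assumes q: "q \<in> carrier_vec n" "map_mat of_int (transpose_mat M) *\<^sub>v q = lam \<cdot>\<^sub>v q"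
  shows "transpose_mat (cmat M) *\<^sub>v map_vec complex_of_real q = l \<cdot>\<^sub>v map_vec complex_of_real q"
proof -
  let ?q = "map_vec complex_of_real q"
  have "transpose_mat (cmat M) *\<^sub>v ?q = map_vec of_real (map_mat of_int (transpose_mat M) *\<^sub>v q)"
  proof -
    have T: "map_mat of_int (transpose_mat M) \<in> carrier_mat n n" using M by simp
    have "map_vec complex_of_real (map_mat of_int (transpose_mat M) *\<^sub>v q)
      = map_mat of_real (map_mat of_int (transpose_mat M)) *\<^sub>v ?q"
      by (rule of_real_hom.mult_mat_vec_hom[OF T q(1)])
    moreover have "map_mat complex_of_real (map_mat of_int (transpose_mat M)) = transpose_mat (cmat M)"
      by auto
    ultimately show ?thesis by simp
  qed
  also have "\<dots> = l \<cdot>\<^sub>v ?q" unfolding q(2) using l_eq q(1) by (intro eq_vecI) auto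
  finally show ?thesis .
qed

text \<open>A preimage of an eigenvector under \<open>cmat M - l\<close> would pair to zero with a positive row
  eigenvector.\<close>
lemma semisimple:
  assumes x: "x \<in> carrier_vec n" and u: "u = cmat M *\<^sub>v x - l \<cdot>\<^sub>v x"
    and ev: "cmat M *\<^sub>v u = l \<cdot>\<^sub>v u"
  shows "cmat M *\<^sub>v x = l \<cdot>\<^sub>v x"
proof -
  obtain p where p: "p \<in> carrier_vec n" "\<And>i. i < n \<Longrightarrow> p $ i > 0" "Mr *\<^sub>v p = lam \<cdot>\<^sub>v p"
    using ex_positive_eigenvector by blast
  obtain q where q: "q \<in> carrier_vec n" "\<And>i. i < n \<Longrightarrow> q $ i > 0"
    "map_mat of_int (transpose_mat M) *\<^sub>v q = lam \<cdot>\<^sub>v q"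
    using pf_matrix.ex_positive_eigenvector[OF pf_transpose] by metis
  let ?q = "map_vec complex_of_real q"
  have qc: "?q \<in> carrier_vec n" using q by simp
  have Mx: "cmat M *\<^sub>v x \<in> carrier_vec n" using Mc x by simp
  have uc: "u \<in> carrier_vec n" using u Mx x by simp
  obtain t where t: "u = t \<cdot>\<^sub>v map_vec of_real p" using eigenvector_unique[OF p uc ev] by blast
  have qM: "transpose_mat (cmat M) *\<^sub>v ?q = l \<cdot>\<^sub>v ?q" by (rule row_eigen_of_real[OF q(1,3)])
  have "?q \<bullet> u = ?q \<bullet> (cmat M *\<^sub>v x) - ?q \<bullet> (l \<cdot>\<^sub>v x)"
    unfolding u using scalar_prod_minus_distrib[OF qc Mx, of "l \<cdot>\<^sub>v x"] x by simp
  also have "?q \<bullet> (cmat M *\<^sub>v x) = l * (?q \<bullet> x)"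
    using row_mult_scalar_prod[OF Mc qc x] qM qc x by simp
  finally have "?q \<bullet> u = 0" using qc x by simp
  moreover have "?q \<bullet> u = t * of_real (\<Sum>j<n. q $ j * p $ j)"
    unfolding scalar_prod_sum[OF uc] using p q by (simp add: t sum_distrib_left algebra_simps)
  moreover have "(\<Sum>j<n. q $ j * p $ j) > 0"
    using n_pos p q by (intro sum_pos) auto
  ultimately have "t = 0" by (simp del: of_real_sum)
  then have "u = 0\<^sub>v n" using t p by auto
  then show ?thesis using u Mx x by (metis (no_types, lifting) carrier_vecD eq_vecI
        index_minus_vec(1) index_zero_vec(1) right_minus_eq smult_carrier_vec)
qed

text \<open>The backward orbit of a nonnegative vector stays in a compact simplex on which a positive
  power of \<open>Mr\<close> is contracting: the largest \<open>t\<close> with \<open>f k \<ge> t p\<close> for all \<open>k\<close> could be increased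
  unless \<open>f k = t p\<close>.\<close>
lemma backward_nonneg_imp_eigen:
  fixes x :: "nat \<Rightarrow> real vec"
  assumes x: "\<And>k. x k \<in> carrier_vec n" "\<And>k i. i < n \<Longrightarrow> 0 \<le> x k $ i"
    and bw: "\<And>k. Mr *\<^sub>v x (Suc k) = x k"
  shows "Mr *\<^sub>v x 0 = lam \<cdot>\<^sub>v x 0"
proof -
  obtain p where p: "p \<in> carrier_vec n" "\<And>i. i < n \<Longrightarrow> p $ i > 0" "Mr *\<^sub>v p = lam \<cdot>\<^sub>v p"
    using ex_positive_eigenvector by blast
  obtain q where q: "q \<in> carrier_vec n" "\<And>i. i < n \<Longrightarrow> q $ i > 0"
    "\<And>x. x \<in> carrier_vec n \<Longrightarrow> q \<bullet> (Mr *\<^sub>v x) = lam * (q \<bullet> x)"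
    using ex_positive_row_eigenvector by blast
  obtain m where m: "\<And>i j. i < n \<Longrightarrow> j < n \<Longrightarrow> (Mr ^\<^sub>m m) $$ (i, j) > 0"
    using ex_positive_power by blast
  let ?P = "Mr ^\<^sub>m m"
  have P: "?P \<in> carrier_mat n n" using Mr by simp
  define f where "f k = lam ^ k \<cdot>\<^sub>v x k" for k
  have f: "f k \<in> carrier_vec n" for k using x by (simp add: f_def)
  have f0: "0 \<le> f k $ i" if "i < n" for i k
    using x lam_pos that by (simp add: f_def carrier_vecD[OF x(1)])
  have fback: "Mr *\<^sub>v f (Suc k) = lam \<cdot>\<^sub>v f k" for k
    unfolding f_def using mult_mat_vec_smult[OF Mr x(1)[of "Suc k"]] bw[of k]
    by (simp add: smult_smult_assoc)
  define T where "T = {t. \<forall>k. \<forall>i<n. t * p $ i \<le> f k $ i}"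
  define tau where "tau = Sup T"
  have T0: "0 \<in> T" using f0 by (simp add: T_def)
  have Tb: "t \<le> f k $ i / p $ i" if "t \<in> T" "i < n" for t i k
    using that p(2)[OF that(2)] by (simp add: T_def pos_le_divide_eq)
  have bdd: "bdd_above T" by (rule bdd_aboveI[of _ "f 0 $ 0 / p $ 0"]) (use Tb n_pos in blast)
  have tauT: "tau \<in> T"
    unfolding T_def
  proof (intro CollectI allI impI)
    fix k i assume i: "i < n"
    have "tau \<le> f k $ i / p $ i" unfolding tau_def using T0 Tb[OF _ i] by (intro cSup_least) auto
    then show "tau * p $ i \<le> f k $ i" using p(2)[OF i] by (simp add: pos_le_divide_eq)
  qed
  define g where "g k = f k - tau \<cdot>\<^sub>v p" for k
  have g: "g k \<in> carrier_vec n" for k using f p by (simp add: g_def)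
  have g0: "0 \<le> g k $ i" if "i < n" for i k
    using tauT that f p by (simp add: T_def g_def)
  have gback: "Mr *\<^sub>v g (Suc k) = lam \<cdot>\<^sub>v g k" for k
  proof -
    have "Mr *\<^sub>v g (Suc k) = lam \<cdot>\<^sub>v f k - tau \<cdot>\<^sub>v (lam \<cdot>\<^sub>v p)"
      unfolding g_def using mult_minus_distrib_mat_vec[OF Mr f, of "tau \<cdot>\<^sub>v p"] fback p
        mult_mat_vec_smult[OF Mr p(1)] by simp
    also have "\<dots> = lam \<cdot>\<^sub>v g k"
      unfolding g_def using f[of k] p(1) by (intro eq_vecI) (auto simp: algebra_simps)
    finally show ?thesis .
  qed
  have gpow: "(Mr ^\<^sub>m j) *\<^sub>v g (k + j) = lam ^ j \<cdot>\<^sub>v g k" for j k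
  proof (induction j arbitrary: k)
    case 0
    then show ?case using g Mr by simp
  next
    case (Suc j)
    have "(Mr ^\<^sub>m Suc j) *\<^sub>v g (k + Suc j) = (Mr ^\<^sub>m j) *\<^sub>v (lam \<cdot>\<^sub>v g (k + j))"
      using pow_mat_mult_vec_Suc(1)[OF Mr g[of "Suc (k + j)"], of j] gback[of "k + j"] by simp
    also have "\<dots> = lam \<cdot>\<^sub>v (lam ^ j \<cdot>\<^sub>v g k)"
      using mult_mat_vec_smult[OF pow_carrier_mat[OF Mr] g] Suc by simp
    finally show ?case by (simp add: smult_smult_assoc)
  qed
  have qg: "q \<bullet> g k = q \<bullet> g 0" for k
  proof (induction k)
    case (Suc k)
    have "lam * (q \<bullet> g (Suc k)) = q \<bullet> (lam \<cdot>\<^sub>v g k)"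
      using q(3)[OF g[of "Suc k"]] gback[of k] by simp
    also have "\<dots> = lam * (q \<bullet> g k)" using q(1) g[of k] by simp
    finally have "lam * (q \<bullet> g (Suc k)) = lam * (q \<bullet> g k)" .
    then show ?case using Suc lam_pos by simp
  qed simp
  define sig where "sig = q \<bullet> g 0"
  have "sig = 0"
  proof (rule ccontr)
    assume "sig \<noteq> 0"
    moreover have "sig \<ge> 0" unfolding sig_def scalar_prod_sum[OF g]
      using q g0 by (intro sum_nonneg mult_nonneg_nonneg) (auto intro: less_imp_le)
    ultimately have sig: "sig > 0" by simp
    define dl where "dl = Min ((\<lambda>(i, j). ?P $$ (i, j)) ` ({..<n} \<times> {..<n}))"
    have dl: "dl > 0" unfolding dl_def using n_pos m by (subst Min_gr_iff) auto
    have dlP: "dl \<le> ?P $$ (i, j)" if "i < n" "j < n" for i j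
      unfolding dl_def using that by (intro Min_le) auto
    define qm where "qm = Max ((\<lambda>i. q $ i) ` {..<n})"
    define pm where "pm = Max ((\<lambda>i. p $ i) ` {..<n})"
    have qm: "q $ i \<le> qm" "p $ i \<le> pm" if "i < n" for i
      using that by (auto simp: qm_def pm_def)
    have qpos: "qm > 0" "pm > 0" using qm[OF n_pos] q(2)[OF n_pos] p(2)[OF n_pos] by auto
    \<comment> \<open>\<open>sig / qm\<close> bounds the sum of the entries of every
      \<open>g (k + m)\<close> from below, \<open>dl\<close> is the smallest entry of
      \<open>?P\<close>, and \<open>?P\<close> maps \<open>g (k + m)\<close> to
      \<open>lam ^ m\<close> times \<open>g k\<close>. So no entry of any \<open>g k\<close> is
      below \<open>eta\<close>.\<close>
    define eta where "eta = dl * (sig / qm) / lam ^ m"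
    have eta: "eta > 0" using dl sig qpos lam_pos by (simp add: eta_def)
    have low: "eta \<le> g k $ i" if i: "i < n" for i k
    proof -
      have "sig = q \<bullet> g (k + m)" using qg[of "k + m"] by (simp add: sig_def)
      also have "\<dots> \<le> (\<Sum>j<n. qm * g (k + m) $ j)"
        unfolding scalar_prod_sum[OF g]
        using qm g0 by (intro sum_mono mult_right_mono) auto
      finally have "sig / qm \<le> (\<Sum>j<n. g (k + m) $ j)"
        using qpos by (simp add: pos_divide_le_eq sum_distrib_left mult.commute)
      then have "dl * (sig / qm) \<le> dl * (\<Sum>j<n. g (k + m) $ j)"
        using dl by (intro mult_left_mono) auto
      also have "\<dots> \<le> (\<Sum>j<n. ?P $$ (i, j) * g (k + m) $ j)"
        unfolding sum_distrib_left using dlP[OF i] g0 by (intro sum_mono mult_right_mono) auto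
      also have "\<dots> = lam ^ m * g k $ i"
        using mult_mat_vec_index[OF P g i, of "k + m"] gpow[of m k] g[of k] i by simp
      finally show ?thesis
        unfolding eta_def using lam_pos by (subst pos_divide_le_eq) (auto simp: mult.commute)
    qed
    have "tau + eta / pm \<in> T"
      unfolding T_def
    proof (intro CollectI allI impI)
      fix k i assume i: "i < n"
      have "eta / pm * p $ i \<le> eta / pm * pm" using qm[OF i] eta qpos by (intro mult_left_mono) auto
      also have "\<dots> \<le> g k $ i" using low[OF i] qpos by simp
      finally show "(tau + eta / pm) * p $ i \<le> f k $ i"
        using i f[of k] p by (simp add: g_def algebra_simps)
    qed
    then have "tau + eta / pm \<le> tau" unfolding tau_def by (rule cSup_upper[OF _ bdd])
    then show False using eta qpos by (simp add: divide_le_0_iff)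
  qed
  then have z: "(\<Sum>j<n. q $ j * g 0 $ j) = 0" by (simp add: sig_def scalar_prod_sum[OF g])
  have "x 0 = tau \<cdot>\<^sub>v p"
  proof (rule eq_vecI)
    fix i assume "i < dim_vec (tau \<cdot>\<^sub>v p)"
    then have i: "i < n" using p by simp
    have "q $ i * g 0 $ i = 0"
      using z i q(2) g0 by (subst (asm) sum_nonneg_eq_0_iff) (simp_all add: less_imp_le)
    then have "g 0 $ i = 0" using q(2)[OF i] by simp
    then show "x 0 $ i = (tau \<cdot>\<^sub>v p) $ i" using i p x(1)[of 0] by (simp add: g_def f_def)
  qed (use p x(1)[of 0] in auto)
  then show ?thesis using mult_mat_vec_smult[OF Mr p(1)] p by (simp add: smult_smult_assoc mult.commute)
qed

end

section \<open>Polynomials acting on vectors\<close>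

text \<open>This is \<open>f(A) y\<close> by Horner's rule, with only vectors as intermediate
  values.\<close>

definition poly_act :: "'a :: comm_ring_1 mat \<Rightarrow> 'a vec \<Rightarrow> 'a poly \<Rightarrow> 'a vec" where
  "poly_act A y f = fold_coeffs (\<lambda>a u. a \<cdot>\<^sub>v y + A *\<^sub>v u) f (0\<^sub>v (dim_row A))"

context
  fixes A :: "'a :: comm_ring_1 mat" and n :: nat and y :: "'a vec"
  assumes A: "A \<in> carrier_mat n n" and y: "y \<in> carrier_vec n"
begin

lemma poly_act_0: "poly_act A y 0 = 0\<^sub>v n"
  using A by (simp add: poly_act_def)

lemma poly_act_pCons: "poly_act A y (pCons a f) = a \<cdot>\<^sub>v y + A *\<^sub>v poly_act A y f"
proof (cases "a = 0 \<and> f = 0")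
  case True
  have "A *\<^sub>v 0\<^sub>v n = 0\<^sub>v n" using A by (intro eq_vecI) (auto simp: scalar_prod_def)
  then show ?thesis using True y A by (auto simp: poly_act_0)
next
  case False
  then show ?thesis by (auto simp: poly_act_def)
qed

lemma poly_act_carrier: "poly_act A y f \<in> carrier_vec n"
  by (induction f) (use A y in \<open>auto simp: poly_act_0 poly_act_pCons\<close>)

lemma poly_act_add: "poly_act A y (f + g) = poly_act A y f + poly_act A y g"
proof (induction f g rule: poly_induct2)
  case 0
  then show ?case by (simp add: poly_act_0)
next
  case (pCons a f b g)
  have "poly_act A y (pCons a f + pCons b g)
    = (a + b) \<cdot>\<^sub>v y + A *\<^sub>v (poly_act A y f + poly_act A y g)"
    by (simp add: poly_act_pCons pCons)
  also have "A *\<^sub>v (poly_act A y f + poly_act A y g) = A *\<^sub>v poly_act A y f + A *\<^sub>v poly_act A y g"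
    by (rule mult_add_distrib_mat_vec[OF A poly_act_carrier poly_act_carrier])
  finally show ?case
    using A y mult_mat_vec_carrier[OF A poly_act_carrier]
    by (intro eq_vecI) (auto simp: poly_act_pCons algebra_simps)
qed

lemma poly_act_smult: "poly_act A y (Polynomial.smult c f) = c \<cdot>\<^sub>v poly_act A y f"
proof (induction f)
  case 0
  then show ?case by (auto simp: poly_act_0)
next
  case (pCons a f)
  then show ?case
    using A y mult_mat_vec_smult[OF A poly_act_carrier]
    by (intro eq_vecI) (auto simp: poly_act_pCons algebra_simps simp del: index_mult_mat_vec)
qed

lemma poly_act_linear_factor:
  "poly_act A y ([:- c, 1:] * f) = A *\<^sub>v poly_act A y f - c \<cdot>\<^sub>v poly_act A y f"
proof -
  have "[:- c, 1:] * f = pCons 0 f + Polynomial.smult (- c) f" by simp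
  then have "poly_act A y ([:- c, 1:] * f)
    = (0 \<cdot>\<^sub>v y + A *\<^sub>v poly_act A y f) + (- c) \<cdot>\<^sub>v poly_act A y f"
    by (simp only: poly_act_add poly_act_pCons poly_act_smult)
  then show ?thesis
    using A y poly_act_carrier[of f] by (intro eq_vecI) auto
qed

text \<open>If \<open>q\<close> does not pair to zero with \<open>y\<close>, its eigenvalue is
  therefore a root of every polynomial annihilating \<open>y\<close>.\<close>

lemma poly_act_left_eigen:
  assumes q: "q \<in> carrier_vec n" "transpose_mat A *\<^sub>v q = k \<cdot>\<^sub>v q"
  shows "q \<bullet> poly_act A y f = poly f k * (q \<bullet> y)"
proof (induction f)
  case 0
  then show ?case using q by (simp add: poly_act_0)
next
  case (pCons a f)
  have "q \<bullet> poly_act A y (pCons a f) = q \<bullet> (a \<cdot>\<^sub>v y) + q \<bullet> (A *\<^sub>v poly_act A y f)"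
    unfolding poly_act_pCons using q y mult_mat_vec_carrier[OF A poly_act_carrier]
    by (intro scalar_prod_add_distrib) auto
  also have "q \<bullet> (A *\<^sub>v poly_act A y f) = k * (q \<bullet> poly_act A y f)"
    using row_mult_scalar_prod[OF A q(1) poly_act_carrier] q poly_act_carrier by simp
  finally show ?case using pCons q y by (simp add: algebra_simps)
qed

lemma poly_act_monom: "poly_act A y (Polynomial.monom c k) = c \<cdot>\<^sub>v ((A ^\<^sub>m k) *\<^sub>v y)"
proof (induction k)
  case 0
  have "A *\<^sub>v 0\<^sub>v n = 0\<^sub>v n" using A by (intro eq_vecI) (auto simp: scalar_prod_def)
  then show ?case using A y by (simp add: Polynomial.monom_0 poly_act_pCons poly_act_0)
next
  case (Suc k)
  have "A *\<^sub>v (c \<cdot>\<^sub>v ((A ^\<^sub>m k) *\<^sub>v y)) = c \<cdot>\<^sub>v (A *\<^sub>v ((A ^\<^sub>m k) *\<^sub>v y))"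
    by (rule mult_mat_vec_smult[OF A mult_mat_vec_carrier[OF pow_carrier_mat[OF A] y]])
  then show ?case
    using A y Suc pow_mat_mult_vec_Suc(2)[OF A y, of k]
    by (intro eq_vecI) (auto simp: Polynomial.monom_Suc poly_act_pCons simp del: index_mult_mat_vec pow_mat.simps)
qed

lemma poly_act_sum_monom:
  assumes "i < n"
  shows "poly_act A y (\<Sum>k<m. Polynomial.monom (c k) k) $ i = (\<Sum>k<m. c k * ((A ^\<^sub>m k) *\<^sub>v y) $ i)"
proof (induction m)
  case 0
  then show ?case using assms by (simp add: poly_act_0)
next
  case (Suc m)
  have w: "(A ^\<^sub>m m) *\<^sub>v y \<in> carrier_vec n" by (rule mult_mat_vec_carrier[OF pow_carrier_mat[OF A] y])
  show ?case
    using Suc assms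
    by (simp add: poly_act_add poly_act_monom carrier_vecD[OF w] del: index_mult_mat_vec dim_mult_mat_vec)
qed

end

text \<open>The first \<open>n + 1\<close> iterates of \<open>y\<close> have only \<open>n\<close>
  entries each, so they are dependent. The argument by determinants works over the integers,
  too.\<close>

lemma ex_annihilating_poly:
  fixes A :: "'a :: idom mat"
  assumes A: "A \<in> carrier_mat n n" and y: "y \<in> carrier_vec n"
  obtains f where "f \<noteq> 0" "poly_act A y f = 0\<^sub>v n"
proof -
  \<comment> \<open>A zero row makes the matrix with these iterates as columns square and singular;
    a kernel vector supplies the coefficients.\<close>
  define K where "K = mat (Suc n) (Suc n) (\<lambda>(i, k). if i < n then ((A ^\<^sub>m k) *\<^sub>v y) $ i else 0)"
  have K: "K \<in> carrier_mat (Suc n) (Suc n)" by (simp add: K_def)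
  have "K = mat\<^sub>r (Suc n) (Suc n) (\<lambda>i. if i = n then 0\<^sub>v (Suc n) else row K i)"
    by (rule eq_matI) (auto simp: K_def)
  then have "det K = 0" using det_row_0[of n "Suc n" "\<lambda>i. row K i"] K by auto
  then obtain c where c: "c \<in> carrier_vec (Suc n)" "c \<noteq> 0\<^sub>v (Suc n)" "K *\<^sub>v c = 0\<^sub>v (Suc n)"
    using det_0_iff_vec_prod_zero[OF K] by blast
  define f where "f = (\<Sum>k<Suc n. Polynomial.monom (c $ k) k)"
  have coeff: "Polynomial.coeff f k = c $ k" if "k < Suc n" for k
    using that unfolding f_def coeff_sum by (simp add: sum.delta del: sum.lessThan_Suc)
  obtain k where k: "k < Suc n" "c $ k \<noteq> 0" using c(1,2) by (metis eq_vecI carrier_vecD index_zero_vec)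
  have "f \<noteq> 0" using coeff[OF k(1)] k(2) by auto
  moreover have "poly_act A y f = 0\<^sub>v n"
  proof (rule eq_vecI)
    fix i assume "i < dim_vec (0\<^sub>v n)"
    then have i: "i < n" by simp
    have "poly_act A y f $ i = (\<Sum>k<Suc n. c $ k * ((A ^\<^sub>m k) *\<^sub>v y) $ i)"
      unfolding f_def by (rule poly_act_sum_monom[OF A y i])
    also have "\<dots> = (\<Sum>k<Suc n. K $$ (i, k) * c $ k)"
      using i by (intro sum.cong) (auto simp: K_def)
    also have "\<dots> = (K *\<^sub>v c) $ i" using mult_mat_vec_index[OF K c(1), of i] i by simp
    also have "\<dots> = 0" using c(3) i by simp
    finally show "poly_act A y f $ i = 0\<^sub>v n $ i" using i by simp
  qed (use poly_act_carrier[OF A y] in auto)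
  ultimately show ?thesis using that by blast
qed

section \<open>An integral Perron-Frobenius eigenvector\<close>

definition int_adjoin :: "complex \<Rightarrow> complex set" where
  "int_adjoin l = range (\<lambda>f. poly (map_poly of_int f) l)"

lemma int_adjoin_closed:
  "of_int k \<in> int_adjoin l" "l \<in> int_adjoin l"
  "x \<in> int_adjoin l \<Longrightarrow> y \<in> int_adjoin l \<Longrightarrow> x + y \<in> int_adjoin l"
  "x \<in> int_adjoin l \<Longrightarrow> y \<in> int_adjoin l \<Longrightarrow> x * y \<in> int_adjoin l"
proof -
  show "of_int k \<in> int_adjoin l"
    unfolding int_adjoin_def by (rule range_eqI[of _ _ "[:k:]"]) (cases "k = 0"; simp add: map_poly_pCons)
  show "l \<in> int_adjoin l"
    unfolding int_adjoin_def by (rule range_eqI[of _ _ "[:0, 1:]"]) (simp add: map_poly_pCons)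
  assume "x \<in> int_adjoin l" "y \<in> int_adjoin l"
  then obtain f g where fg: "x = poly (map_poly of_int f) l" "y = poly (map_poly of_int g) l"
    by (auto simp: int_adjoin_def)
  show "x + y \<in> int_adjoin l"
    unfolding int_adjoin_def by (rule range_eqI[of _ _ "f + g"]) (simp add: fg hom_distribs)
  show "x * y \<in> int_adjoin l"
    unfolding int_adjoin_def by (rule range_eqI[of _ _ "f * g"]) (simp add: fg hom_distribs)
qed

lemma int_adjoin_sum: "(\<And>i. i \<in> I \<Longrightarrow> f i \<in> int_adjoin l) \<Longrightarrow> sum f I \<in> int_adjoin l"
  by (induction I rule: infinite_finite_induct)
     (use int_adjoin_closed(1)[of 0] in \<open>auto intro: int_adjoin_closed\<close>)

text \<open>Division by the monic \<open>X - l\<close> creates no denominators: the coefficients of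
  the quotient are intermediate values of Horner's rule at \<open>l\<close>. The final value is
  carried along for the induction.\<close>

lemma int_adjoin_synthetic_div:
  assumes "\<And>k. Polynomial.coeff f k \<in> int_adjoin l"
  shows "Polynomial.coeff (synthetic_div f l) k \<in> int_adjoin l \<and> poly f l \<in> int_adjoin l"
  using assms
proof (induction f arbitrary: k)
  case 0
  then show ?case using int_adjoin_closed(1)[of 0] by simp
next
  case (pCons a f)
  have "Polynomial.coeff f k \<in> int_adjoin l" for k using pCons.prems[of "Suc k"] by simp
  then have IH: "Polynomial.coeff (synthetic_div f l) k \<in> int_adjoin l" "poly f l \<in> int_adjoin l" for k
    using pCons.IH by blast+
  have "a \<in> int_adjoin l" using pCons.prems[of 0] by simp
  then show ?case
    using IH by (cases k) (auto intro: int_adjoin_closed)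
qed

context pf_matrix
begin

text \<open>A relation of minimal degree between the iterates of a unit vector, with coefficients in
  \<open>\<int>[l]\<close>, is divisible by \<open>x - l\<close>; the quotient yields the eigenvector.\<close>
lemma ex_integral_eigenvector:
  obtains x where "x \<in> carrier_vec n" "x \<noteq> 0\<^sub>v n" "cmat M *\<^sub>v x = l \<cdot>\<^sub>v x"
    "\<And>i. i < n \<Longrightarrow> x $ i \<in> int_adjoin l"
proof -
  \<comment> \<open>This vector pairs to a nonzero number with any positive row eigenvector, so
    \<open>l\<close> is a root of every polynomial annihilating it. Its integer copy
    \<open>eI\<close> provides an annihilating polynomial with integer coefficients.\<close>
  define e where "e = (unit_vec n 0 :: complex vec)"
  have e: "e \<in> carrier_vec n" by (simp add: e_def)
  define eI where "eI = (unit_vec n 0 :: int vec)"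
  have eI: "eI \<in> carrier_vec n" by (simp add: eI_def)
  have e_eI: "e = map_vec of_int eI" by (auto simp: e_def eI_def unit_vec_def)
  define Q where "Q f \<longleftrightarrow> f \<noteq> 0 \<and> (\<forall>k. Polynomial.coeff f k \<in> int_adjoin l)
    \<and> poly_act (cmat M) e f = 0\<^sub>v n" for f
  obtain f0 where f0: "f0 \<noteq> 0" "poly_act M eI f0 = 0\<^sub>v n"
    using ex_annihilating_poly[OF M eI] .
  have hom: "poly_act (cmat M) e (map_poly of_int f) = map_vec of_int (poly_act M eI f)" for f
  proof (induction f)
    case 0
    then show ?case by (auto simp: poly_act_0[OF Mc e] poly_act_0[OF M eI])
  next
    case (pCons a f)
    have c: "M *\<^sub>v poly_act M eI f \<in> carrier_vec n"
      by (rule mult_mat_vec_carrier[OF M poly_act_carrier[OF M eI]])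
    have "map_poly complex_of_int (pCons a f) = pCons (of_int a) (map_poly of_int f)"
      by (cases "a = 0 \<and> f = 0") (auto simp: map_poly_pCons)
    then have "poly_act (cmat M) e (map_poly of_int (pCons a f))
      = of_int a \<cdot>\<^sub>v e + cmat M *\<^sub>v map_vec of_int (poly_act M eI f)"
      by (simp add: poly_act_pCons[OF Mc e] pCons)
    also have "cmat M *\<^sub>v map_vec of_int (poly_act M eI f) = map_vec of_int (M *\<^sub>v poly_act M eI f)"
      by (rule of_int_hom.mult_mat_vec_hom[OF M poly_act_carrier[OF M eI], symmetric])
    also have "of_int a \<cdot>\<^sub>v e + \<dots> = map_vec of_int (poly_act M eI (pCons a f))"
      unfolding poly_act_pCons[OF M eI] e_eI using c eI M
      by (intro eq_vecI) (auto simp del: index_mult_mat_vec)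
    finally show ?case .
  qed
  have "Q (map_poly of_int f0)"
    unfolding Q_def hom f0(2) using f0(1) int_adjoin_closed(1) by (auto simp: coeff_map_poly)
  then obtain f where f: "Q f" and min: "\<And>g. Q g \<Longrightarrow> Polynomial.degree f \<le> Polynomial.degree g"
    using ex_has_least_nat[of Q "map_poly of_int f0" Polynomial.degree] by blast
  obtain q where q: "q \<in> carrier_vec n" "\<And>i. i < n \<Longrightarrow> q $ i > 0"
    "map_mat of_int (transpose_mat M) *\<^sub>v q = lam \<cdot>\<^sub>v q"
    using pf_matrix.ex_positive_eigenvector[OF pf_transpose] by metis
  let ?q = "map_vec complex_of_real q"
  have qc: "?q \<in> carrier_vec n" using q by simp
  have qM: "transpose_mat (cmat M) *\<^sub>v ?q = l \<cdot>\<^sub>v ?q" by (rule row_eigen_of_real[OF q(1,3)])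
  have "?q \<bullet> e = of_real (q $ 0)" using n_pos q(1) by (simp add: e_def)
  then have qe: "?q \<bullet> e \<noteq> 0" using q(2)[OF n_pos] by simp
  have "poly f l * (?q \<bullet> e) = 0"
    using poly_act_left_eigen[OF Mc e qc qM, of f] f qc by (simp add: Q_def)
  then have fl: "poly f l = 0" using qe by simp
  define g where "g = synthetic_div f l"
  have fg: "f = [:- l, 1:] * g"
    using synthetic_div_correct'[of l f] fl by (simp add: g_def)
  have f_nz: "f \<noteq> 0" using f by (simp add: Q_def)
  have g_nz: "g \<noteq> 0" using f_nz fg by auto
  have gc: "Polynomial.coeff g k \<in> int_adjoin l" for k
    using int_adjoin_synthetic_div[of f l k] f by (simp add: Q_def g_def)
  have "Polynomial.degree f = Suc (Polynomial.degree g)"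
    unfolding fg using g_nz by (subst degree_mult_eq) auto
  then have "\<not> Q g" using min[of g] by auto
  then have nz: "poly_act (cmat M) e g \<noteq> 0\<^sub>v n" using g_nz gc by (simp add: Q_def)
  define x where "x = poly_act (cmat M) e g"
  have x: "x \<in> carrier_vec n" unfolding x_def by (rule poly_act_carrier[OF Mc e])
  have Mx: "cmat M *\<^sub>v x \<in> carrier_vec n" by (rule mult_mat_vec_carrier[OF Mc x])
  have "cmat M *\<^sub>v x - l \<cdot>\<^sub>v x = 0\<^sub>v n"
    using poly_act_linear_factor[OF Mc e, of l g] f fg by (simp add: Q_def x_def)
  then have ev: "cmat M *\<^sub>v x = l \<cdot>\<^sub>v x"
    using Mx x by (metis (no_types, lifting) carrier_vecD eq_vecI
        index_minus_vec(1) index_zero_vec(1) right_minus_eq smult_carrier_vec)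
  have "\<forall>i<n. poly_act (cmat M) e h $ i \<in> int_adjoin l"
    if "\<And>k. Polynomial.coeff h k \<in> int_adjoin l" for h
    using that
  proof (induction h)
    case 0
    then show ?case using int_adjoin_closed(1)[of 0] by (simp add: poly_act_0[OF Mc e])
  next
    case (pCons a h)
    have u: "poly_act (cmat M) e h \<in> carrier_vec n" by (rule poly_act_carrier[OF Mc e])
    have IH: "\<forall>i<n. poly_act (cmat M) e h $ i \<in> int_adjoin l"
      using pCons.prems[of "Suc _"] by (intro pCons.IH) simp
    have a: "a \<in> int_adjoin l" using pCons.prems[of 0] by simp
    show ?case
    proof (intro allI impI)
      fix i assume i: "i < n"
      have 1: "poly_act (cmat M) e (pCons a h) $ i = a * e $ i + (cmat M *\<^sub>v poly_act (cmat M) e h) $ i"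
        unfolding poly_act_pCons[OF Mc e] using i e carrier_vecD[OF mult_mat_vec_carrier[OF Mc u]]
        by (simp del: index_mult_mat_vec dim_mult_mat_vec)
      have "e $ i = of_int (eI $ i)" using i eI by (simp add: e_eI)
      then have 2: "a * e $ i \<in> int_adjoin l" using a by (simp add: int_adjoin_closed)
      have "(cmat M *\<^sub>v poly_act (cmat M) e h) $ i
        = (\<Sum>j<n. of_int (M $$ (i, j)) * poly_act (cmat M) e h $ j)"
        unfolding mult_mat_vec_index[OF Mc u i] using i M by (intro sum.cong) auto
      also have "\<dots> \<in> int_adjoin l"
        using IH by (intro int_adjoin_sum int_adjoin_closed(4) int_adjoin_closed(1)) auto
      finally show "poly_act (cmat M) e (pCons a h) $ i \<in> int_adjoin l"
        using 1 2 int_adjoin_closed(3) by simp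
    qed
  qed
  then have "x $ i \<in> int_adjoin l" if "i < n" for i using gc that unfolding x_def by blast
  then show ?thesis using that x nz ev by (simp add: x_def)
qed

end

section \<open>Generated number fields\<close>

lemma subfield_gen_field: "subfield (gen_field S) class_ring"
  unfolding gen_field_def by (rule field.generate_field_is_subfield[OF class_field]) simp

lemma gen_field_incl: "S \<subseteq> gen_field S"
  unfolding gen_field_def by (auto intro: generate_field.incl)

lemma gen_field_subset: "subfield K class_ring \<Longrightarrow> S \<subseteq> K \<Longrightarrow> gen_field S \<subseteq> K"
  unfolding gen_field_def by (rule field.generate_field_min_subfield1[OF class_field]) auto

lemma eval_snoc:
  "ring.eval class_ring (ps @ [a]) x = x * ring.eval class_ring ps x + (a :: complex)"
  by (induction ps)
    (auto simp: ring.eval.simps[OF class_ring.ring_axioms] class_ring_simps algebra_simps)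

text \<open>\<open>eval\<close> reads coefficient lists from the leading coefficient downwards,
  hence the reversal.\<close>

lemma eval_rev_coeffs:
  "ring.eval class_ring (rev (Polynomial.coeffs p)) x = poly p (x :: complex)"
  by (induction p)
    (auto simp: eval_snoc cCons_def ring.eval.simps[OF class_ring.ring_axioms] class_ring_simps)

lemma algebraic_int_imp_algebraic_over_Rats:
  fixes x :: complex
  assumes "algebraic_int x"
  shows "(ring.algebraic class_ring over \<rat>) x"
proof -
  obtain p where p: "Polynomial.coeff p (Polynomial.degree p) = 1" "\<forall>i. Polynomial.coeff p i \<in> \<int>" "poly p x = 0"
    using assms by (auto simp: algebraic_int.simps)
  let ?cs = "rev (Polynomial.coeffs p)"
  have p0: "p \<noteq> 0" using p(1) by auto
  have "set ?cs \<subseteq> \<rat>"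
    using p(2) Ints_subset_Rats by (auto simp: coeffs_def)
  moreover have "hd ?cs = 1"
    using p p0 by (simp add: hd_rev last_coeffs_eq_coeff_degree)
  ultimately have "?cs \<in> carrier (univ_poly class_ring \<rat>)"
    by (simp add: univ_poly_def polynomial_def)
  moreover have "?cs \<noteq> []" using p0 by simp
  moreover have "ring.eval class_ring ?cs x = \<zero>\<^bsub>class_ring\<^esub>"
    using p(3) by (simp add: eval_rev_coeffs)
  ultimately show ?thesis by (rule ring.algebraicI[OF class_ring.ring_axioms])
qed

text \<open>The generated field coincides with the extension of the rationals obtained by adjoining
  the finitely many algebraic elements of \<open>S\<close> one after the other.\<close>

lemma finite_dimension_gen_field:
  assumes "finite S" "\<And>x. x \<in> S \<Longrightarrow> algebraic_int x"
  shows "ring.finite_dimension class_ring \<rat> (gen_field S)"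
proof -
  obtain xs where xs: "set xs = S" using finite_list[OF assms(1)] by blast
  have dom: "domain (class_ring :: complex ring)" by (rule class_field.domain_axioms)
  have alg: "\<And>x. x \<in> set xs \<Longrightarrow> (ring.algebraic class_ring over \<rat>) x"
    using assms(2) xs by (auto intro: algebraic_int_imp_algebraic_over_Rats)
  let ?K = "ring.finite_extension class_ring \<rat> xs"
  have xsc: "set xs \<subseteq> carrier (class_ring :: complex ring)" by simp
  have K: "subfield ?K class_ring"
    by (rule domain.finite_extension_is_subfield[OF dom subfield_Rats xsc alg])
  have "S \<subseteq> ?K"
    using domain.finite_extension_mem[OF dom subfieldE(1)[OF subfield_Rats] xsc] xs by simp
  then have 1: "gen_field S \<subseteq> ?K" by (rule gen_field_subset[OF K])
  interpret G: complex_subfield "gen_field S"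
    by (rule complex_subfield.intro) (rule subfield_gen_field)
  have "?K \<subseteq> gen_field S"
    by (rule ring.finite_extension_subring_incl[OF class_ring.ring_axioms
          subfieldE(1)[OF subfield_gen_field] G.E_Rats]) (use gen_field_incl xs in auto)
  then have "gen_field S = ?K" using 1 by simp
  then show ?thesis
    using domain.finite_extension_finite_dimension(1)[OF dom subfield_Rats xsc alg] by simp
qed

lemma number_field_extension:
  assumes "finite S" "\<And>x. x \<in> S \<Longrightarrow> algebraic_int x" "finite_field_extension (gen_field S) E"
  shows "number_field E"
proof (intro number_field.intro complex_subfield.intro number_field_axioms.intro)
  show "subfield E class_ring" using assms(3) by (simp add: finite_field_extension_def)
  show "ring.finite_dimension class_ring \<rat> E"
    using ring.telescopic_base_dim(1)[OF class_ring.ring_axioms subfield_Rats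
        subfield_gen_field finite_dimension_gen_field[OF assms(1,2)]] assms(3)
    by (simp add: finite_field_extension_def)
qed

lemma (in complex_subfield) int_adjoin_subset:
  assumes "l \<in> R"
  shows "int_adjoin l \<subseteq> R"
proof
  fix x assume "x \<in> int_adjoin l"
  then obtain f where f: "x = poly (map_poly of_int f) l" by (auto simp: int_adjoin_def)
  have "poly (map_poly of_int f) l \<in> R"
    by (induction f)
      (use assms in \<open>auto simp: map_poly_pCons intro!: E_0 E_add E_mult E_of_int
        algebraic_int_add algebraic_int_mult\<close>)
  then show "x \<in> R" using f by simp
qed

section \<open>Normalized vectors\<close>

text \<open>The ideal of \<open>F\<close> generated by the entries of \<open>v0\<close> becomes principal in \<open>E\<close>, so a
  generator \<open>d\<close> can be divided out; \<open>v\<close> is then a unit multiple of \<open>v0 / d\<close>.\<close>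
lemma (in complex_subfield) normalized_vec_bezout:
  assumes F: "subfield F class_ring" "F \<subseteq> E" and pr: "ideals_become_principal F E"
    and v0: "v0 \<in> carrier_vec n" "v0 \<noteq> 0\<^sub>v n" "\<And>i. i < n \<Longrightarrow> v0 $ i \<in> F"
      "\<And>i. i < n \<Longrightarrow> algebraic_int (v0 $ i)"
    and v: "v = t \<cdot>\<^sub>v v0" "normalized_vec E v"
  obtains a where "\<And>i. i < n \<Longrightarrow> a i \<in> R" "(\<Sum>i<n. a i * v $ i) = 1"
proof -
  let ?OF = "ring_of_integers F" and ?OE = "ring_of_integers E"
  interpret F: complex_subfield F by (rule complex_subfield.intro) (rule F(1))
  have v0R: "v0 $ i \<in> R" if "i < n" for i using v0(3,4)[OF that] F(2) by auto
  have v_index: "v $ i = t * v0 $ i" if "i < n" for i using that v0(1) v(1) by simp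
  \<comment> \<open>\<open>I\<close> lies in the integers of \<open>F\<close>, where the hypothesis
    on ideals applies. \<open>K\<close> has the same generators over the integers of
    \<open>E\<close> and contains the ideal generated by \<open>I\<close> there.\<close>
  define I where "I = {\<Sum>i<n. r i * v0 $ i | r. \<forall>i<n. r i \<in> F.R}"
  define K where "K = {\<Sum>i<n. r i * v0 $ i | r. \<forall>i<n. r i \<in> R}"
  have I: "ideal I ?OF" unfolding I_def by (rule F.ideal_span) (use v0 in auto)
  have K: "ideal K ?OE" unfolding K_def by (rule ideal_span) (use v0R in auto)
  have "I \<subseteq> K" unfolding I_def K_def using F(2) by blast
  then have IK: "Idl\<^bsub>?OE\<^esub> I \<subseteq> K" by (rule roi.genideal_minimal[OF K])
  have IR: "I \<subseteq> carrier ?OE" using \<open>I \<subseteq> K\<close> K by (auto simp: ideal_iff)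
  have v0I: "v0 $ i \<in> I" if i: "i < n" for i
  proof -
    have "v0 $ i = (\<Sum>j<n. (\<lambda>j. if j = i then 1 else 0) j * v0 $ j)"
      using i by (simp add: if_distrib[of "\<lambda>x. x * _"] sum.delta cong: if_cong)
    moreover have "\<forall>j<n. (\<lambda>j. if j = i then 1 else 0) j \<in> F.R" using F.R_0 F.R_1 by simp
    ultimately show ?thesis
      unfolding I_def by (intro CollectI exI[of _ "\<lambda>j. if j = i then 1 else 0"] conjI)
  qed
  have "principalideal (Idl\<^bsub>?OE\<^esub> I) ?OE"
    using pr I by (simp add: ideals_become_principal_def)
  then obtain d where d: "d \<in> R" "Idl\<^bsub>?OE\<^esub> I = Idl\<^bsub>?OE\<^esub> {d}"
    using principalideal.generate by force
  have "d \<in> Idl\<^bsub>?OE\<^esub> I" unfolding d(2) using roi.genideal_self'[of d] d(1) by simp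
  then obtain r where r: "d = (\<Sum>i<n. r i * v0 $ i)" "\<forall>i<n. r i \<in> R"
    using IK unfolding K_def by blast
  have "\<exists>s\<in>R. v0 $ i = s * d" if "i < n" for i
  proof -
    have "v0 $ i \<in> Idl\<^bsub>?OE\<^esub> {d}"
      using v0I[OF that] roi.genideal_self[OF IR] d(2) by blast
    then have "v0 $ i \<in> PIdl\<^bsub>?OE\<^esub> d"
      using roi.cgenideal_eq_genideal[of d] d(1) by simp
    then show ?thesis by (auto simp: cgenideal_def)
  qed
  then have "\<forall>i. \<exists>s. i < n \<longrightarrow> s \<in> R \<and> v0 $ i = s * d" by blast
  then obtain s where s: "\<And>i. i < n \<Longrightarrow> s i \<in> R" "\<And>i. i < n \<Longrightarrow> v0 $ i = s i * d" by metis
  obtain k where k: "k < n" "v0 $ k \<noteq> 0" using v0(1,2) by (metis eq_vecI carrier_vecD index_zero_vec)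
  have d0: "d \<noteq> 0" using s(2)[OF k(1)] k(2) by auto
  have "d * 1 = d * (\<Sum>i<n. r i * s i)"
    by (subst r(1)) (simp add: s(2) sum_distrib_left algebra_simps)
  then have rs: "(\<Sum>i<n. r i * s i) = 1" using d0 by simp
  have vR: "v $ i \<in> R" if "i < n" for i using v(2) v0(1) that by (simp add: normalized_vec_def v(1))
  \<comment> \<open>\<open>e\<close> divides every entry of \<open>v\<close> and is also the
    combination of these entries with coefficients \<open>r i\<close>. Normalization makes it a
    unit, and dividing by it turns the combination into 1.\<close>
  define e where "e = t * d"
  have ve: "v $ i = e * s i" if "i < n" for i
    using that by (simp add: v_index s(2) e_def mult_ac)
  have "(\<Sum>i<n. r i * v $ i) = e * (\<Sum>i<n. r i * s i)"
    by (simp add: ve sum_distrib_left algebra_simps)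
  then have ev: "(\<Sum>i<n. r i * v $ i) = e" using rs by simp
  have eR: "e \<in> R" unfolding ev[symmetric] using r(2) vR by (intro R_sum R_mult) auto
  have "e divides\<^bsub>?OE\<^esub> v $ i" if "i < dim_vec v" for i
    using that v0(1) ve[of i] s(1)[of i] by (auto simp: factor_def v(1))
  then have "e \<in> Units ?OE" using v(2) eR by (simp add: normalized_vec_def)
  then obtain u where u: "u \<in> R" "u * e = 1" by (auto simp: Units_def)
  show ?thesis
  proof (rule that[of "\<lambda>i. u * r i"])
    show "u * r i \<in> R" if "i < n" for i using r(2) u(1) that R_mult by blast
    have "(\<Sum>i<n. u * r i * v $ i) = u * (\<Sum>i<n. r i * v $ i)"
      by (simp add: sum_distrib_left mult.assoc)
    then show "(\<Sum>i<n. u * r i * v $ i) = 1" using u ev by simp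
  qed
qed

text \<open>The Bezout identity writes \<open>c\<close> as a combination of the integral numbers
  \<open>c * x i\<close>.\<close>

lemma (in complex_subfield) bezout_scalar_integral:
  assumes "\<And>i. i < n \<Longrightarrow> a i \<in> R" "(\<Sum>i<n. a i * x i) = 1" "\<And>i. i < n \<Longrightarrow> c * x i \<in> R"
  shows "c \<in> R"
proof -
  have "c = c * (\<Sum>i<n. a i * x i)" using assms(2) by simp
  also have "\<dots> = (\<Sum>i<n. a i * (c * x i))" by (simp add: sum_distrib_left algebra_simps)
  also have "\<dots> \<in> R"
    by (rule R_sum) (use R_mult[OF assms(1,3)] in blast)
  finally show ?thesis .
qed

section \<open>Divisibility by powers of the Perron-Frobenius eigenvalue\<close>

text \<open>Otherwise the descending ideals \<open>I k\<close> of all \<open>x\<close> such that \<open>l ^ k\<close> divides \<open>\<mu> ^ j x\<close> for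
  some \<open>j\<close> have a common nonzero element, so they become stationary; as \<open>l ^ k \<in> I k\<close>, some
  power of \<open>\<mu>\<close> is divisible by \<open>l\<close>.\<close>
lemma (in number_field) infinitely_divisible_eq_0:
  assumes l: "l \<in> R" "l \<noteq> 0" and mu: "\<mu> \<in> R" and P: "P \<in> primes_dividing E l" "\<mu> \<notin> P"
    and t: "t \<in> R" and div: "\<And>k. \<exists>j. \<mu> ^ j * t / l ^ k \<in> R"
  shows "t = 0"
proof (rule ccontr)
  assume t0: "t \<noteq> 0"
  define I where "I k = {x \<in> R. \<exists>j. \<mu> ^ j * x / l ^ k \<in> R}" for k
  have idl: "ideal (I k) OE" for k
  proof (rule ideal_linearI)
    show "I k \<subseteq> R" by (auto simp: I_def)
    show "0 \<in> I k" using R_0 by (auto simp: I_def)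
    fix x y r assume "x \<in> I k" "y \<in> I k" and r: "r \<in> R"
    then obtain i j where x: "x \<in> R" "\<mu> ^ i * x / l ^ k \<in> R"
      and y: "y \<in> R" "\<mu> ^ j * y / l ^ k \<in> R" by (auto simp: I_def)
    have "\<mu> ^ (i + j) * (x + r * y) / l ^ k
      = \<mu> ^ j * (\<mu> ^ i * x / l ^ k) + \<mu> ^ i * (r * (\<mu> ^ j * y / l ^ k))"
      using l(2) by (simp add: power_add field_simps)
    also have "\<dots> \<in> R"
      by (rule R_add[OF R_mult[OF R_power[OF mu] x(2)] R_mult[OF R_power[OF mu] R_mult[OF r y(2)]]])
    finally show "x + r * y \<in> I k" unfolding I_def using R_add[OF x(1) R_mult[OF r y(1)]] by blast
  qed
  have tI: "t \<in> I k" for k using t div by (simp add: I_def)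
  have tt: "t \<in> (\<lambda>r. t * r) ` R" by (rule image_eqI[of _ _ 1]) (use R_1 in auto)
  \<comment> \<open>A positive integer that is a multiple of \<open>t\<close> lies in every
    \<open>I k\<close>, as the rank function requires.\<close>
  obtain N where N: "N > 0" "of_nat N \<in> (\<lambda>r. t * r) ` R"
    using nonzero_ideal_contains_nat[OF ideal_principal[OF t] tt t0] .
  obtain r where r: "r \<in> R" "of_nat N = t * r" using N(2) by blast
  have NI: "of_nat N \<in> I k" for k
    using ideal_multiple[OF tI idl r(1)] r(2) by (simp add: mult.commute)
  have sub: "I (Suc k) \<subseteq> I k" for k
  proof
    fix x assume "x \<in> I (Suc k)"
    then obtain j where x: "x \<in> R" "\<mu> ^ j * x / l ^ Suc k \<in> R" by (auto simp: I_def)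
    have "\<mu> ^ j * x / l ^ k = l * (\<mu> ^ j * x / l ^ Suc k)" using l(2) by simp
    also have "\<dots> \<in> R" by (rule R_mult[OF l(1) x(2)])
    finally show "x \<in> I k" using x(1) by (auto simp: I_def)
  qed
  obtain rk :: "complex set \<Rightarrow> nat" and bd where
    rk: "\<And>I. ideal I OE \<Longrightarrow> of_nat N \<in> I \<Longrightarrow> rk I \<le> bd"
    "\<And>I J. ideal I OE \<Longrightarrow> ideal J OE \<Longrightarrow> of_nat N \<in> I \<Longrightarrow> I \<subset> J \<Longrightarrow> rk I < rk J"
    using ex_ideal_rank[OF N(1)] by blast
  have "\<exists>k. I (Suc k) = I k"
  proof (rule ccontr)
    assume "\<nexists>k. I (Suc k) = I k"
    then have "I (Suc k) \<subset> I k" for k using sub by blast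
    then have dec: "rk (I (Suc k)) < rk (I k)" for k by (intro rk(2) idl NI)
    have "rk (I k) + k \<le> rk (I 0)" for k
    proof (induction k)
      case (Suc k)
      then show ?case using dec[of k] by simp
    qed simp
    from this[of "Suc (rk (I 0))"] show False by simp
  qed
  then obtain k where k: "I (Suc k) = I k" by blast
  have "\<mu> ^ 0 * l ^ k / l ^ k \<in> R" using l(2) R_1 by simp
  then have "l ^ k \<in> I k" unfolding I_def using R_power[OF l(1), of k] by blast
  then have "l ^ k \<in> I (Suc k)" using k by simp
  then obtain j where "\<mu> ^ j * l ^ k / l ^ Suc k \<in> R" unfolding I_def by blast
  then have "\<mu> ^ j / l \<in> R" using l(2) by (simp add: field_simps)
  then have "\<mu> ^ j / l * l \<in> P"
    using P(1) ideal_multiple[of l P] nf_primesD(1) unfolding primes_dividing_def by blast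
  then have "\<mu> ^ j \<in> P" using l(2) by simp
  then show False using prime_power_mem[OF _ mu] P by (auto simp: primes_dividing_def)
qed

text \<open>Compared with \<open>poly_act_linear_factor\<close>, this shows that passing from
  \<open>y\<close> to \<open>(A - c) y\<close> removes the factor \<open>X - c\<close> from an
  annihilating polynomial, which drives an induction on the degree.\<close>

lemma poly_act_linear_factor_vec:
  fixes A :: "'a :: comm_ring_1 mat"
  assumes A: "A \<in> carrier_mat n n" and y: "y \<in> carrier_vec n"
  shows "poly_act A (A *\<^sub>v y - c \<cdot>\<^sub>v y) f = A *\<^sub>v poly_act A y f - c \<cdot>\<^sub>v poly_act A y f"
proof (induction f)
  case 0
  have "A *\<^sub>v 0\<^sub>v n = 0\<^sub>v n" using A by (intro eq_vecI) (auto simp: scalar_prod_def)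
  then show ?case using A y by (auto simp: poly_act_0[OF A])
next
  case (pCons a f)
  define u where "u = poly_act A y f"
  have u: "u \<in> carrier_vec n" unfolding u_def by (rule poly_act_carrier[OF A y])
  have Ay: "A *\<^sub>v y \<in> carrier_vec n" and Au: "A *\<^sub>v u \<in> carrier_vec n"
    using mult_mat_vec_carrier[OF A] y u by auto
  have AAu: "A *\<^sub>v (A *\<^sub>v u) \<in> carrier_vec n" by (rule mult_mat_vec_carrier[OF A Au])
  have z: "A *\<^sub>v y - c \<cdot>\<^sub>v y \<in> carrier_vec n" using Ay y by simp
  have 1: "A *\<^sub>v (A *\<^sub>v u - c \<cdot>\<^sub>v u) = A *\<^sub>v (A *\<^sub>v u) - c \<cdot>\<^sub>v (A *\<^sub>v u)"
    using mult_minus_distrib_mat_vec[OF A Au, of "c \<cdot>\<^sub>v u"] mult_mat_vec_smult[OF A u] u by simp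
  have 2: "A *\<^sub>v (a \<cdot>\<^sub>v y + A *\<^sub>v u) = a \<cdot>\<^sub>v (A *\<^sub>v y) + A *\<^sub>v (A *\<^sub>v u)"
    using mult_add_distrib_mat_vec[OF A, of "a \<cdot>\<^sub>v y" "A *\<^sub>v u"] mult_mat_vec_smult[OF A y] y Au by simp
  show ?case
    unfolding poly_act_pCons[OF A z] poly_act_pCons[OF A y] pCons u_def[symmetric] 1 2
    using Ay Au AAu y u
    by (intro eq_vecI) (auto simp: carrier_vecD[OF Ay] carrier_vecD[OF Au] carrier_vecD[OF AAu]
        algebra_simps simp del: index_mult_mat_vec dim_mult_mat_vec)
qed

lemma vec_eq_if_minus_0:
  fixes x y :: "'a :: group_add vec"
  assumes "x - y = 0\<^sub>v n" "x \<in> carrier_vec n" "y \<in> carrier_vec n"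
  shows "x = y"
proof (rule eq_vecI)
  fix i assume "i < dim_vec y"
  then have "i < n" using assms(3) by simp
  then show "x $ i = y $ i" using arg_cong[OF assms(1), of "\<lambda>v. v $ i"] assms(2,3) by simp
qed (use assms in auto)

context number_field
begin

text \<open>The exponent \<open>j\<close> depends on \<open>k\<close>, because \<open>J\<close>
  times the \<open>k\<close>-th power of \<open>Ai\<close> becomes integral only after
  multiplication by some uncontrolled power of \<open>B\<close>.\<close>

definition divisible_vec :: "complex mat \<Rightarrow> complex \<Rightarrow> nat \<Rightarrow> complex vec \<Rightarrow> bool" where
  "divisible_vec B l n y \<longleftrightarrow> y \<in> carrier_vec n \<and> (\<forall>i<n. y $ i \<in> R)
     \<and> (\<forall>k. \<exists>j. \<forall>i<n. ((B ^\<^sub>m j) *\<^sub>v y) $ i / l ^ k \<in> R)"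

text \<open>\<open>B - c\<close> has integral entries and commutes with the powers of
  \<open>B\<close>, so the same exponents \<open>j\<close> work.\<close>

lemma divisible_vec_linear_factor:
  assumes B: "B \<in> carrier_mat n n" "\<And>i j. i < n \<Longrightarrow> j < n \<Longrightarrow> B $$ (i, j) \<in> R"
    and y: "divisible_vec B l n y" and c: "c \<in> R"
  shows "divisible_vec B l n (B *\<^sub>v y - c \<cdot>\<^sub>v y)"
proof -
  have yc: "y \<in> carrier_vec n" and yR: "\<And>i. i < n \<Longrightarrow> y $ i \<in> R"
    and yd: "\<And>k. \<exists>j. \<forall>i<n. ((B ^\<^sub>m j) *\<^sub>v y) $ i / l ^ k \<in> R"
    using y by (auto simp: divisible_vec_def)
  have By: "B *\<^sub>v y \<in> carrier_vec n" by (rule mult_mat_vec_carrier[OF B(1) yc])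
  show ?thesis
    unfolding divisible_vec_def
  proof (intro conjI allI impI)
    show "B *\<^sub>v y - c \<cdot>\<^sub>v y \<in> carrier_vec n" using By yc by simp
    fix i assume i: "i < n"
    have "(B *\<^sub>v y - c \<cdot>\<^sub>v y) $ i = (\<Sum>j<n. B $$ (i, j) * y $ j) - c * y $ i"
      using mult_mat_vec_index[OF B(1) yc i] i yc B(1) by simp
    also have "\<dots> \<in> R" by (intro R_diff R_sum R_mult B(2) yR c i) auto
    finally show "(B *\<^sub>v y - c \<cdot>\<^sub>v y) $ i \<in> R" .
  next
    fix k
    obtain j where j: "\<And>i. i < n \<Longrightarrow> ((B ^\<^sub>m j) *\<^sub>v y) $ i / l ^ k \<in> R" using yd[of k] by blast
    define u where "u = (B ^\<^sub>m j) *\<^sub>v y"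
    have P: "B ^\<^sub>m j \<in> carrier_mat n n" using B(1) by simp
    have u: "u \<in> carrier_vec n" unfolding u_def by (rule mult_mat_vec_carrier[OF P yc])
    have eq: "(B ^\<^sub>m j) *\<^sub>v (B *\<^sub>v y - c \<cdot>\<^sub>v y) = B *\<^sub>v u - c \<cdot>\<^sub>v u"
      using mult_minus_distrib_mat_vec[OF P By, of "c \<cdot>\<^sub>v y"] mult_mat_vec_smult[OF P yc]
        pow_mat_mult_vec_Suc[OF B(1) yc, of j] yc by (simp add: u_def)
    show "\<exists>j. \<forall>i<n. ((B ^\<^sub>m j) *\<^sub>v (B *\<^sub>v y - c \<cdot>\<^sub>v y)) $ i / l ^ k \<in> R"
    proof (intro exI[of _ j] allI impI)
      fix i assume i: "i < n"
      have "((B ^\<^sub>m j) *\<^sub>v (B *\<^sub>v y - c \<cdot>\<^sub>v y)) $ i / l ^ k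
        = (\<Sum>h<n. B $$ (i, h) * (u $ h / l ^ k)) - c * (u $ i / l ^ k)"
        unfolding eq using mult_mat_vec_index[OF B(1) u i] i u B(1)
        by (simp add: diff_divide_distrib sum_divide_distrib)
      also have "\<dots> \<in> R" by (intro R_diff R_sum R_mult B(2) c i) (use j i u_def in auto)
      finally show "((B ^\<^sub>m j) *\<^sub>v (B *\<^sub>v y - c \<cdot>\<^sub>v y)) $ i / l ^ k \<in> R" .
    qed
  qed
qed

text \<open>On an eigenvector the \<open>j\<close>-th power of \<open>B\<close> is multiplication by
  \<open>\<mu> ^ j\<close>, so \<open>infinitely_divisible_eq_0\<close> applies to each
  entry.\<close>

lemma divisible_vec_eigen_0:
  assumes B: "B \<in> carrier_mat n n" and l: "l \<in> R" "l \<noteq> 0" and mu: "\<mu> \<in> R"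
    and P: "P \<in> primes_dividing E l" "P \<notin> primes_dividing E \<mu>"
    and y: "divisible_vec B l n y" and ev: "B *\<^sub>v y = \<mu> \<cdot>\<^sub>v y"
  shows "y = 0\<^sub>v n"
proof (rule eq_vecI)
  have yc: "y \<in> carrier_vec n" and yR: "\<And>i. i < n \<Longrightarrow> y $ i \<in> R"
    and yd: "\<And>k. \<exists>j. \<forall>i<n. ((B ^\<^sub>m j) *\<^sub>v y) $ i / l ^ k \<in> R"
    using y by (auto simp: divisible_vec_def)
  show "dim_vec y = dim_vec (0\<^sub>v n)" using yc by simp
  fix i assume "i < dim_vec (0\<^sub>v n)"
  then have i: "i < n" by simp
  have "\<mu> \<notin> P" using P by (auto simp: primes_dividing_def)
  moreover have "\<exists>j. \<mu> ^ j * y $ i / l ^ k \<in> R" for k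
    using yd[of k] pow_mat_mult_eigen[OF B yc ev] i yc by (auto simp del: index_mult_mat_vec)
  ultimately show "y $ i = 0\<^sub>v n $ i"
    using infinitely_divisible_eq_0[OF l mu P(1) _ yR[OF i]] i by simp
qed

end

text \<open>Splitting off the linear factors of an annihilating polynomial, all components for
  eigenvalues other than \<open>l'\<close> vanish.\<close>
lemma (in number_field) divisible_vec_imp_eigen:
  assumes pfB: "pf_matrix B n l'" and l: "l \<in> R" "l \<noteq> 0"
    and evR: "\<And>\<mu>. eigenvalue (cmat B) \<mu> \<Longrightarrow> \<mu> \<in> R"
    and hyp: "\<And>\<mu>. eigenvalue (cmat B) \<mu> \<Longrightarrow> \<mu> \<noteq> l' \<Longrightarrow>
      \<exists>P\<in>primes_dividing E l. P \<notin> primes_dividing E \<mu>"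
    and y: "divisible_vec (cmat B) l n y"
  shows "cmat B *\<^sub>v y = l' \<cdot>\<^sub>v y"
proof -
  interpret B: pf_matrix B n l' by (rule pfB)
  have BR: "cmat B $$ (i, j) \<in> R" if "i < n" "j < n" for i j
    using that B.M R_of_int by simp
  have "y \<in> carrier_vec n" using y by (simp add: divisible_vec_def)
  then obtain f where f: "f \<noteq> 0" "poly_act (cmat B) y f = 0\<^sub>v n"
    using ex_annihilating_poly[OF B.Mc] by blast
  have l'R: "l' \<in> R" using evR B.pf by (simp add: pf_eigenvalue_def)
  show ?thesis using f y
  proof (induction "Polynomial.degree f" arbitrary: f y)
    case 0
    have yc: "y \<in> carrier_vec n" using 0 by (simp add: divisible_vec_def)
    obtain a where a: "f = [:a:]" using 0 by (metis degree_eq_zeroE)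
    have "A0 *\<^sub>v 0\<^sub>v n = 0\<^sub>v n" if "A0 \<in> carrier_mat n n" for A0 :: "complex mat"
      using that by (intro eq_vecI) (auto simp: scalar_prod_def)
    then have B0: "cmat B *\<^sub>v 0\<^sub>v n = 0\<^sub>v n" using B.Mc by blast
    have "a \<cdot>\<^sub>v y = 0\<^sub>v n"
      using 0(3) yc by (simp add: a poly_act_pCons[OF B.Mc yc] poly_act_0[OF B.Mc yc] B0)
    moreover have "a \<noteq> 0" using 0(2) a by auto
    ultimately have "y = 0\<^sub>v n" using yc by (auto simp: vec_eq_iff)
    then show ?case using B0 by auto
  next
    case (Suc d)
    have yc: "y \<in> carrier_vec n" using Suc.prems by (simp add: divisible_vec_def)
    have By: "cmat B *\<^sub>v y \<in> carrier_vec n" by (rule mult_mat_vec_carrier[OF B.Mc yc])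
    obtain \<mu> where "poly f \<mu> = 0"
      using fundamental_theorem_of_algebra_alt[of f] Suc.hyps(2) by (metis degree_pCons_0 nat.simps(3))
    then obtain g where g: "f = [:- \<mu>, 1:] * g" by (metis dvdE poly_eq_0_iff_dvd)
    have g0: "g \<noteq> 0" using g Suc.prems(1) by auto
    have "Polynomial.degree f = Suc (Polynomial.degree g)"
      unfolding g using g0 by (subst degree_mult_eq) auto
    then have dg: "d = Polynomial.degree g" using Suc.hyps(2) by simp
    let ?u = "poly_act (cmat B) y g"
    have u: "?u \<in> carrier_vec n" by (rule poly_act_carrier[OF B.Mc yc])
    have Bu: "cmat B *\<^sub>v ?u \<in> carrier_vec n" by (rule mult_mat_vec_carrier[OF B.Mc u])
    have eq: "cmat B *\<^sub>v ?u - \<mu> \<cdot>\<^sub>v ?u = 0\<^sub>v n"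
      using Suc.prems(2) poly_act_linear_factor[OF B.Mc yc, of \<mu> g] g by simp
    show ?case
    proof (cases "eigenvalue (cmat B) \<mu>")
      case False
      \<comment> \<open>A root that is no eigenvalue can be cancelled: \<open>B - \<mu>\<close> is
        injective, so \<open>g\<close> already annihilates \<open>y\<close>.\<close>
      have "cmat B *\<^sub>v ?u = \<mu> \<cdot>\<^sub>v ?u" using vec_eq_if_minus_0[OF eq Bu] u by simp
      then have "?u = 0\<^sub>v n" using False u B.Mc unfolding eigenvalue_def eigenvector_def by auto
      then show ?thesis using Suc.hyps(1)[OF dg g0 _ Suc.prems(3)] by simp
    next
      case True
      have muR: "\<mu> \<in> R" using evR[OF True] .
      \<comment> \<open>This vector is annihilated by \<open>g\<close>, so by induction it satisfies
        the eigenvector equation for \<open>l'\<close>.\<close>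
      let ?y1 = "cmat B *\<^sub>v y - \<mu> \<cdot>\<^sub>v y"
      have y1: "divisible_vec (cmat B) l n ?y1"
        by (rule divisible_vec_linear_factor[OF B.Mc BR Suc.prems(3) muR])
      have "poly_act (cmat B) ?y1 g = 0\<^sub>v n"
        using eq poly_act_linear_factor_vec[OF B.Mc yc] by simp
      then have ev1: "cmat B *\<^sub>v ?y1 = l' \<cdot>\<^sub>v ?y1" by (rule Suc.hyps(1)[OF dg g0 _ y1])
      show ?thesis
      proof (cases "\<mu> = l'")
        case True
        \<comment> \<open>Here \<open>y\<close> is killed by the square of \<open>B - l'\<close>,
          and by semisimplicity already by \<open>B - l'\<close> itself.\<close>
        then show ?thesis using B.semisimple[OF yc refl] ev1 by simp
      next
        case False
        \<comment> \<open>As \<open>(B - l') (B - \<mu>) y = 0\<close>, the vector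
          \<open>(B - l') y\<close> satisfies the eigenvector equation for \<open>\<mu>\<close>;
          being divisible as well, it vanishes.\<close>
        let ?z = "cmat B *\<^sub>v y - l' \<cdot>\<^sub>v y"
        have z: "divisible_vec (cmat B) l n ?z"
          by (rule divisible_vec_linear_factor[OF B.Mc BR Suc.prems(3) l'R])
        have BBy: "cmat B *\<^sub>v (cmat B *\<^sub>v y) \<in> carrier_vec n"
          by (rule mult_mat_vec_carrier[OF B.Mc By])
        have dist: "cmat B *\<^sub>v (cmat B *\<^sub>v y - c \<cdot>\<^sub>v y) = cmat B *\<^sub>v (cmat B *\<^sub>v y) - c \<cdot>\<^sub>v (cmat B *\<^sub>v y)" for c
          using mult_minus_distrib_mat_vec[OF B.Mc By, of "c \<cdot>\<^sub>v y"] mult_mat_vec_smult[OF B.Mc yc] yc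
          by simp
        have "cmat B *\<^sub>v ?z = \<mu> \<cdot>\<^sub>v ?z"
        proof (rule eq_vecI)
          fix i assume "i < dim_vec (\<mu> \<cdot>\<^sub>v ?z)"
          then have i: "i < n" using yc by simp
          have "(cmat B *\<^sub>v ?y1) $ i = (l' \<cdot>\<^sub>v ?y1) $ i" using ev1 by simp
          then have "(cmat B *\<^sub>v (cmat B *\<^sub>v y)) $ i - \<mu> * (cmat B *\<^sub>v y) $ i
            = l' * ((cmat B *\<^sub>v y) $ i - \<mu> * y $ i)"
            unfolding dist using i yc carrier_vecD[OF By] carrier_vecD[OF BBy]
            by (simp del: index_mult_mat_vec dim_mult_mat_vec)
          then show "(cmat B *\<^sub>v ?z) $ i = (\<mu> \<cdot>\<^sub>v ?z) $ i"
            unfolding dist using i yc carrier_vecD[OF By] carrier_vecD[OF BBy]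
            by (simp del: index_mult_mat_vec dim_mult_mat_vec add: algebra_simps)
        qed (use B.M yc in auto)
        moreover obtain P where "P \<in> primes_dividing E l" "P \<notin> primes_dividing E \<mu>"
          using hyp[OF True False] by blast
        ultimately have "?z = 0\<^sub>v n"
          using divisible_vec_eigen_0[OF B.Mc l muR _ _ z] by blast
        then show ?thesis using vec_eq_if_minus_0[OF _ By] yc by simp
      qed
    qed
  qed
qed

section \<open>Dimension groups\<close>

abbreviation qmat :: "int mat \<Rightarrow> rat mat" where "qmat A \<equiv> map_mat of_int A"

lemma mem_dim_group_iff:
  assumes "A \<in> carrier_mat n n"
  shows "g \<in> dim_group A \<longleftrightarrow> g \<in> carrier_vec n \<and>
    (\<exists>k. \<exists>z\<in>carrier_vec n. (qmat A ^\<^sub>m k) *\<^sub>v g = map_vec of_int (z :: int vec))"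
  using assms by (auto simp: dim_group_def)

lemma mem_dim_group_cone_iff:
  assumes "A \<in> carrier_mat n n"
  shows "g \<in> dim_group_cone A \<longleftrightarrow> g \<in> carrier_vec n \<and>
    (\<exists>k. \<exists>z\<in>carrier_vec n. (\<forall>i<n. 0 \<le> z $ i) \<and>
      (qmat A ^\<^sub>m k) *\<^sub>v g = map_vec of_int (z :: int vec))"
  using assms by (auto simp: dim_group_cone_def)

lemma dim_group_cone_subset: "A \<in> carrier_mat n n \<Longrightarrow> dim_group_cone A \<subseteq> dim_group A"
  unfolding subset_iff mem_dim_group_iff mem_dim_group_cone_iff by blast

lemma integral_power_mono:
  assumes A: "A \<in> carrier_mat n n" and g: "g \<in> carrier_vec n"
    and k: "\<exists>z\<in>carrier_vec n. (qmat A ^\<^sub>m k) *\<^sub>v g = map_vec of_int (z :: int vec)" and "k \<le> j"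
  shows "\<exists>z\<in>carrier_vec n. (qmat A ^\<^sub>m j) *\<^sub>v g = map_vec of_int (z :: int vec)"
  using \<open>k \<le> j\<close>
proof (induction j rule: dec_induct)
  case base
  then show ?case by (rule k)
next
  case (step j)
  have qA: "qmat A \<in> carrier_mat n n" using A by simp
  obtain z where z: "z \<in> carrier_vec n" "(qmat A ^\<^sub>m j) *\<^sub>v g = map_vec of_int z"
    using step by blast
  have "(qmat A ^\<^sub>m Suc j) *\<^sub>v g = map_vec of_int (A *\<^sub>v z)"
    unfolding pow_mat_mult_vec_Suc(2)[OF qA g] z(2)
    by (rule of_int_hom.mult_mat_vec_hom[OF A z(1), symmetric])
  then show ?case using mult_mat_vec_carrier[OF A z(1)] by blast
qed

text \<open>A column that has become integral stays so under further powers of \<open>A\<close>;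
  hence the sum of the individual exponents serves all columns at once.\<close>

lemma integral_lift:
  assumes A: "A \<in> carrier_mat n n" and G: "G \<in> carrier_mat n n"
    and cols: "\<And>i. i < n \<Longrightarrow> G *\<^sub>v unit_vec n i \<in> dim_group A"
  obtains k Z where "Z \<in> carrier_mat n n" "(qmat A ^\<^sub>m k) * G = qmat Z"
proof -
  have P: "qmat A ^\<^sub>m k \<in> carrier_mat n n" for k using A by simp
  have "\<forall>i. \<exists>k. i < n \<longrightarrow> (\<exists>z\<in>carrier_vec n. (qmat A ^\<^sub>m k) *\<^sub>v (G *\<^sub>v unit_vec n i) = map_vec of_int (z :: int vec))"
    using cols unfolding mem_dim_group_iff[OF A] by blast
  then obtain k where k: "\<And>i. i < n \<Longrightarrow>
    \<exists>z\<in>carrier_vec n. (qmat A ^\<^sub>m k i) *\<^sub>v (G *\<^sub>v unit_vec n i) = map_vec of_int (z :: int vec)" by metis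
  define K where "K = (\<Sum>i<n. k i)"
  have "\<exists>z\<in>carrier_vec n. (qmat A ^\<^sub>m K) *\<^sub>v (G *\<^sub>v unit_vec n i) = map_vec of_int (z :: int vec)"
    if i: "i < n" for i
  proof (rule integral_power_mono[OF A _ k[OF i]])
    show "G *\<^sub>v unit_vec n i \<in> carrier_vec n" by (rule mult_mat_vec_carrier[OF G]) simp
    show "k i \<le> K" unfolding K_def using i by (intro member_le_sum) auto
  qed
  then have "\<forall>i. \<exists>z. i < n \<longrightarrow> z \<in> carrier_vec n \<and>
    (qmat A ^\<^sub>m K) *\<^sub>v (G *\<^sub>v unit_vec n i) = map_vec of_int (z :: int vec)" by blast
  then obtain z :: "nat \<Rightarrow> int vec" where z: "\<And>i. i < n \<Longrightarrow> z i \<in> carrier_vec n"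
    "\<And>i. i < n \<Longrightarrow> (qmat A ^\<^sub>m K) *\<^sub>v (G *\<^sub>v unit_vec n i) = map_vec of_int (z i)" by metis
  define Z where "Z = mat n n (\<lambda>(r, c). z c $ r)"
  show ?thesis
  proof (rule that[of Z K])
    show "Z \<in> carrier_mat n n" by (simp add: Z_def)
    show "(qmat A ^\<^sub>m K) * G = qmat Z"
    proof (rule eq_matI)
      fix r c assume "r < dim_row (qmat Z)" "c < dim_col (qmat Z)"
      then have rc: "r < n" "c < n" by (auto simp: Z_def)
      have "G *\<^sub>v unit_vec n c = col G c"
        using rc G by (intro eq_vecI) auto
      then have "((qmat A ^\<^sub>m K) * G) $$ (r, c) = ((qmat A ^\<^sub>m K) *\<^sub>v (G *\<^sub>v unit_vec n c)) $ r"
        using rc G carrier_matD[OF P[of K]] by simp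
      also have "\<dots> = qmat Z $$ (r, c)"
        unfolding z(2)[OF rc(2)] using rc z(1)[OF rc(2)] by (simp add: Z_def)
      finally show "((qmat A ^\<^sub>m K) * G) $$ (r, c) = qmat Z $$ (r, c)" .
    qed (use G P[of K] in \<open>auto simp: Z_def simp del: pow_mat_dim\<close>)
  qed
qed

lemma ex_inverse_mat:
  fixes A :: "'a :: field mat"
  assumes "A \<in> carrier_mat n n" "det A \<noteq> 0"
  obtains B where "B \<in> carrier_mat n n" "A * B = 1\<^sub>m n" "B * A = 1\<^sub>m n"
  using det_non_zero_imp_unit[OF assms, of "()"] that by (auto simp: Units_def ring_mat_simps)

section \<open>Rational matrices acting on complex row and column vectors\<close>

abbreviation (input) crow :: "rat mat \<Rightarrow> complex vec \<Rightarrow> complex vec" where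
  "crow U v \<equiv> transpose_mat (map_mat of_rat U) *\<^sub>v v"

abbreviation (input) ccol :: "rat mat \<Rightarrow> complex vec \<Rightarrow> complex vec" where
  "ccol U v \<equiv> map_mat of_rat U *\<^sub>v v"

lemma map_mat_of_rat_qmat: "map_mat of_rat (qmat A) = (map_mat of_int A :: 'a :: field_char_0 mat)"
  by (rule eq_matI) auto

lemma transpose_of_rat_qmat:
  "transpose_mat (map_mat of_rat (qmat M)) = (cmat (transpose_mat M) :: complex mat)"
  unfolding map_mat_of_rat_qmat by auto

lemma of_real_of_rat: "complex_of_real (of_rat r) = of_rat r"
  by (cases r) (simp add: of_rat_rat)

lemma crow_carrier: "U \<in> carrier_mat n n \<Longrightarrow> v \<in> carrier_vec n \<Longrightarrow> crow U v \<in> carrier_vec n"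
  and ccol_carrier: "U \<in> carrier_mat n n \<Longrightarrow> v \<in> carrier_vec n \<Longrightarrow> ccol U v \<in> carrier_vec n"
  by (auto intro!: mult_mat_vec_carrier[of _ n n])

lemma crow_mult:
  assumes U: "U \<in> carrier_mat n n" and Y: "Y \<in> carrier_mat n n" and v: "v \<in> carrier_vec n"
  shows "crow (U * Y) v = crow Y (crow U v)"
proof -
  have c: "map_mat of_rat U \<in> carrier_mat n n" "map_mat of_rat Y \<in> carrier_mat n n" using U Y by auto
  have "transpose_mat (map_mat of_rat (U * Y)) =
    transpose_mat (map_mat of_rat Y) * (transpose_mat (map_mat of_rat U) :: complex mat)"
    unfolding of_rat_hom.mat_hom_mult[OF U Y] by (rule transpose_mult[OF c])
  then show ?thesis using assoc_mult_mat_vec[of _ n n _ n v] c v by simp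
qed

lemma ccol_mult:
  assumes U: "U \<in> carrier_mat n n" and Y: "Y \<in> carrier_mat n n" and v: "v \<in> carrier_vec n"
  shows "ccol (U * Y) v = ccol U (ccol Y v)"
  unfolding of_rat_hom.mat_hom_mult[OF U Y]
  by (rule assoc_mult_mat_vec[of _ n n _ n]) (use assms in auto)

lemma crow_1: "v \<in> carrier_vec n \<Longrightarrow> crow (1\<^sub>m n) v = v"
  and ccol_1: "v \<in> carrier_vec n \<Longrightarrow> ccol (1\<^sub>m n) v = v"
  by (simp_all add: of_rat_hom.mat_hom_one)

lemma crow_smult: "U \<in> carrier_mat n n \<Longrightarrow> v \<in> carrier_vec n \<Longrightarrow> crow U (c \<cdot>\<^sub>v v) = c \<cdot>\<^sub>v crow U v"
  and ccol_smult: "U \<in> carrier_mat n n \<Longrightarrow> v \<in> carrier_vec n \<Longrightarrow> ccol U (c \<cdot>\<^sub>v v) = c \<cdot>\<^sub>v ccol U v"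
  by (auto intro!: mult_mat_vec_smult[of _ n n])

lemma crow_pow_eigen:
  assumes U: "U \<in> carrier_mat n n" and v: "v \<in> carrier_vec n" and ev: "crow U v = k \<cdot>\<^sub>v v"
  shows "crow (U ^\<^sub>m m) v = k ^ m \<cdot>\<^sub>v v"
proof -
  have c: "map_mat of_rat U \<in> carrier_mat n n" "transpose_mat (map_mat of_rat U) \<in> carrier_mat n n"
    using U by auto
  show ?thesis
    unfolding of_rat_hom.mat_hom_pow[OF U] transpose_pow_mat[OF c(1)]
    by (rule pow_mat_mult_eigen[OF c(2) v ev])
qed

lemma ccol_pow_eigen:
  assumes U: "U \<in> carrier_mat n n" and v: "v \<in> carrier_vec n" and ev: "ccol U v = k \<cdot>\<^sub>v v"
  shows "ccol (U ^\<^sub>m m) v = k ^ m \<cdot>\<^sub>v v"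
  unfolding of_rat_hom.mat_hom_pow[OF U]
  by (rule pow_mat_mult_eigen[OF _ v ev]) (use U in simp)

text \<open>\<open>f\<close> and \<open>g\<close> stand for a matrix and its inverse, acting either
  on rows or on columns.\<close>

lemma inverse_eigen:
  fixes f :: "complex vec \<Rightarrow> complex vec"
  assumes fg: "g (f v) = v" and ev: "f v = k \<cdot>\<^sub>v v" and lin: "g (k \<cdot>\<^sub>v v) = k \<cdot>\<^sub>v g v" and k: "k \<noteq> 0"
  shows "g v = (1 / k) \<cdot>\<^sub>v v"
proof -
  have "(1 / k) \<cdot>\<^sub>v (k \<cdot>\<^sub>v g v) = (1 / k) \<cdot>\<^sub>v v" using fg ev lin by metis
  then show ?thesis using k by (simp add: smult_smult_assoc)
qed

lemma (in pf_matrix) eigenvector_multiple: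
  assumes x: "x \<in> carrier_vec n" "x \<noteq> 0\<^sub>v n" "cmat M *\<^sub>v x = l \<cdot>\<^sub>v x"
    and y: "y \<in> carrier_vec n" "cmat M *\<^sub>v y = l \<cdot>\<^sub>v y"
  shows "\<exists>c. y = c \<cdot>\<^sub>v x"
proof -
  obtain p where p: "p \<in> carrier_vec n" "\<And>i. i < n \<Longrightarrow> p $ i > 0" "Mr *\<^sub>v p = lam \<cdot>\<^sub>v p"
    using ex_positive_eigenvector by blast
  obtain s t where st: "x = s \<cdot>\<^sub>v map_vec of_real p" "y = t \<cdot>\<^sub>v map_vec of_real p"
    using eigenvector_unique[OF p] x y by metis
  have "s \<noteq> 0" using x(2) p(1) by (auto simp: st(1))
  then have "y = (t / s) \<cdot>\<^sub>v x" by (simp add: st smult_smult_assoc)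
  then show ?thesis by blast
qed

text \<open>The inverses are parameters so that the locale is symmetric: exchanging \<open>A\<close>
  and \<open>B\<close> and replacing \<open>J\<close> by \<open>Ji\<close> gives another instance,
  and every statement about \<open>J\<close> transfers to its inverse.\<close>

locale pf_iso =
  A: pf_matrix A n l + B: pf_matrix B n l'
  for A B :: "int mat" and n :: nat and l l' :: complex +
  fixes Ai Bi J Ji :: "rat mat"
  assumes Ai: "Ai \<in> carrier_mat n n" "qmat A * Ai = 1\<^sub>m n" "Ai * qmat A = 1\<^sub>m n"
    and Bi: "Bi \<in> carrier_mat n n" "qmat B * Bi = 1\<^sub>m n" "Bi * qmat B = 1\<^sub>m n"
    and J: "J \<in> carrier_mat n n" and Ji: "Ji \<in> carrier_mat n n"
    and JJi: "J * Ji = 1\<^sub>m n" "Ji * J = 1\<^sub>m n"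
    and iso: "dim_group_iso A B (\<lambda>g. J *\<^sub>v g)"
begin

lemma qA: "qmat A \<in> carrier_mat n n" and qB: "qmat B \<in> carrier_mat n n"
  using A.M B.M by auto

lemma J_mem: "g \<in> dim_group A \<Longrightarrow> J *\<^sub>v g \<in> dim_group B"
  using iso by (auto simp: dim_group_iso_def bij_betw_def)

lemma J_cone: "g \<in> dim_group_cone A \<Longrightarrow> J *\<^sub>v g \<in> dim_group_cone B"
  using iso dim_group_cone_subset[OF A.M] by (auto simp: dim_group_iso_def)

lemma Ji_J: "g \<in> carrier_vec n \<Longrightarrow> Ji *\<^sub>v (J *\<^sub>v g) = g"
  and J_Ji: "g \<in> carrier_vec n \<Longrightarrow> J *\<^sub>v (Ji *\<^sub>v g) = g"
  using assoc_mult_mat_vec[OF Ji J, of g] assoc_mult_mat_vec[OF J Ji, of g] JJi by auto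

lemma dim_group_carrier: "g \<in> dim_group A \<Longrightarrow> g \<in> carrier_vec n"
  and dim_group_carrier': "g \<in> dim_group B \<Longrightarrow> g \<in> carrier_vec n"
  by (simp_all add: mem_dim_group_iff[OF A.M] mem_dim_group_iff[OF B.M])

lemma iso_inverse: "dim_group_iso B A (\<lambda>g. Ji *\<^sub>v g)"
proof -
  have surj: "\<exists>x\<in>dim_group A. J *\<^sub>v x = g" if "g \<in> dim_group B" for g
  proof -
    have "(\<lambda>g. J *\<^sub>v g) ` dim_group A = dim_group B"
      using iso by (simp add: dim_group_iso_def bij_betw_def)
    then show ?thesis using that by (metis imageE)
  qed
  have mem: "Ji *\<^sub>v g \<in> dim_group A" if g: "g \<in> dim_group B" for g
    using surj[OF g] Ji_J dim_group_carrier by auto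
  show ?thesis
    unfolding dim_group_iso_def
  proof (intro conjI ballI)
    show "bij_betw (\<lambda>g. Ji *\<^sub>v g) (dim_group B) (dim_group A)"
      by (rule bij_betw_byWitness[of _ "\<lambda>g. J *\<^sub>v g"])
        (auto simp: Ji_J J_Ji dim_group_carrier dim_group_carrier' mem J_mem)
    fix x assume x: "x \<in> dim_group B"
    show "Ji *\<^sub>v (x + y) = Ji *\<^sub>v x + Ji *\<^sub>v y" if "y \<in> dim_group B" for y
      by (rule mult_add_distrib_mat_vec[OF Ji dim_group_carrier'[OF x] dim_group_carrier'[OF that]])
    have "Ji *\<^sub>v x \<in> dim_group_cone A \<longleftrightarrow> J *\<^sub>v (Ji *\<^sub>v x) \<in> dim_group_cone B"
      using iso mem[OF x] by (auto simp: dim_group_iso_def)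
    then show "x \<in> dim_group_cone B \<longleftrightarrow> Ji *\<^sub>v x \<in> dim_group_cone A"
      using J_Ji[OF dim_group_carrier'[OF x]] by simp
  qed
qed

lemma pf_iso_sym: "pf_iso B A n l' l Bi Ai Ji J"
  by unfold_locales (use Ai Bi J Ji JJi iso_inverse in auto)

lemma qA_pow_Suc_Ai:
  assumes "g \<in> carrier_vec n"
  shows "(qmat A ^\<^sub>m Suc k) *\<^sub>v (Ai *\<^sub>v g) = (qmat A ^\<^sub>m k) *\<^sub>v g"
proof -
  have c: "Ai *\<^sub>v g \<in> carrier_vec n" by (rule mult_mat_vec_carrier[OF Ai(1) assms])
  have "qmat A *\<^sub>v (Ai *\<^sub>v g) = g"
    using assoc_mult_mat_vec[OF qA Ai(1) assms] Ai(2) assms by simp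
  then show ?thesis using pow_mat_mult_vec_Suc(1)[OF qA c] by simp
qed

text \<open>One more power of \<open>A\<close> absorbs the inverse, and the dimension group is a
  union over all powers.\<close>

lemma Ai_mem: "g \<in> dim_group A \<Longrightarrow> Ai *\<^sub>v g \<in> dim_group A"
  and Ai_cone: "g \<in> dim_group_cone A \<Longrightarrow> Ai *\<^sub>v g \<in> dim_group_cone A"
  unfolding mem_dim_group_iff[OF A.M] mem_dim_group_cone_iff[OF A.M]
  using qA_pow_Suc_Ai mult_mat_vec_carrier[OF Ai(1)] by metis+

lemma Ai_pow_cone: "g \<in> dim_group_cone A \<Longrightarrow> (Ai ^\<^sub>m k) *\<^sub>v g \<in> dim_group_cone A"
proof (induction k)
  case 0
  then show ?case using Ai(1) by (simp add: mem_dim_group_cone_iff[OF A.M])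
next
  case (Suc k)
  then have g: "g \<in> carrier_vec n" by (simp add: mem_dim_group_cone_iff[OF A.M])
  show ?case unfolding pow_mat_mult_vec_Suc(2)[OF Ai(1) g] by (rule Ai_cone[OF Suc.IH[OF Suc.prems]])
qed

lemma unit_vec_cone:
  assumes i: "i < n"
  shows "unit_vec n i \<in> dim_group_cone A"
  unfolding mem_dim_group_cone_iff[OF A.M]
proof (intro conjI exI[of _ "0::nat"] bexI[of _ "unit_vec n i"])
  show "(qmat A ^\<^sub>m 0) *\<^sub>v unit_vec n i = map_vec of_int (unit_vec n i)"
    using qA by (auto simp: unit_vec_def)
qed (use i in \<open>auto simp: unit_vec_def\<close>)

text \<open>That these columns lie in the cone yields the positivity used in
  \<open>crow_J_eigen\<close>; that they lie in the dimension group yields the integrality in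
  \<open>ex_integral_J_Ai\<close>.\<close>

lemma J_Ai_pow_cone:
  assumes i: "i < n"
  shows "(J * Ai ^\<^sub>m k) *\<^sub>v unit_vec n i \<in> dim_group_cone B"
proof -
  have "(J * Ai ^\<^sub>m k) *\<^sub>v unit_vec n i = J *\<^sub>v ((Ai ^\<^sub>m k) *\<^sub>v unit_vec n i)"
    by (rule assoc_mult_mat_vec[OF J pow_carrier_mat[OF Ai(1)]]) simp
  then show ?thesis using J_cone[OF Ai_pow_cone[OF unit_vec_cone[OF i]]] by simp
qed

text \<open>The functional \<open>x \<mapsto> p' J x\<close> is nonnegative on the cone, that is, all its preimages under
  powers of the transposed matrix are nonnegative.\<close>
lemma crow_J_eigen:
  assumes v': "v' \<in> carrier_vec n" "crow (qmat B) v' = l' \<cdot>\<^sub>v v'"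
  shows "crow (qmat A) (crow J v') = l \<cdot>\<^sub>v crow J v'"
proof -
  interpret AT: pf_matrix "transpose_mat A" n l by (rule A.pf_transpose)
  interpret BT: pf_matrix "transpose_mat B" n l' by (rule B.pf_transpose)
  obtain p where p: "p \<in> carrier_vec n" "\<And>i. i < n \<Longrightarrow> p $ i > 0" "BT.Mr *\<^sub>v p = BT.lam \<cdot>\<^sub>v p"
    using BT.ex_positive_eigenvector by blast
  define rr :: "rat mat \<Rightarrow> real mat" where "rr U = map_mat of_rat U" for U
  have rr: "rr U \<in> carrier_mat n n" "transpose_mat (rr U) \<in> carrier_mat n n"
    if "U \<in> carrier_mat n n" for U
    using that by (auto simp: rr_def)
  have rr_mult: "rr (U * Y) = rr U * rr Y" if "U \<in> carrier_mat n n" "Y \<in> carrier_mat n n" for U Y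
    unfolding rr_def by (rule of_rat_hom.mat_hom_mult[OF that])
  define x where "x k = transpose_mat (rr (J * Ai ^\<^sub>m k)) *\<^sub>v p" for k
  have JA: "J * Ai ^\<^sub>m k \<in> carrier_mat n n" for k using J Ai(1) by simp
  have xc: "x k \<in> carrier_vec n" for k
    unfolding x_def by (rule mult_mat_vec_carrier[OF rr(2)[OF JA] p(1)])
  have Btp: "transpose_mat (rr (qmat B)) *\<^sub>v p = BT.lam \<cdot>\<^sub>v p"
  proof -
    have "transpose_mat (rr (qmat B)) = map_mat of_int (transpose_mat B)"
      unfolding rr_def map_mat_of_rat_qmat by auto
    then show ?thesis using p(3) by simp
  qed
  have nonneg: "0 \<le> x k $ i" if i: "i < n" for k i
  proof -
    define g where "g = (J * Ai ^\<^sub>m k) *\<^sub>v unit_vec n i"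
    obtain j z where z: "z \<in> carrier_vec n" "\<And>i. i < n \<Longrightarrow> 0 \<le> z $ i"
      "(qmat B ^\<^sub>m j) *\<^sub>v g = map_vec of_int (z :: int vec)" and gc: "g \<in> carrier_vec n"
      using J_Ai_pow_cone[OF i, of k] unfolding mem_dim_group_cone_iff[OF B.M] g_def by blast
    let ?gr = "map_vec real_of_rat g"
    have grc: "?gr \<in> carrier_vec n" using gc by simp
    have P: "qmat B ^\<^sub>m j \<in> carrier_mat n n" using qB by simp
    have "x k $ i = x k \<bullet> unit_vec n i" using i xc[of k] by simp
    also have "\<dots> = p \<bullet> (rr (J * Ai ^\<^sub>m k) *\<^sub>v unit_vec n i)"
      unfolding x_def by (rule row_mult_scalar_prod[OF rr(1)[OF JA] p(1)]) simp
    also have "rr (J * Ai ^\<^sub>m k) *\<^sub>v unit_vec n i = ?gr"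
    proof -
      have u: "(unit_vec n i :: real vec) = map_vec of_rat (unit_vec n i)" by (auto simp: unit_vec_def)
      have "map_vec real_of_rat ((J * Ai ^\<^sub>m k) *\<^sub>v unit_vec n i)
        = map_mat of_rat (J * Ai ^\<^sub>m k) *\<^sub>v map_vec of_rat (unit_vec n i)"
        by (rule of_rat_hom.mult_mat_vec_hom[OF JA]) simp
      then show ?thesis unfolding g_def rr_def u by simp
    qed
    finally have xg: "x k $ i = p \<bullet> ?gr" .
    \<comment> \<open>Since \<open>p\<close> is a row eigenvector, multiplying by a power of its
      eigenvalue applies a power of \<open>B\<close> to \<open>g\<close>, which makes it a
      nonnegative integer vector.\<close>
    have "BT.lam ^ j * (p \<bullet> ?gr) = (transpose_mat (rr (qmat B ^\<^sub>m j)) *\<^sub>v p) \<bullet> ?gr"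
    proof -
      have "transpose_mat (rr (qmat B ^\<^sub>m j)) *\<^sub>v p = BT.lam ^ j \<cdot>\<^sub>v p"
        using pow_mat_mult_eigen[OF rr(2)[OF qB] p(1) Btp] transpose_pow_mat[OF rr(1)[OF qB]]
        unfolding rr_def of_rat_hom.mat_hom_pow[OF qB] by simp
      then show ?thesis using p(1) grc by simp
    qed
    also have "\<dots> = p \<bullet> (rr (qmat B ^\<^sub>m j) *\<^sub>v ?gr)"
      by (rule row_mult_scalar_prod[OF rr(1)[OF P] p(1) grc])
    also have "rr (qmat B ^\<^sub>m j) *\<^sub>v ?gr = map_vec of_rat (map_vec of_int z)"
      unfolding rr_def z(3)[symmetric] by (rule of_rat_hom.mult_mat_vec_hom[OF P gc, symmetric])
    also have "p \<bullet> map_vec of_rat (map_vec of_int z) \<ge> 0"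
    proof -
      have zr: "map_vec of_rat (map_vec rat_of_int z) \<in> carrier_vec n" using z(1) by simp
      show ?thesis unfolding scalar_prod_sum[OF zr] using z p
        by (intro sum_nonneg mult_nonneg_nonneg) (auto intro: less_imp_le)
    qed
    finally have "BT.lam ^ j * (p \<bullet> ?gr) \<ge> 0" .
    then show ?thesis
      using xg zero_less_power[OF BT.lam_pos, of j] by (simp add: zero_le_mult_iff not_le[symmetric])
  qed
  have step: "AT.Mr *\<^sub>v x (Suc k) = x k" for k
  proof -
    have AP: "Ai ^\<^sub>m k \<in> carrier_mat n n" using Ai(1) by simp
    have "J * Ai ^\<^sub>m Suc k = J * Ai ^\<^sub>m k * Ai"
      using assoc_mult_mat[OF J AP Ai(1)] by simp
    then have "J * Ai ^\<^sub>m Suc k * qmat A = J * Ai ^\<^sub>m k * (Ai * qmat A)"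
      using assoc_mult_mat[OF JA[of k] Ai(1) qA] by simp
    also have "\<dots> = J * Ai ^\<^sub>m k" unfolding Ai(3) by (rule right_mult_one_mat[OF JA])
    finally have eq: "J * Ai ^\<^sub>m Suc k * qmat A = J * Ai ^\<^sub>m k" .
    have AT: "AT.Mr = transpose_mat (rr (qmat A))"
      unfolding rr_def map_mat_of_rat_qmat by auto
    have "AT.Mr *\<^sub>v x (Suc k)
      = (transpose_mat (rr (qmat A)) * transpose_mat (rr (J * Ai ^\<^sub>m Suc k))) *\<^sub>v p"
      unfolding x_def AT
      by (rule assoc_mult_mat_vec[OF rr(2)[OF qA] rr(2)[OF JA] p(1), symmetric])
    also have "\<dots> = transpose_mat (rr (J * Ai ^\<^sub>m Suc k * qmat A)) *\<^sub>v p"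
      unfolding rr_mult[OF JA qA] transpose_mult[OF rr(1)[OF JA] rr(1)[OF qA]] ..
    finally show ?thesis unfolding eq x_def .
  qed
  have ev0: "AT.Mr *\<^sub>v x 0 = AT.lam \<cdot>\<^sub>v x 0"
    by (rule AT.backward_nonneg_imp_eigen[of x, OF xc nonneg step])
  obtain t where t: "v' = t \<cdot>\<^sub>v map_vec of_real p"
    using BT.eigenvector_unique[OF p v'(1)] v'(2) transpose_of_rat_qmat by metis
  have pc: "map_vec complex_of_real p \<in> carrier_vec n" using p(1) by simp
  have "J * Ai ^\<^sub>m 0 = J" using J Ai(1) by simp
  then have x0: "x 0 = transpose_mat (rr J) *\<^sub>v p" by (simp add: x_def)
  have "crow J (map_vec of_real p) = map_vec of_real (x 0)"
  proof -
    have "map_mat complex_of_real (transpose_mat (rr J)) = transpose_mat (map_mat of_rat J)"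
      using J by (intro eq_matI) (auto simp: rr_def of_real_of_rat)
    then show ?thesis
      unfolding x0 using of_real_hom.mult_mat_vec_hom[OF rr(2)[OF J] p(1)] by metis
  qed
  then have cJ: "crow J v' = t \<cdot>\<^sub>v map_vec of_real (x 0)"
    unfolding t crow_smult[OF J pc] by simp
  have xcc: "map_vec complex_of_real (x 0) \<in> carrier_vec n" using xc by simp
  have "cmat (transpose_mat A) *\<^sub>v map_vec of_real (x 0) = map_vec of_real (AT.Mr *\<^sub>v x 0)"
  proof -
    have "map_mat complex_of_real AT.Mr = cmat (transpose_mat A)" by auto
    then show ?thesis using of_real_hom.mult_mat_vec_hom[OF AT.Mr xc[of 0]] by metis
  qed
  also have "\<dots> = l \<cdot>\<^sub>v map_vec of_real (x 0)"
    unfolding ev0 using xc[of 0] AT.l_eq by (intro eq_vecI) auto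
  finally show ?thesis
    unfolding cJ crow_smult[OF qA xcc] unfolding transpose_of_rat_qmat by (simp add: smult_smult_assoc mult.commute)
qed

lemma crow_inverse:
  assumes "v \<in> carrier_vec n"
  shows "crow J (crow Ji v) = v" "crow Ji (crow J v) = v"
    "crow Ai (crow (qmat A) v) = v" "crow Bi (crow (qmat B) v) = v"
  using crow_mult[OF Ji J assms] crow_mult[OF J Ji assms] crow_mult[OF qA Ai(1) assms]
    crow_mult[OF qB Bi(1) assms] crow_1[OF assms] JJi Ai(2) Bi(2) by metis+

lemma ccol_inverse:
  assumes "v \<in> carrier_vec n"
  shows "ccol J (ccol Ji v) = v" "ccol Ji (ccol J v) = v"
    "ccol Ai (ccol (qmat A) v) = v" "ccol Bi (ccol (qmat B) v) = v"
  using ccol_mult[OF Ji J assms] ccol_mult[OF J Ji assms] ccol_mult[OF Ai(1) qA assms]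
    ccol_mult[OF Bi(1) qB assms] ccol_1[OF assms] JJi Ai(3) Bi(3) by metis+

lemma mult_zero_vec: "U \<in> carrier_mat n n \<Longrightarrow> U *\<^sub>v 0\<^sub>v n = (0\<^sub>v n :: complex vec)"
  by (intro eq_vecI) (auto simp: scalar_prod_def)

lemma crow_J_nz:
  assumes "v \<in> carrier_vec n" "v \<noteq> 0\<^sub>v n"
  shows "crow J v \<noteq> 0\<^sub>v n" "crow Ji v \<noteq> 0\<^sub>v n" "ccol J v \<noteq> 0\<^sub>v n" "ccol Ji v \<noteq> 0\<^sub>v n"
  using crow_inverse(1,2)[OF assms(1)] ccol_inverse(1,2)[OF assms(1)] assms(2) J Ji
    mult_zero_vec[of "transpose_mat (map_mat of_rat J)"] mult_zero_vec[of "transpose_mat (map_mat of_rat Ji)"]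
    mult_zero_vec[of "map_mat of_rat J"] mult_zero_vec[of "map_mat of_rat Ji"]
  by (metis map_carrier_mat transpose_carrier_mat)+

text \<open>Uniqueness of the row eigenvector provides \<open>c\<close>, nonzero because
  \<open>J\<close> is invertible. The equation for \<open>Ji\<close> allows \<open>1 / c\<close> to
  be treated exactly like \<open>c\<close>.\<close>

lemma crow_J_multiple:
  assumes v: "v \<in> carrier_vec n" "v \<noteq> 0\<^sub>v n" "crow (qmat A) v = l \<cdot>\<^sub>v v"
    and v': "v' \<in> carrier_vec n" "v' \<noteq> 0\<^sub>v n" "crow (qmat B) v' = l' \<cdot>\<^sub>v v'"
  obtains c where "c \<noteq> 0" "crow J v' = c \<cdot>\<^sub>v v" "crow Ji v = (1 / c) \<cdot>\<^sub>v v'"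
proof -
  interpret AT: pf_matrix "transpose_mat A" n l by (rule A.pf_transpose)
  have Jv: "crow J v' \<in> carrier_vec n" by (rule crow_carrier[OF J v'(1)])
  obtain c where c: "crow J v' = c \<cdot>\<^sub>v v"
    using AT.eigenvector_multiple[OF v(1,2) _ Jv] v(3) crow_J_eigen[OF v'(1,3)] transpose_of_rat_qmat by metis
  have c0: "c \<noteq> 0"
  proof
    assume "c = 0"
    then have "crow J v' = 0\<^sub>v n" using c v(1) by auto
    then show False using crow_J_nz(1)[OF v'(1,2)] by simp
  qed
  have "v' = c \<cdot>\<^sub>v crow Ji v"
    using crow_inverse(2)[OF v'(1)] crow_smult[OF Ji v(1)] c by metis
  then have "(1 / c) \<cdot>\<^sub>v v' = crow Ji v" using c0 by (simp add: smult_smult_assoc)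
  then show ?thesis using that[OF c0 c] by simp
qed

lemma ex_integral_J_Ai:
  obtains k Z where "Z \<in> carrier_mat n n" "(qmat B ^\<^sub>m k) * (J * Ai ^\<^sub>m m) = qmat Z"
  using integral_lift[OF B.M, of "J * Ai ^\<^sub>m m"] J Ai(1) J_Ai_pow_cone dim_group_cone_subset[OF B.M]
  by (metis mult_carrier_mat pow_carrier_mat subsetD)

lemma ex_integral_J:
  obtains k Z where "Z \<in> carrier_mat n n" "(qmat B ^\<^sub>m k) * J = qmat Z"
proof -
  have "J * Ai ^\<^sub>m 0 = J" using J Ai(1) by simp
  then show ?thesis using ex_integral_J_Ai[of 0] that by metis
qed

text \<open>\<open>l ^ k / l'\<close> is an eigenvalue of the integer matrix \<open>A\<^sup>k J\<inverse> B\<inverse> J\<close>.\<close>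
lemma algebraic_int_power_divide: "\<exists>k. algebraic_int (l ^ k / l')"
proof -
  interpret AT: pf_matrix "transpose_mat A" n l by (rule A.pf_transpose)
  interpret S: pf_iso B A n l' l Bi Ai Ji J by (rule pf_iso_sym)
  \<comment> \<open>Going to the dimension group of \<open>B\<close>, dividing by \<open>B\<close>
    there and returning preserves the dimension group of \<open>A\<close>, so
    \<open>integral_lift\<close> applies to \<open>G\<close>.\<close>
  define G where "G = Ji * (Bi * J)"
  have G: "G \<in> carrier_mat n n" using Ji Bi(1) J by (simp add: G_def)
  have "G *\<^sub>v unit_vec n i \<in> dim_group A" if i: "i < n" for i
  proof -
    have u: "(unit_vec n i :: rat vec) \<in> carrier_vec n" by simp
    have "G *\<^sub>v unit_vec n i = Ji *\<^sub>v (Bi *\<^sub>v (J *\<^sub>v unit_vec n i))"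
      unfolding G_def using assoc_mult_mat_vec[OF Ji, of "Bi * J" n "unit_vec n i"]
        assoc_mult_mat_vec[OF Bi(1) J u] Bi(1) J by simp
    then show ?thesis
      using S.J_mem[OF S.Ai_mem[OF J_mem]] unit_vec_cone[OF i] dim_group_cone_subset[OF A.M] by auto
  qed
  then obtain k Z where Z: "Z \<in> carrier_mat n n" "(qmat A ^\<^sub>m k) * G = qmat Z"
    using integral_lift[OF A.M G] by metis
  obtain v where "eigenvector (cmat (transpose_mat A)) v l"
    using AT.pf by (auto simp: pf_eigenvalue_def eigenvalue_def)
  then have v: "v \<in> carrier_vec n" "v \<noteq> 0\<^sub>v n" "crow (qmat A) v = l \<cdot>\<^sub>v v"
    using A.M by (auto simp: eigenvector_def transpose_of_rat_qmat)
  have u: "crow Ji v \<in> carrier_vec n" by (rule crow_carrier[OF Ji v(1)])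
  have Biu: "crow Bi (crow Ji v) = (1 / l') \<cdot>\<^sub>v crow Ji v"
    by (rule inverse_eigen[where f = "crow (qmat B)", OF crow_inverse(4)[OF u]
          S.crow_J_eigen[OF v(1,3)] crow_smult[OF Bi(1) u] B.l_nz])
  have BJ: "Bi * J \<in> carrier_mat n n" using Bi(1) J by simp
  have P: "qmat A ^\<^sub>m k \<in> carrier_mat n n" using qA by simp
  have "crow (qmat Z) v = crow G (l ^ k \<cdot>\<^sub>v v)"
    unfolding Z(2)[symmetric] crow_mult[OF P G v(1)] crow_pow_eigen[OF qA v(1,3)] ..
  also have "\<dots> = l ^ k \<cdot>\<^sub>v crow J (crow Bi (crow Ji v))"
    unfolding crow_smult[OF G v(1)] unfolding G_def crow_mult[OF Ji BJ v(1)] crow_mult[OF Bi(1) J u] ..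
  also have "\<dots> = l ^ k \<cdot>\<^sub>v ((1 / l') \<cdot>\<^sub>v v)"
    unfolding Biu crow_smult[OF J u] crow_inverse(1)[OF v(1)] ..
  also have "\<dots> = (l ^ k / l') \<cdot>\<^sub>v v" by (simp add: smult_smult_assoc)
  finally have "cmat (transpose_mat Z) *\<^sub>v v = (l ^ k / l') \<cdot>\<^sub>v v" unfolding transpose_of_rat_qmat .
  then have "eigenvalue (cmat (transpose_mat Z)) (l ^ k / l')"
    using v Z(1) unfolding eigenvalue_def eigenvector_def by auto
  then show ?thesis using eigenvalue_int_mat_algebraic_int[of "transpose_mat Z" n] Z(1) by auto
qed

text \<open>A row eigenvector of \<open>A\<close> over the field of \<open>l\<close> is carried by
  the rational matrix \<open>Ji\<close> to a row eigenvector of \<open>B\<close> over the same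
  field. Comparing a nonzero entry before and after applying \<open>B\<close> exhibits
  \<open>l'\<close> as a quotient.\<close>

lemma l'_in_gen_field: "l' \<in> gen_field {l}"
proof -
  interpret AT: pf_matrix "transpose_mat A" n l by (rule A.pf_transpose)
  interpret S: pf_iso B A n l' l Bi Ai Ji J by (rule pf_iso_sym)
  interpret K: complex_subfield "gen_field {l}" by (rule complex_subfield.intro) (rule subfield_gen_field)
  obtain v where v: "v \<in> carrier_vec n" "v \<noteq> 0\<^sub>v n" "cmat (transpose_mat A) *\<^sub>v v = l \<cdot>\<^sub>v v"
    "\<And>i. i < n \<Longrightarrow> v $ i \<in> int_adjoin l"
    using AT.ex_integral_eigenvector by metis
  have "algebraic_int l"
    using eigenvalue_int_mat_algebraic_int[OF A.M] A.pf by (simp add: pf_eigenvalue_def)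
  moreover have "l \<in> gen_field {l}" using gen_field_incl[of "{l}"] by simp
  ultimately have vK: "v $ i \<in> gen_field {l}" if "i < n" for i
    using K.int_adjoin_subset[of l] v(4)[OF that] by blast
  let ?u = "crow Ji v"
  have u: "?u \<in> carrier_vec n" by (rule crow_carrier[OF Ji v(1)])
  have comp: "(crow U y) $ i = (\<Sum>j<n. of_rat (U $$ (j, i)) * y $ j)"
    if "U \<in> carrier_mat n n" "y \<in> carrier_vec n" "i < n" for U y i
    using that mult_mat_vec_index[of "transpose_mat (map_mat of_rat U)" n n y i]
    by (auto simp del: index_mult_mat_vec)
  have uK: "?u $ i \<in> gen_field {l}" if "i < n" for i
    unfolding comp[OF Ji v(1) that] using K.E_Rats vK
    by (intro K.E_sum K.E_mult) auto
  have ev: "crow (qmat B) ?u = l' \<cdot>\<^sub>v ?u" using S.crow_J_eigen v(1,3) transpose_of_rat_qmat by metis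
  obtain i where i: "i < n" "?u $ i \<noteq> 0"
    using crow_J_nz(2)[OF v(1,2)] u by (metis eq_vecI carrier_vecD index_zero_vec)
  have "l' * ?u $ i = (crow (qmat B) ?u) $ i" unfolding ev using i(1) carrier_vecD[OF u] by (simp del: dim_mult_mat_vec index_mult_mat_vec)
  also have "\<dots> \<in> gen_field {l}" unfolding comp[OF qB u i(1)] using uK K.E_Rats
    by (intro K.E_sum K.E_mult) auto
  finally have "l' * ?u $ i \<in> gen_field {l}" .
  then have "l' * ?u $ i / ?u $ i \<in> gen_field {l}" using uK[OF i(1)] by (rule K.E_divide)
  then show ?thesis using i(2) by simp
qed

end

text \<open>\<open>l'\<close> divides a power of \<open>l\<close> in the integers of
  \<open>E\<close>. Exchanging \<open>A\<close> and \<open>B\<close> gives the reverse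
  inclusion.\<close>

lemma (in complex_subfield) primes_dividing_subset:
  assumes "pf_iso A B n l l' Ai Bi J Ji" "l \<in> E" "l' \<in> E"
  shows "primes_dividing E l' \<subseteq> primes_dividing E l"
proof
  interpret pf_iso A B n l l' Ai Bi J Ji by (rule assms(1))
  fix P assume "P \<in> primes_dividing E l'"
  then have P: "P \<in> nf_primes E" "l' \<in> P" by (auto simp: primes_dividing_def)
  have lR: "l \<in> R"
    using assms(2) eigenvalue_int_mat_algebraic_int[OF A.M] A.pf by (simp add: pf_eigenvalue_def)
  obtain k where k: "algebraic_int (l ^ k / l')" using algebraic_int_power_divide by blast
  have "l ^ k / l' \<in> R" using k assms(2,3) by (auto intro: E_divide E_power)
  then have "l ^ k / l' * l' \<in> P" 
    by (rule ideal_multiple[OF P(2) nf_primesD(1)[OF P(1)]])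
  then have "l ^ k \<in> P" using B.l_nz by simp
  then have "l \<in> P" by (rule prime_power_mem[OF P(1) lR])
  then show "P \<in> primes_dividing E l" using P(1) by (simp add: primes_dividing_def)
qed

section \<open>Denominators of the coefficients on normalized eigenvectors\<close>

context complex_subfield
begin

text \<open>A power of \<open>B\<close> makes \<open>J\<close> an integer matrix, which maps the
  integral row \<open>v'\<close> to \<open>l' ^ k * c\<close> times \<open>v\<close>; the Bezout
  identity for \<open>v\<close> then removes the vector.\<close>

lemma crow_coefficient_integral:
  assumes iso: "pf_iso A B n l l' Ai Bi J Ji"
    and v: "v \<in> carrier_vec n" "\<And>i. i < n \<Longrightarrow> a i \<in> R" "(\<Sum>i<n. a i * v $ i) = 1"
    and v': "v' \<in> carrier_vec n" "crow (qmat B) v' = l' \<cdot>\<^sub>v v'" "\<And>i. i < n \<Longrightarrow> v' $ i \<in> R"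
    and c: "crow J v' = c \<cdot>\<^sub>v v"
  shows "\<exists>k. l' ^ k * c \<in> R"
proof -
  interpret pf_iso A B n l l' Ai Bi J Ji by (rule iso)
  obtain k Z where Z: "Z \<in> carrier_mat n n" "(qmat B ^\<^sub>m k) * J = qmat Z" using ex_integral_J by blast
  have P: "qmat B ^\<^sub>m k \<in> carrier_mat n n" using qB by simp
  have "crow (qmat Z) v' = l' ^ k \<cdot>\<^sub>v (c \<cdot>\<^sub>v v)"
    unfolding Z(2)[symmetric] crow_mult[OF P J v'(1)] crow_pow_eigen[OF qB v'(1,2)]
      crow_smult[OF J v'(1)] c ..
  then have eq: "crow (qmat Z) v' = (l' ^ k * c) \<cdot>\<^sub>v v" by (simp add: smult_smult_assoc)
  have "l' ^ k * c * v $ i \<in> R" if i: "i < n" for i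
  proof -
    have "l' ^ k * c * v $ i = crow (qmat Z) v' $ i" unfolding eq using i v(1) by simp
    also have "\<dots> = (\<Sum>j<n. of_int (Z $$ (j, i)) * v' $ j)"
      unfolding map_mat_of_rat_qmat using i Z(1) v'(1)
      by (subst mult_mat_vec_index[of _ n n]) (auto intro!: sum.cong)
    also have "\<dots> \<in> R" by (intro R_sum R_mult R_of_int v'(3)) simp
    finally show ?thesis .
  qed
  then show ?thesis using bezout_scalar_integral[OF v(2,3)] by blast
qed

text \<open>On columns \<open>J\<close> is applied first, so the factor \<open>l' ^ k\<close> arises
  from \<open>w'\<close>, whose Bezout identity removes the vector.\<close>

lemma ccol_coefficient_integral:
  assumes iso: "pf_iso A B n l l' Ai Bi J Ji"
    and w: "w \<in> carrier_vec n" "\<And>i. i < n \<Longrightarrow> w $ i \<in> R"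
    and w': "w' \<in> carrier_vec n" "ccol (qmat B) w' = l' \<cdot>\<^sub>v w'"
      "\<And>i. i < n \<Longrightarrow> a i \<in> R" "(\<Sum>i<n. a i * w' $ i) = 1"
    and c: "ccol J w = c \<cdot>\<^sub>v w'"
  shows "\<exists>k. l' ^ k * c \<in> R"
proof -
  interpret pf_iso A B n l l' Ai Bi J Ji by (rule iso)
  obtain k Z where Z: "Z \<in> carrier_mat n n" "(qmat B ^\<^sub>m k) * J = qmat Z" using ex_integral_J by blast
  have P: "qmat B ^\<^sub>m k \<in> carrier_mat n n" using qB by simp
  have "ccol (qmat Z) w = c \<cdot>\<^sub>v (l' ^ k \<cdot>\<^sub>v w')"
    unfolding Z(2)[symmetric] ccol_mult[OF P J w(1)] c ccol_smult[OF P w'(1)]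
      ccol_pow_eigen[OF qB w'(1,2)] ..
  then have eq: "ccol (qmat Z) w = (l' ^ k * c) \<cdot>\<^sub>v w'"
    by (simp add: smult_smult_assoc mult.commute)
  have "l' ^ k * c * w' $ i \<in> R" if i: "i < n" for i
  proof -
    have "l' ^ k * c * w' $ i = ccol (qmat Z) w $ i" unfolding eq using i w'(1) by simp
    also have "\<dots> = (\<Sum>j<n. of_int (Z $$ (i, j)) * w $ j)"
      unfolding map_mat_of_rat_qmat using i Z(1) w(1)
      by (subst mult_mat_vec_index[of _ n n]) (auto intro!: sum.cong)
    also have "\<dots> \<in> R" by (intro R_sum R_mult R_of_int w(2)) simp
    finally show ?thesis .
  qed
  then show ?thesis using bezout_scalar_integral[OF w'(3,4)] by blast
qed

lemma power_mult_integral_mono: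
  assumes "l \<in> R" "l ^ i * x \<in> R" "i \<le> j"
  shows "l ^ j * x \<in> R"
proof -
  have "l ^ j * x = l ^ (j - i) * (l ^ i * x)"
    using assms(3) by (simp flip: power_add add: mult.assoc[symmetric])
  then show ?thesis using R_mult[OF R_power[OF assms(1)] assms(2)] by metis
qed

text \<open>The bounds for \<open>x\<close> and \<open>1 / x\<close> come from \<open>J\<close> and
  its inverse and involve different eigenvalues; \<open>l ^ d / l'\<close> converts powers of
  \<open>l'\<close> into powers of \<open>l\<close>.\<close>

lemma ex_common_power:
  assumes l: "l \<in> R" and d: "l ^ d / l' \<in> R" "l' \<noteq> 0"
    and 1: "\<exists>k. l' ^ k * x \<in> R" and 2: "\<exists>k. l ^ k * (1 / x) \<in> R"
  obtains k where "l ^ k * x \<in> R" "l ^ k / x \<in> R"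
proof -
  obtain i where i: "l' ^ i * x \<in> R" using 1 by blast
  obtain j where j: "l ^ j * (1 / x) \<in> R" using 2 by blast
  have "l ^ (d * i) * x = (l ^ d / l') ^ i * (l' ^ i * x)"
    using d(2) by (simp add: power_divide power_mult)
  also have "\<dots> \<in> R" by (rule R_mult[OF R_power[OF d(1)] i])
  finally have *: "l ^ (d * i) * x \<in> R" .
  show ?thesis
    using that[of "max (d * i) j"] power_mult_integral_mono[OF l *, of "max (d * i) j"]
      power_mult_integral_mono[OF l j, of "max (d * i) j"] by simp
qed

text \<open>Both \<open>x\<close> and \<open>1 / x\<close> are a power of \<open>1 / l\<close> times
  an integral element.\<close>

lemma unit_adjoin_inverse:
  assumes l: "l \<in> R" "l \<noteq> 0" and x: "x \<noteq> 0" "l ^ k * x \<in> R" "l ^ k / x \<in> R"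
  shows "x \<in> Units (integers_adjoin_inverse E l)"
proof -
  let ?H = "insert (1 / l) (carrier (ring_of_integers E))"
  let ?T = "generate_ring class_ring ?H"
  have sr: "subring ?T class_ring"
    by (rule ring.generate_ring_is_subring[OF class_ring.ring_axioms]) simp
  have mult: "a * b \<in> ?T" if "a \<in> ?T" "b \<in> ?T" for a b
    using subringE(6)[OF sr that] by simp
  have one: "1 \<in> ?T" using subringE(3)[OF sr] by simp
  have RT: "a \<in> ?T" if "a \<in> R" for a using that by (intro generate_ring.incl) simp
  have inv: "(1 / l) ^ j \<in> ?T" for j
  proof (induction j)
    case (Suc j)
    have "1 / l \<in> ?T" by (intro generate_ring.incl) simp
    then show ?case unfolding power_Suc by (rule mult[OF _ Suc])
  qed (use one in simp)
  have "x = (1 / l) ^ k * (l ^ k * x)" using l(2) by (simp add: power_divide)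
  then have xT: "x \<in> ?T" using mult[OF inv RT[OF x(2)]] by metis
  have "1 / x = (1 / l) ^ k * (l ^ k / x)" using l(2) by (simp add: power_divide)
  then have iT: "1 / x \<in> ?T" using mult[OF inv RT[OF x(3)]] by metis
  show ?thesis
    unfolding Units_def integers_adjoin_inverse_def using xT iT x(1)
    by (auto intro!: bexI[of _ "1 / x"])
qed

end

text \<open>\<open>normalized_vec_bezout\<close> asks for a proportional vector with integral
  entries in \<open>F\<close>; the eigenvector with entries in \<open>int_adjoin l\<close> is
  one.\<close>

lemma (in complex_subfield) pf_normalized_bezout:
  assumes pf: "pf_matrix M n l" and F: "subfield F class_ring" "F \<subseteq> E" "l \<in> F"
    and pr: "ideals_become_principal F E"
    and x: "x \<in> carrier_vec n" "cmat M *\<^sub>v x = l \<cdot>\<^sub>v x" "normalized_vec E x"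
  obtains a where "\<And>i. i < n \<Longrightarrow> a i \<in> R" "(\<Sum>i<n. a i * x $ i) = 1"
proof -
  interpret M: pf_matrix M n l by (rule pf)
  interpret F: complex_subfield F by (rule complex_subfield.intro) (rule F(1))
  obtain x0 where x0: "x0 \<in> carrier_vec n" "x0 \<noteq> 0\<^sub>v n" "cmat M *\<^sub>v x0 = l \<cdot>\<^sub>v x0"
    "\<And>i. i < n \<Longrightarrow> x0 $ i \<in> int_adjoin l"
    using M.ex_integral_eigenvector by metis
  have "algebraic_int l"
    using eigenvalue_int_mat_algebraic_int[OF M.M] M.pf by (simp add: pf_eigenvalue_def)
  then have "x0 $ i \<in> F.R" if "i < n" for i
    using F.int_adjoin_subset[of l] F(3) x0(4)[OF that] by blast
  then have x0F: "\<And>i. i < n \<Longrightarrow> x0 $ i \<in> F" "\<And>i. i < n \<Longrightarrow> algebraic_int (x0 $ i)" by auto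
  obtain t where t: "x = t \<cdot>\<^sub>v x0" using M.eigenvector_multiple[OF x0(1-3) x(1,2)] by blast
  show ?thesis
    using normalized_vec_bezout[OF F(1,2) pr x0(1,2) x0F t x(3)] that by metis
qed

text \<open>\<open>divisible_vec\<close> speaks of integral vectors, but \<open>J w\<close> may have
  denominators; the product of the denominators of all entries of \<open>J\<close> clears
  them.\<close>

lemma (in complex_subfield) ex_common_denominator:
  assumes J: "J \<in> carrier_mat n n" and w: "w \<in> carrier_vec n" "\<And>i. i < n \<Longrightarrow> w $ i \<in> R"
  obtains D :: int where "D > 0" "\<And>i. i < n \<Longrightarrow> of_int D * (ccol J w) $ i \<in> R"
proof -
  define D where "D = (\<Prod>p\<in>{..<n} \<times> {..<n}. snd (quotient_of (J $$ p)))"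
  have D: "D > 0" unfolding D_def by (intro prod_pos) (auto simp: quotient_of_denom_pos')
  have entry: "of_int D * (of_rat (J $$ (i, j)) :: complex) \<in> R" if ij: "i < n" "j < n" for i j
  proof -
    obtain a d where q: "quotient_of (J $$ (i, j)) = (a, d)" by (cases "quotient_of (J $$ (i, j))")
    have d0: "d > 0" by (rule quotient_of_denom_pos[OF q])
    have "snd (quotient_of (J $$ (i, j))) dvd D"
      unfolding D_def using ij by (intro dvd_prodI) auto
    then obtain e where e: "D = d * e" using q by auto
    have "J $$ (i, j) = of_int a / of_int d" by (rule quotient_of_div[OF q])
    then have "of_int D * (of_rat (J $$ (i, j)) :: complex) = of_int (e * a)"
      using d0 by (simp add: e of_rat_divide)
    then show ?thesis using R_of_int by metis
  qed
  show ?thesis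
  proof (rule that[OF D])
    fix i assume i: "i < n"
    have "of_int D * (ccol J w) $ i = (\<Sum>j<n. (of_int D * of_rat (J $$ (i, j))) * w $ j)"
      using i J w(1)
      by (subst mult_mat_vec_index[of _ n n]) (auto simp: sum_distrib_left mult.assoc intro!: sum.cong)
    also have "\<dots> \<in> R"
      by (rule R_sum) (use R_mult[OF entry[OF i] w(2)] in blast)
    finally show "of_int D * (ccol J w) $ i \<in> R" .
  qed
qed

lemma finite_eigenvalues:
  "A \<in> carrier_mat n n \<Longrightarrow> finite {\<mu>. eigenvalue (A :: complex mat) \<mu>}"
  using card_finite_spectrum(1)[of A n] by (simp add: spectrum_def)

theorem proposition7p1:
  fixes A B :: "int mat" and J :: "rat mat" and n :: nat
    and F E :: "complex set" and l l' :: complex and v v' w w' :: "complex vec"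
  defines "Jc \<equiv> map_mat of_rat J :: complex mat"
  assumes A: "A \<in> carrier_mat n n" "primitive_mat A" "det A \<noteq> 0"
    and B: "B \<in> carrier_mat n n" "primitive_mat B" "det B \<noteq> 0"
    and F: "F = gen_field {\<mu>. eigenvalue (cmat A) \<mu> \<or> eigenvalue (cmat B) \<mu>}"
    and E: "finite_field_extension F E" "ideals_become_principal F E"
    and l: "pf_eigenvalue A l"
    and l': "pf_eigenvalue B l'"
    and v: "row_eigenvector (cmat A) v l" "normalized_vec E v"
    and v': "row_eigenvector (cmat B) v' l'" "normalized_vec E v'"
    and w: "eigenvector (cmat A) w l" "normalized_vec E w"
    and w': "eigenvector (cmat B) w' l'" "normalized_vec E w'"
    and J: "J \<in> carrier_mat n n" "det J \<noteq> 0" "dim_group_iso A B (\<lambda>g. J *\<^sub>v g)"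
  shows "\<exists>c. v' \<^sub>r* Jc = c \<cdot>\<^sub>v v
     \<and> gen_field {l} = gen_field {l'}
     \<and> primes_dividing (gen_field {l}) l = primes_dividing (gen_field {l}) l'
     \<and> ((\<forall>\<mu>. (eigenvalue (cmat A) \<mu> \<and> \<mu> \<noteq> l) \<or> (eigenvalue (cmat B) \<mu> \<and> \<mu> \<noteq> l')
              \<longrightarrow> (\<exists>P \<in> primes_dividing E l. P \<notin> primes_dividing E \<mu>))
         \<longrightarrow> (\<exists>\<xi>. Jc *\<^sub>v w = \<xi> \<cdot>\<^sub>v w'
               \<and> factorizes_into E (primes_dividing E l) \<xi>
               \<and> factorizes_into E (primes_dividing E l) c
               \<and> v' \<bullet> (Jc *\<^sub>v w') = c * (v \<bullet> w')
               \<and> c * (v \<bullet> w') = (c / \<xi>) * (v \<bullet> (Jc *\<^sub>v w))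
               \<and> (\<exists>u \<in> Units (integers_adjoin_inverse E l). v' \<bullet> w' = u * (v \<bullet> w))))"
proof -
  interpret A: pf_matrix A n l by unfold_locales (use A l in auto)
  interpret B: pf_matrix B n l' by unfold_locales (use B l' in auto)
  have "det (qmat A) \<noteq> 0" "det (qmat B) \<noteq> 0" using A(3) B(3) by simp_all
  then obtain Ai Bi where Ai: "Ai \<in> carrier_mat n n" "qmat A * Ai = 1\<^sub>m n" "Ai * qmat A = 1\<^sub>m n"
    and Bi: "Bi \<in> carrier_mat n n" "qmat B * Bi = 1\<^sub>m n" "Bi * qmat B = 1\<^sub>m n"
    using ex_inverse_mat[of "qmat A" n] ex_inverse_mat[of "qmat B" n] A(1) B(1)
    by (metis map_carrier_mat)
  obtain Ji where Ji: "Ji \<in> carrier_mat n n" "J * Ji = 1\<^sub>m n" "Ji * J = 1\<^sub>m n"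
    using ex_inverse_mat[OF J(1,2)] .
  have iso: "pf_iso A B n l l' Ai Bi J Ji" by unfold_locales (use Ai Bi J Ji in auto)
  interpret I: pf_iso A B n l l' Ai Bi J Ji by (rule iso)
  have iso': "pf_iso B A n l' l Bi Ai Ji J" by (rule I.pf_iso_sym)
  interpret S: pf_iso B A n l' l Bi Ai Ji J by (rule iso')
  have T: "transpose_mat (map_mat of_rat (qmat M)) = transpose_mat (cmat M)"
    "cmat (transpose_mat M) = transpose_mat (cmat M)" for M :: "int mat"
    unfolding map_mat_of_rat_qmat by auto
  have vv: "v \<in> carrier_vec n" "v \<noteq> 0\<^sub>v n" "crow (qmat A) v = l \<cdot>\<^sub>v v"
    and vv': "v' \<in> carrier_vec n" "v' \<noteq> 0\<^sub>v n" "crow (qmat B) v' = l' \<cdot>\<^sub>v v'"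
    using v(1) v'(1) A(1) B(1) unfolding row_eigenvector_def T by auto
  have ww: "w \<in> carrier_vec n" "w \<noteq> 0\<^sub>v n" "cmat A *\<^sub>v w = l \<cdot>\<^sub>v w"
    and ww': "w' \<in> carrier_vec n" "w' \<noteq> 0\<^sub>v n" "cmat B *\<^sub>v w' = l' \<cdot>\<^sub>v w'"
    using w(1) w'(1) A(1) B(1) unfolding eigenvector_def by auto
  have cw: "ccol (qmat A) w = l \<cdot>\<^sub>v w" and cw': "ccol (qmat B) w' = l' \<cdot>\<^sub>v w'"
    using ww(3) ww'(3) by (simp_all add: map_mat_of_rat_qmat)
  obtain c where c: "c \<noteq> 0" "crow J v' = c \<cdot>\<^sub>v v" "crow Ji v = (1 / c) \<cdot>\<^sub>v v'"
    using I.crow_J_multiple[OF vv vv'] by blast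
  have fields: "gen_field {l} = gen_field {l'}"
    using gen_field_subset[OF subfield_gen_field, of "{l'}" "{l}"]
      gen_field_subset[OF subfield_gen_field, of "{l}" "{l'}"] I.l'_in_gen_field S.l'_in_gen_field
    by auto
  \<comment> \<open>(ii) concerns primes of the field generated by \<open>l\<close>, which may be
    smaller than \<open>E\<close>, so this field is interpreted on its own.\<close>
  have primes: "primes_dividing (gen_field {l}) l = primes_dividing (gen_field {l}) l'"
  proof -
    interpret K: complex_subfield "gen_field {l}"
      by (rule complex_subfield.intro) (rule subfield_gen_field)
    have "l \<in> gen_field {l}" using gen_field_incl[of "{l}"] by simp
    then show ?thesis
      using K.primes_dividing_subset[OF iso] K.primes_dividing_subset[OF iso'] I.l'_in_gen_field
      by auto
  qed
  \<comment> \<open>The generators of \<open>F\<close> are finitely many algebraic integers, which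
    makes \<open>E\<close> a number field.\<close>
  define S where "S = {\<mu>. eigenvalue (cmat A) \<mu> \<or> eigenvalue (cmat B) \<mu>}"
  have S_int: "algebraic_int \<mu>" if "\<mu> \<in> S" for \<mu>
    using that eigenvalue_int_mat_algebraic_int A(1) B(1) by (auto simp: S_def)
  have "finite S"
    using finite_eigenvalues[OF A.Mc] finite_eigenvalues[OF B.Mc] by (simp add: S_def Collect_disj_eq)
  then interpret E: number_field E
    using number_field_extension[of S E] S_int E(1) F S_def by auto
  have sF: "subfield F class_ring" and FE: "F \<subseteq> E" using E(1) by (auto simp: finite_field_extension_def)
  have SF: "S \<subseteq> F" unfolding F S_def by (rule gen_field_incl)
  have lS: "l \<in> S" "l' \<in> S" using l l' by (auto simp: S_def pf_eigenvalue_def)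
  have SR: "S \<subseteq> E.R" using S_int SF FE by auto
  have lR: "l \<in> E.R" "l' \<in> E.R" using lS SR by auto
  have entries: "x $ i \<in> E.R" if "normalized_vec E x" "x \<in> carrier_vec n" "i < n" for x i
    using that by (auto simp: normalized_vec_def)
  interpret AT: pf_matrix "transpose_mat A" n l by (rule A.pf_transpose)
  interpret BT: pf_matrix "transpose_mat B" n l' by (rule B.pf_transpose)
  have lF: "l \<in> F" "l' \<in> F" using lS SF by auto
  have rowA: "cmat (transpose_mat A) *\<^sub>v v = l \<cdot>\<^sub>v v"
    and rowB: "cmat (transpose_mat B) *\<^sub>v v' = l' \<cdot>\<^sub>v v'"
    using vv(3) vv'(3) by (simp_all add: T)
  obtain a where a: "\<And>i. i < n \<Longrightarrow> a i \<in> E.R" "(\<Sum>i<n. a i * v $ i) = 1"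
    using E.pf_normalized_bezout[OF AT.pf_matrix_axioms sF FE lF(1) E(2) vv(1) rowA v(2)] by blast
  obtain a' where a': "\<And>i. i < n \<Longrightarrow> a' i \<in> E.R" "(\<Sum>i<n. a' i * v' $ i) = 1"
    using E.pf_normalized_bezout[OF BT.pf_matrix_axioms sF FE lF(2) E(2) vv'(1) rowB v'(2)] by blast
  obtain b where b: "\<And>i. i < n \<Longrightarrow> b i \<in> E.R" "(\<Sum>i<n. b i * w $ i) = 1"
    using E.pf_normalized_bezout[OF A.pf_matrix_axioms sF FE lF(1) E(2) ww(1,3) w(2)] by blast
  obtain b' where b': "\<And>i. i < n \<Longrightarrow> b' i \<in> E.R" "(\<Sum>i<n. b' i * w' $ i) = 1"
    using E.pf_normalized_bezout[OF B.pf_matrix_axioms sF FE lF(2) E(2) ww'(1,3) w'(2)] by blast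
  obtain d where "algebraic_int (l ^ d / l')" using I.algebraic_int_power_divide by blast
  then have d: "l ^ d / l' \<in> E.R" using lR E.E_divide E.E_power by simp
  have c_int: "\<exists>k. l' ^ k * c \<in> E.R"
    by (rule E.crow_coefficient_integral[OF iso vv(1) a vv'(1,3) entries[OF v'(2) vv'(1)] c(2)])
  have c_inv: "\<exists>k. l ^ k * (1 / c) \<in> E.R"
    by (rule E.crow_coefficient_integral[OF iso' vv'(1) a' vv(1,3) entries[OF v(2) vv(1)] c(3)])
  obtain kc where kc: "l ^ kc * c \<in> E.R" "l ^ kc / c \<in> E.R"
    using E.ex_common_power[OF lR(1) d B.l_nz c_int c_inv] by blast
  have inE: "x \<in> E" if "l ^ k * x \<in> E.R" for k x
  proof -
    have "l ^ k * x / l ^ k \<in> E" using that lR E.E_divide E.E_power by blast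
    then show ?thesis using A.l_nz by simp
  qed
  have "\<exists>\<xi>. Jc *\<^sub>v w = \<xi> \<cdot>\<^sub>v w'
      \<and> factorizes_into E (primes_dividing E l) \<xi>
      \<and> factorizes_into E (primes_dividing E l) c
      \<and> v' \<bullet> (Jc *\<^sub>v w') = c * (v \<bullet> w')
      \<and> c * (v \<bullet> w') = (c / \<xi>) * (v \<bullet> (Jc *\<^sub>v w))
      \<and> (\<exists>u \<in> Units (integers_adjoin_inverse E l). v' \<bullet> w' = u * (v \<bullet> w))"
    if hyp: "\<forall>\<mu>. (eigenvalue (cmat A) \<mu> \<and> \<mu> \<noteq> l) \<or> (eigenvalue (cmat B) \<mu> \<and> \<mu> \<noteq> l')
              \<longrightarrow> (\<exists>P \<in> primes_dividing E l. P \<notin> primes_dividing E \<mu>)"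
  proof -
    have Jw: "ccol J w \<in> carrier_vec n" by (rule ccol_carrier[OF J(1) ww(1)])
    obtain D :: int where D: "D > 0" "\<And>i. i < n \<Longrightarrow> of_int D * (ccol J w) $ i \<in> E.R"
      using E.ex_common_denominator[OF J(1) ww(1) entries[OF w(2) ww(1)]] by blast
    \<comment> \<open>Applying the integer matrix \<open>Z\<close>, which is \<open>J\<close> times
      \<open>m\<close> factors \<open>Ai\<close> and \<open>k\<close> factors \<open>B\<close> on
      the left, to \<open>w\<close> shows that \<open>k\<close> factors \<open>B\<close> turn
      \<open>J w\<close> into \<open>l ^ m\<close> times an integral vector.\<close>
    have div: "E.divisible_vec (cmat B) l n (of_int D \<cdot>\<^sub>v ccol J w)"
      unfolding E.divisible_vec_def
    proof (intro conjI allI impI)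
      show "of_int D \<cdot>\<^sub>v ccol J w \<in> carrier_vec n" using Jw by simp
      show "(of_int D \<cdot>\<^sub>v ccol J w) $ i \<in> E.R" if "i < n" for i
        using D(2)[OF that] that carrier_vecD[OF Jw] by (simp del: index_mult_mat_vec dim_mult_mat_vec)
      fix m
      obtain k Z where Z: "Z \<in> carrier_mat n n" "(qmat B ^\<^sub>m k) * (J * Ai ^\<^sub>m m) = qmat Z"
        using I.ex_integral_J_Ai by blast
      have P: "qmat B ^\<^sub>m k \<in> carrier_mat n n" "Ai ^\<^sub>m m \<in> carrier_mat n n"
        "J * Ai ^\<^sub>m m \<in> carrier_mat n n"
        using I.qB Ai(1) J(1) by auto
      have Aiw: "ccol Ai w = (1 / l) \<cdot>\<^sub>v w"
        by (rule inverse_eigen[where f = "ccol (qmat A)", OF I.ccol_inverse(3)[OF ww(1)] cw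
              ccol_smult[OF Ai(1) ww(1)] A.l_nz])
      have "ccol (qmat Z) w = (1 / l) ^ m \<cdot>\<^sub>v ccol (qmat B ^\<^sub>m k) (ccol J w)"
        unfolding Z(2)[symmetric] ccol_mult[OF P(1,3) ww(1)] ccol_mult[OF J(1) P(2) ww(1)]
          ccol_pow_eigen[OF Ai(1) ww(1) Aiw] ccol_smult[OF J(1) ww(1)] ccol_smult[OF P(1) Jw] ..
      also have "ccol (qmat B ^\<^sub>m k) (ccol J w) = (cmat B ^\<^sub>m k) *\<^sub>v ccol J w"
        unfolding of_rat_hom.mat_hom_pow[OF I.qB] map_mat_of_rat_qmat ..
      finally have eq: "ccol (qmat Z) w = (1 / l) ^ m \<cdot>\<^sub>v ((cmat B ^\<^sub>m k) *\<^sub>v ccol J w)" .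
      have cPJ: "(cmat B ^\<^sub>m k) *\<^sub>v ccol J w \<in> carrier_vec n"
        by (rule mult_mat_vec_carrier[OF pow_carrier_mat[OF B.Mc] Jw])
      show "\<exists>j. \<forall>i<n. ((cmat B ^\<^sub>m j) *\<^sub>v (of_int D \<cdot>\<^sub>v ccol J w)) $ i / l ^ m \<in> E.R"
      proof (intro exI[of _ k] allI impI)
        fix i assume i: "i < n"
        have "((cmat B ^\<^sub>m k) *\<^sub>v (of_int D \<cdot>\<^sub>v ccol J w)) $ i / l ^ m
          = of_int D * (ccol (qmat Z) w) $ i"
          unfolding eq mult_mat_vec_smult[OF pow_carrier_mat[OF B.Mc] Jw]
          using i carrier_vecD[OF cPJ] A.l_nz
          by (simp add: power_divide del: index_mult_mat_vec dim_mult_mat_vec)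
        also have "\<dots> = of_int D * (\<Sum>j<n. of_int (Z $$ (i, j)) * w $ j)"
          unfolding map_mat_of_rat_qmat using i Z(1) ww(1)
          by (subst mult_mat_vec_index[of _ n n]) (auto intro!: sum.cong)
        also have "\<dots> \<in> E.R"
          by (intro E.R_mult E.R_sum E.R_of_int entries[OF w(2) ww(1)]) simp
        finally show "((cmat B ^\<^sub>m k) *\<^sub>v (of_int D \<cdot>\<^sub>v ccol J w)) $ i / l ^ m \<in> E.R" .
      qed
    qed
    have "cmat B *\<^sub>v (of_int D \<cdot>\<^sub>v ccol J w) = l' \<cdot>\<^sub>v (of_int D \<cdot>\<^sub>v ccol J w)"
      by (rule E.divisible_vec_imp_eigen[OF B.pf_matrix_axioms lR(1) A.l_nz _ _ div])
        (use SR hyp in \<open>auto simp: S_def\<close>)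
    then obtain t where t: "of_int D \<cdot>\<^sub>v ccol J w = t \<cdot>\<^sub>v w'"
      using B.eigenvector_multiple[OF ww', of "of_int D \<cdot>\<^sub>v ccol J w"] Jw by auto
    define \<xi> where "\<xi> = t / of_int D"
    have "(1 / of_int D) \<cdot>\<^sub>v (of_int D \<cdot>\<^sub>v ccol J w) = (1 / of_int D) \<cdot>\<^sub>v (t \<cdot>\<^sub>v w')" using t by simp
    then have xi: "ccol J w = \<xi> \<cdot>\<^sub>v w'" using D(1) by (simp add: smult_smult_assoc \<xi>_def)
    have xi0: "\<xi> \<noteq> 0"
    proof
      assume "\<xi> = 0"
      then have "ccol J w = 0\<^sub>v n" using xi ww'(1) by auto
      then show False using I.crow_J_nz(3)[OF ww(1,2)] by simp
    qed
    have "w = \<xi> \<cdot>\<^sub>v ccol Ji w'"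
      using I.ccol_inverse(2)[OF ww(1)] ccol_smult[OF Ji(1) ww'(1)] xi by metis
    then have "(1 / \<xi>) \<cdot>\<^sub>v w = (1 / \<xi>) \<cdot>\<^sub>v (\<xi> \<cdot>\<^sub>v ccol Ji w')" by simp
    then have xi': "ccol Ji w' = (1 / \<xi>) \<cdot>\<^sub>v w" using xi0 by (simp add: smult_smult_assoc)
    have x_int: "\<exists>k. l' ^ k * \<xi> \<in> E.R"
      by (rule E.ccol_coefficient_integral[OF iso ww(1) entries[OF w(2) ww(1)] ww'(1) cw' b' xi])
    have x_inv: "\<exists>k. l ^ k * (1 / \<xi>) \<in> E.R"
      by (rule E.ccol_coefficient_integral[OF iso' ww'(1) entries[OF w'(2) ww'(1)] ww(1) cw b xi'])
    obtain kx where kx: "l ^ kx * \<xi> \<in> E.R" "l ^ kx / \<xi> \<in> E.R"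
      using E.ex_common_power[OF lR(1) d B.l_nz x_int x_inv] by blast
    have fx: "factorizes_into E (primes_dividing E l) \<xi>"
      by (rule E.factorizes_into_if_unit_outside[OF inE[OF kx(1)] xi0 lR(1) A.l_nz kx])
    have fc: "factorizes_into E (primes_dividing E l) c"
      by (rule E.factorizes_into_if_unit_outside[OF inE[OF kc(1)] c(1) lR(1) A.l_nz kc])
    have pair: "v' \<bullet> ccol J x = c * (v \<bullet> x)" if "x \<in> carrier_vec n" for x
    proof -
      have Jcc: "map_mat of_rat J \<in> carrier_mat n n" using J(1) by simp
      have "v' \<bullet> ccol J x = crow J v' \<bullet> x" by (rule row_mult_scalar_prod[OF Jcc vv'(1) that, symmetric])
      then show ?thesis unfolding c(2) using vv(1) that by simp
    qed
    have e2: "c * (v \<bullet> w') = (c / \<xi>) * (v \<bullet> ccol J w)"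
      unfolding xi using xi0 vv(1) ww'(1) by simp
    \<comment> \<open>The number \<open>v' J w\<close> is evaluated in two ways, with
      \<open>J\<close> acting on the column and on the row.\<close>
    have "\<xi> * (v' \<bullet> w') = c * (v \<bullet> w)"
      using pair[OF ww(1)] unfolding xi using vv'(1) ww'(1) by simp
    then have u: "v' \<bullet> w' = (c / \<xi>) * (v \<bullet> w)" using xi0 by (simp add: field_simps)
    have "l ^ (kc + kx) * (c / \<xi>) = (l ^ kc * c) * (l ^ kx / \<xi>)"
      "l ^ (kc + kx) / (c / \<xi>) = (l ^ kc / c) * (l ^ kx * \<xi>)"
      by (simp_all add: power_add)
    then have "l ^ (kc + kx) * (c / \<xi>) \<in> E.R" "l ^ (kc + kx) / (c / \<xi>) \<in> E.R"
      using E.R_mult[OF kc(1) kx(2)] E.R_mult[OF kc(2) kx(1)] by metis+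
    then have "c / \<xi> \<in> Units (integers_adjoin_inverse E l)"
      using E.unit_adjoin_inverse[OF lR(1) A.l_nz, of "c / \<xi>" "kc + kx"] c(1) xi0 by simp
    then show ?thesis
      unfolding Jc_def using xi fx fc pair[OF ww'(1)] e2 u by blast
  qed
  then show ?thesis unfolding Jc_def using c(2) fields primes by blast
qed

end
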